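(* For a positive integer $n$ let $g(n)$ denote the largest size of a subset $P\subseteq [n]^2$ with distinct slopes. Then, as $n\to\infty$, $$g(n)=\Omega\left(\frac{n^{2/3}(\log\log n)^{1/3}}{\log^{1/3} n}\right),$$ that is, there exist constants $c>0$ and $n_0$ such that for every $n\ge n_0$ there is a subset of the grid $[n]^2$ with distinct slopes and of size at least $c\, n^{2/3}(\log\log n)^{1/3}/(\log n)^{1/3}$.
   Context: $[n]=\{1,\dots,n\}$ and $[n]^2\subset\mathbb{R}^2$ is the grid. A subset $P\subseteq[n]^2$ has distinct slopes if there are no two different pairs $\{p,q\}\neq\{p',q'\}$ of points of $P$ ($p\ne q$, $p'\neq q'$; the two pairs may share a point) such that the line through $p,q$ and the line through $p',q'$ have the same slope (vertical lines are regarded as having the same, infinite, slope). Equivalently, $P$ contains no three collinear points and no four points forming a trapezoid (parallelograms included). *)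

theory Defs
  imports "HOL-Analysis.Analysis" "HOL-Library.Landau_Symbols"
begin

definition grid :: "nat \<Rightarrow> (real \<times> real) set" where
  "grid n = (\<lambda>(i, j). (real i, real j)) ` ({1..n} \<times> {1..n})"

definition slope :: "real \<times> real \<Rightarrow> real \<times> real \<Rightarrow> ereal" where
  "slope p q = (if fst p = fst q then \<infinity> else ereal ((snd q - snd p) / (fst q - fst p)))"

text \<open>
  The two pairs are compared as unordered pairs and may share one point, so a collinear triple
  is excluded as well.
\<close>

definition distinct_slopes :: "(real \<times> real) set \<Rightarrow> bool" where
  "distinct_slopes P \<longleftrightarrow>
     (\<forall>p\<in>P. \<forall>q\<in>P. \<forall>p'\<in>P. \<forall>q'\<in>P.
        p \<noteq> q \<longrightarrow> p' \<noteq> q' \<longrightarrow> {p, q} \<noteq> {p', q'} \<longrightarrow> slope p q \<noteq> slope p' q')"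

definition g :: "nat \<Rightarrow> nat" where
  "g n = Max {card P | P. P \<subseteq> grid n \<and> distinct_slopes P}"

lemma slope_commute: "slope p q = slope q p"
proof -
  have "(snd q - snd p) / (fst q - fst p) = (snd p - snd q) / (fst p - fst q)"
    by (metis minus_diff_eq minus_divide_divide)
  then show ?thesis
    by (simp add: slope_def)
qed

lemma finite_grid: "finite (grid n)"
  by (simp add: grid_def)

lemma finite_g_set: "finite {card P | P. P \<subseteq> grid n \<and> distinct_slopes P}"
proof (rule finite_subset)
  show "{card P | P. P \<subseteq> grid n \<and> distinct_slopes P} \<subseteq> card ` Pow (grid n)"
    by auto
qed (simp add: finite_grid)

lemma g_attained: "\<exists>P. P \<subseteq> grid n \<and> distinct_slopes P \<and> card P = g n"
proof -
  have "card {} \<in> {card P | P. P \<subseteq> grid n \<and> distinct_slopes P}"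
    by (intro CollectI exI[of _ "{}"]) (simp add: distinct_slopes_def)
  then have "g n \<in> {card P | P. P \<subseteq> grid n \<and> distinct_slopes P}"
    unfolding g_def by (intro Max_in finite_g_set) auto
  then show ?thesis
    by auto
qed

lemma g_upper: "P \<subseteq> grid n \<Longrightarrow> distinct_slopes P \<Longrightarrow> card P \<le> g n"
  unfolding g_def by (intro Max_ge finite_g_set) auto

end

theory Submission
  imports Defs "HOL-Real_Asymp.Real_Asymp"
begin

text \<open>
  Four points of the grid with two parallel connecting lines form an edge of a 4-uniform hypergraph on
  \<open>n\<^sup>2\<close> vertices, each of degree \<open>O(n ^ 4 * ln n)\<close>. The direction of a pair is measured by the
  norm of the primitive vector along it. In a random subset of density slightly above
  \<open>1 / (n powr (4/3) * ln n powr (1/3))\<close> there are few pairs with norm below \<open>n powr (1/3)\<close>, and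
  any other pair has so small a codegree that there are few Berge cycles of length at most 4. Deleting
  a point from each of these leaves a hypergraph without short cycles whose maximum degree \<open>D\<close> is a
  small power of \<open>ln n\<close>. Such a hypergraph on \<open>N\<close> vertices has an independent set of order
  \<open>N * (ln D / D) powr (1/3)\<close> (Ajtai, Komlos, Pintz, Spencer and Szemeredi), and the
  factor \<open>ln D\<close> is the source of \<open>ln (ln n)\<close>. The latter theorem is proved in the manner of Shearer,
  by induction on the number of vertices with a potential function that depends on a time parameter.
\<close>

section \<open>Independent sets in uncrowded hypergraphs\<close>

text \<open>Deleting a point from every parallel quadruple of a random set would only give the order
  \<open>n powr (2/3) / ln n powr (1/3)\<close>; the difficulty is to find room for a further gain.
  At density near \<open>n powr (-4/3)\<close> all powers of \<open>n\<close> cancel in the expected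
  numbers, per chosen point, of short pairs, collinear triples and cycles; only for two quadruples
  with three common points is a factor \<open>n powr (-1/3)\<close> left. The threshold
  \<open>M\<close> for the norm is where this balance is struck: short pairs contribute
  \<open>n * M * p\<close>, which forbids a much larger \<open>M\<close>, and the cycles contain the
  codegree \<open>n ^ 3 / M\<close>, which forbids a much smaller one. What makes the counts small
  is only the factor \<open>ln n powr (1/3)\<close> by which the density is lowered because of the
  logarithm in the degree. Hence the density can be raised by no more than a power of
  \<open>ln n\<close>, the remaining degree is a power of \<open>ln n\<close>, and the gain is
  governed by the logarithm of that.\<close>

definition linear_hg :: "'a set set \<Rightarrow> bool" where
  "linear_hg E \<longleftrightarrow> (\<forall>e\<in>E. \<forall>f\<in>E. \<forall>x\<in>e \<inter> f. \<forall>y\<in>e \<inter> f. x \<noteq> y \<longrightarrow> e = f)"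

text \<open>A Berge cycle: the edges may have further common vertices, and their sizes are
  arbitrary, which lets the condition survive when edges are shrunk. \<open>linear_hg\<close> is the
  case of length 2.\<close>

definition triangle_free :: "'a set set \<Rightarrow> bool" where
  "triangle_free E \<longleftrightarrow>
     (\<forall>e\<in>E. \<forall>f\<in>E. \<forall>h\<in>E. \<forall>x\<in>h \<inter> e. \<forall>y\<in>e \<inter> f. \<forall>z\<in>f \<inter> h.
        distinct [x, y, z] \<longrightarrow> \<not> distinct [e, f, h])"

definition quad_free :: "'a set set \<Rightarrow> bool" where
  "quad_free E \<longleftrightarrow>
     (\<forall>e\<in>E. \<forall>f\<in>E. \<forall>h\<in>E. \<forall>k\<in>E. \<forall>x\<in>k \<inter> e. \<forall>y\<in>e \<inter> f. \<forall>z\<in>f \<inter> h. \<forall>w\<in>h \<inter> k.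
        distinct [x, y, z, w] \<longrightarrow> \<not> distinct [e, f, h, k])"

definition uncrowded :: "'a set set \<Rightarrow> bool" where
  "uncrowded E \<longleftrightarrow> linear_hg E \<and> triangle_free E \<and> quad_free E"

lemma linear_hgD:
  "\<lbrakk>linear_hg E; e \<in> E; f \<in> E; x \<in> e; x \<in> f; y \<in> e; y \<in> f; x \<noteq> y\<rbrakk> \<Longrightarrow> e = f"
  unfolding linear_hg_def by blast

lemma triangle_freeD:
  "\<lbrakk>triangle_free E; e \<in> E; f \<in> E; h \<in> E; x \<in> h; x \<in> e; y \<in> e; y \<in> f; z \<in> f; z \<in> h;
    distinct [x, y, z]; distinct [e, f, h]\<rbrakk> \<Longrightarrow> False"
  unfolding triangle_free_def by blast

lemma quad_freeD:
  "\<lbrakk>quad_free E; e \<in> E; f \<in> E; h \<in> E; k \<in> E; x \<in> k; x \<in> e; y \<in> e; y \<in> f; z \<in> f; z \<in> h;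
    w \<in> h; w \<in> k; distinct [x, y, z, w]; distinct [e, f, h, k]\<rbrakk> \<Longrightarrow> False"
  unfolding quad_free_def by blast

text \<open>A short cycle among the shrunk edges lifts, with the same vertices, to one among chosen
  sources in \<open>E\<close>. Different edges may shrink to the same set, so \<open>t\<close> fixes
  one source; \<open>s\<close> recovers the shrunk edge from it, hence \<open>t\<close> is injective
  on \<open>E'\<close>.\<close>

lemma uncrowded_shrink:
  assumes "uncrowded E" and sub: "\<And>e'. e' \<in> E' \<Longrightarrow> \<exists>e\<in>E. e' = s e \<and> s e \<subseteq> e"
  shows "uncrowded E'"
proof -
  define t where "t e' = (SOME e. e \<in> E \<and> e' = s e \<and> s e \<subseteq> e)" for e'
  have t: "t e' \<in> E \<and> e' = s (t e') \<and> e' \<subseteq> t e'" if "e' \<in> E'" for e'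
  proof -
    have "t e' \<in> E \<and> e' = s (t e') \<and> s (t e') \<subseteq> t e'"
      unfolding t_def by (rule someI_ex) (use sub[OF that] in blast)
    then show ?thesis by auto
  qed
  have inj: "t e = t f \<longleftrightarrow> e = f" if "e \<in> E'" "f \<in> E'" for e f
    using t[OF that(1)] t[OF that(2)] by metis
  have 1: "linear_hg E" "triangle_free E" "quad_free E"
    using assms(1) by (auto simp: uncrowded_def)
  have "linear_hg E'"
    unfolding linear_hg_def
  proof (intro ballI impI)
    fix e f x y assume "e \<in> E'" "f \<in> E'" "x \<in> e \<inter> f" "y \<in> e \<inter> f" "x \<noteq> y"
    then show "e = f"
      using linear_hgD[OF 1(1), of "t e" "t f" x y] t inj by blast
  qed
  moreover have "triangle_free E'"
    unfolding triangle_free_def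
  proof (intro ballI impI notI)
    fix e f h x y z
    assume "e \<in> E'" "f \<in> E'" "h \<in> E'" "x \<in> h \<inter> e" "y \<in> e \<inter> f" "z \<in> f \<inter> h"
      "distinct [x, y, z]" "distinct [e, f, h]"
    note * = this
    have "e \<subseteq> t e" "f \<subseteq> t f" "h \<subseteq> t h" and E: "t e \<in> E" "t f \<in> E" "t h \<in> E"
      using t *(1-3) by simp_all
    then have m: "x \<in> t h" "x \<in> t e" "y \<in> t e" "y \<in> t f" "z \<in> t f" "z \<in> t h"
      using *(4-6) by (simp_all add: subset_iff)
    have d: "distinct [t e, t f, t h]" using inj *(1-3,8) by simp
    show False by (rule triangle_freeD[OF 1(2) E m *(7) d])
  qed
  moreover have "quad_free E'"
    unfolding quad_free_def
  proof (intro ballI impI notI)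
    fix e f h k x y z w
    assume "e \<in> E'" "f \<in> E'" "h \<in> E'" "k \<in> E'" "x \<in> k \<inter> e" "y \<in> e \<inter> f" "z \<in> f \<inter> h"
      "w \<in> h \<inter> k" "distinct [x, y, z, w]" "distinct [e, f, h, k]"
    note * = this
    have "e \<subseteq> t e" "f \<subseteq> t f" "h \<subseteq> t h" "k \<subseteq> t k"
      and E: "t e \<in> E" "t f \<in> E" "t h \<in> E" "t k \<in> E"
      using t *(1-4) by simp_all
    then have m: "x \<in> t k" "x \<in> t e" "y \<in> t e" "y \<in> t f" "z \<in> t f" "z \<in> t h" "w \<in> t h" "w \<in> t k"
      using *(5-8) by (simp_all add: subset_iff)
    have d: "distinct [t e, t f, t h, t k]" using inj *(1-4,10) by simp
    show False by (rule quad_freeD[OF 1(3) E m *(9) d])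
  qed
  ultimately show ?thesis by (simp add: uncrowded_def)
qed

section \<open>Selecting and deleting a vertex\<close>

definition nbrs :: "'a set set \<Rightarrow> 'a \<Rightarrow> 'a set" where
  "nbrs E v = {w. w \<noteq> v \<and> {v, w} \<in> E}"

text \<open>The situation once \<open>v\<close> is in the independent set: its 2-neighbours are then
  excluded, so edges through them cannot be completed, and any other edge through \<open>v\<close>
  survives as the set of its remaining vertices.\<close>

definition contract :: "'a set set \<Rightarrow> 'a \<Rightarrow> 'a set set" where
  "contract E v = (\<lambda>e. e - {v}) ` {e \<in> E. e \<inter> nbrs E v = {}}"

definition del_vertex :: "'a set set \<Rightarrow> 'a \<Rightarrow> 'a set set" where
  "del_vertex E w = {e \<in> E. w \<notin> e}"

definition indep :: "'a set set \<Rightarrow> 'a set \<Rightarrow> bool" where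
  "indep E S \<longleftrightarrow> (\<forall>e\<in>E. \<not> e \<subseteq> S)"

definition alpha :: "'a set \<Rightarrow> 'a set set \<Rightarrow> nat" where
  "alpha U E = Max (card ` {S. S \<subseteq> U \<and> indep E S})"

text \<open>
  Edges of sizes 2 and 3 arise from 4-edges by putting some of their vertices into the independent
  set. The absence of cycles survives this, because it only refers to subsets of the original edges.
\<close>

definition uncrowded_hypergraph :: "'a set \<Rightarrow> 'a set set \<Rightarrow> bool" where
  "uncrowded_hypergraph U E \<longleftrightarrow>
     finite U \<and> (\<forall>e\<in>E. e \<subseteq> U \<and> card e \<in> {2, 3, 4}) \<and> uncrowded E"

lemma nbrs_sym: "w \<in> nbrs E v \<longleftrightarrow> v \<in> nbrs E w"
  by (auto simp: nbrs_def insert_commute)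

lemma hypergraph_finite: "uncrowded_hypergraph U E \<Longrightarrow> finite E"
  unfolding uncrowded_hypergraph_def by (meson PowI finite_Pow_iff finite_subset subsetI)

lemma hypergraph_finite_edge: "uncrowded_hypergraph U E \<Longrightarrow> e \<in> E \<Longrightarrow> finite e"
  unfolding uncrowded_hypergraph_def by (meson finite_subset)

lemma nbrs_subset: "uncrowded_hypergraph U E \<Longrightarrow> nbrs E v \<subseteq> U"
  unfolding uncrowded_hypergraph_def nbrs_def by auto

lemma hypergraph_del:
  assumes "uncrowded_hypergraph U E" shows "uncrowded_hypergraph (U - {w}) (del_vertex E w)"
proof -
  have "uncrowded (del_vertex E w)"
    by (rule uncrowded_shrink[of E _ "\<lambda>e. e"]) (use assms in \<open>auto simp: uncrowded_hypergraph_def del_vertex_def\<close>)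
  then show ?thesis using assms by (auto simp: uncrowded_hypergraph_def del_vertex_def)
qed

lemma hypergraph_contract:
  assumes "uncrowded_hypergraph U E" shows "uncrowded_hypergraph (U - insert v (nbrs E v)) (contract E v)"
proof -
  have u: "uncrowded (contract E v)"
    by (rule uncrowded_shrink[of E _ "\<lambda>e. e - {v}"]) (use assms in \<open>auto simp: uncrowded_hypergraph_def contract_def\<close>)
  have "e' \<subseteq> U - insert v (nbrs E v) \<and> card e' \<in> {2, 3, 4}" if e': "e' \<in> contract E v" for e'
  proof -
    from e' obtain e where e: "e \<in> E" "e \<inter> nbrs E v = {}" "e' = e - {v}"
      by (auto simp: contract_def)
    have c: "e \<subseteq> U" "card e \<in> {2, 3, 4}" "finite e"
      using assms e(1) hypergraph_finite_edge by (auto simp: uncrowded_hypergraph_def)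
    \<comment> \<open>A 2-edge at \<open>v\<close> ends in a neighbour and is therefore not kept, so
      no edge shrinks to a single vertex.\<close>
    have "card e \<noteq> 2" if "v \<in> e"
    proof
      assume "card e = 2"
      then obtain a b where ab: "e = {a, b}" "a \<noteq> b" by (auto simp: card_2_iff)
      from \<open>v \<in> e\<close> ab have "v = a \<or> v = b" by simp
      then show False
      proof
        assume "v = a"
        then have "b \<in> nbrs E v" using e(1) ab by (simp add: nbrs_def)
        then show False using e(2) ab by simp
      next
        assume "v = b"
        then have "a \<in> nbrs E v" using e(1) ab by (simp add: nbrs_def insert_commute)
        then show False using e(2) ab by simp
      qed
    qed
    then have "card e' \<in> {2, 3, 4}" using c e(3) by (cases "v \<in> e") auto
    then show ?thesis using c e by auto
  qed
  then show ?thesis using u assms by (auto simp: uncrowded_hypergraph_def)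
qed

lemma finite_indep: "finite U \<Longrightarrow> finite {S. S \<subseteq> U \<and> indep E S}"
  by (rule finite_subset[of _ "Pow U"]) auto

lemma alpha_ge:
  assumes "finite U" "S \<subseteq> U" "indep E S" shows "card S \<le> alpha U E"
  unfolding alpha_def using assms by (intro Max_ge) (simp_all add: finite_indep)

lemma alpha_attained:
  assumes "finite U" "{} \<notin> E" shows "\<exists>S\<subseteq>U. indep E S \<and> card S = alpha U E"
proof -
  have "alpha U E \<in> card ` {S. S \<subseteq> U \<and> indep E S}"
    unfolding alpha_def
  proof (rule Max_in)
    have "{} \<in> {S. S \<subseteq> U \<and> indep E S}" using assms by (auto simp: indep_def)
    then show "card ` {S. S \<subseteq> U \<and> indep E S} \<noteq> {}" by blast
  qed (use assms in \<open>simp add: finite_indep\<close>)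
  then show ?thesis by auto
qed

lemma hypergraph_no_empty: "uncrowded_hypergraph U E \<Longrightarrow> {} \<notin> E"
  by (force simp: uncrowded_hypergraph_def)

lemma alpha_del:
  assumes "uncrowded_hypergraph U E" shows "alpha (U - {w}) (del_vertex E w) \<le> alpha U E"
proof -
  obtain S where S: "S \<subseteq> U - {w}" "indep (del_vertex E w) S" "card S = alpha (U - {w}) (del_vertex E w)"
    using alpha_attained[of "U - {w}" "del_vertex E w"] hypergraph_del[OF assms, of w]
      hypergraph_no_empty uncrowded_hypergraph_def by metis
  then have "indep E S" by (auto simp: indep_def del_vertex_def)
  then show ?thesis using S alpha_ge[of U S E] assms by (auto simp: uncrowded_hypergraph_def)
qed

lemma alpha_contract:
  assumes "uncrowded_hypergraph U E" "v \<in> U"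
  shows "1 + alpha (U - insert v (nbrs E v)) (contract E v) \<le> alpha U E"
proof -
  obtain S where S: "S \<subseteq> U - insert v (nbrs E v)" "indep (contract E v) S"
      "card S = alpha (U - insert v (nbrs E v)) (contract E v)"
    using alpha_attained[of "U - insert v (nbrs E v)" "contract E v"] hypergraph_contract[OF assms(1), of v]
      hypergraph_no_empty uncrowded_hypergraph_def by metis
  have "indep E (insert v S)"
    unfolding indep_def
  proof (intro ballI notI)
    fix e assume e: "e \<in> E" "e \<subseteq> insert v S"
    have "e \<inter> nbrs E v = {}" using e S(1) by (auto simp: nbrs_def)
    then have "e - {v} \<in> contract E v" using e by (auto simp: contract_def)
    then show False using S(2) e by (auto simp: indep_def)
  qed
  moreover have "finite S" using S(1) assms by (auto simp: uncrowded_hypergraph_def intro: finite_subset)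
  moreover have "v \<notin> S" "insert v S \<subseteq> U" "finite U" using S(1) assms by (auto simp: uncrowded_hypergraph_def)
  ultimately show ?thesis
    using alpha_ge[of U "insert v S" E] S(3) by simp
qed

section \<open>Change of the vertex weights under one move\<close>

lemma prod_minus_one:
  fixes \<phi> :: "'a \<Rightarrow> real"
  assumes "finite A" and one: "\<And>e f. e \<in> A \<Longrightarrow> f \<in> A \<Longrightarrow> e \<noteq> f \<Longrightarrow> \<phi> e = 1 \<or> \<phi> f = 1"
  shows "prod \<phi> A - 1 = (\<Sum>e\<in>A. \<phi> e - 1)"
proof (cases "\<exists>e0\<in>A. \<phi> e0 \<noteq> 1")
  case True
  then obtain e0 where e0: "e0 \<in> A" "\<phi> e0 \<noteq> 1" by blast
  have "prod \<phi> (A - {e0}) = 1" by (rule prod.neutral) (use one e0 in blast)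
  moreover have "(\<Sum>e\<in>A - {e0}. \<phi> e - 1) = 0" by (rule sum.neutral) (use one e0 in force)
  ultimately show ?thesis
    using assms(1) e0 by (simp add: prod.remove[of A e0] sum.remove[of A e0])
qed auto

text \<open>With \<open>x k\<close> above 1 the product behaves like the exponential of a weighted
  degree, so vertices whose degree is much too large are penalised exponentially.\<close>

definition weight :: "(nat \<Rightarrow> real) \<Rightarrow> 'a set set \<Rightarrow> 'a \<Rightarrow> real" where
  "weight x E u = (\<Prod>e\<in>{e\<in>E. u \<in> e}. x (card e))"

lemma weight_del:
  assumes "finite E" "u \<noteq> w"
  shows "weight x (del_vertex E w) u = (\<Prod>e\<in>{e\<in>E. u \<in> e}. if w \<in> e then 1 else x (card e))"
proof -
  have "(\<Prod>e\<in>{e\<in>E. u \<in> e}. if w \<in> e then 1 else x (card e))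
      = (\<Prod>e\<in>{e\<in>{e\<in>E. u \<in> e}. w \<notin> e}. x (card e))"
    using assms(1) by (subst prod.inter_filter) (auto intro!: prod.cong)
  also have "{e\<in>{e\<in>E. u \<in> e}. w \<notin> e} = {e \<in> del_vertex E w. u \<in> e}"
    by (auto simp: del_vertex_def)
  finally show ?thesis by (simp add: weight_def)
qed

lemma weight_contract:
  assumes H: "uncrowded_hypergraph U E" and uv: "u \<noteq> v" "u \<notin> nbrs E v"
  shows "weight x (contract E v) u =
    (\<Prod>e\<in>{e\<in>E. u \<in> e}. if e \<inter> nbrs E v \<noteq> {} then 1 else x (card (e - {v})))"
proof -
  have fin: "finite E" using H by (rule hypergraph_finite)
  have lin: "linear_hg E" using H by (auto simp: uncrowded_hypergraph_def uncrowded_def)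
  let ?B = "{e\<in>E. u \<in> e \<and> e \<inter> nbrs E v = {}}"
  \<comment> \<open>Needed to read a product over contracted edges as one over the original ones. If
    only the first edge contains \<open>v\<close>, the second is part of it and has at least two
    vertices, so linearity identifies them.\<close>
  have inj: "inj_on (\<lambda>e. e - {v}) ?B"
  proof (rule inj_onI)
    fix e f assume ef: "e \<in> ?B" "f \<in> ?B" "e - {v} = f - {v}"
    show "e = f"
    proof (cases "v \<in> e \<and> v \<in> f \<or> v \<notin> e \<and> v \<notin> f")
      case True then show ?thesis using ef(3) by blast
    next
      case False
      have key: False if "v \<in> e'" "v \<notin> f'" "e' \<in> ?B" "f' \<in> ?B" "e' - {v} = f' - {v}" for e' f'
      proof -
        have c: "card f' \<ge> 2" using H that(4) by (auto simp: uncrowded_hypergraph_def)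
        have "\<not> f' \<subseteq> {u}" using c card_mono[of "{u}" f'] by auto
        then obtain z where "z \<in> f'" "z \<noteq> u" by blast
        then have "z \<in> e'" "u \<in> e'" "u \<in> f'" using that by auto
        then have "e' = f'" using linear_hgD[OF lin, of e' f' u z] that \<open>z \<in> f'\<close> \<open>z \<noteq> u\<close> by auto
        then show False using that by blast
      qed
      show ?thesis using False key[OF _ _ ef] key[OF _ _ ef(2,1) ef(3)[symmetric]] by blast
    qed
  qed
  have img: "{e' \<in> contract E v. u \<in> e'} = (\<lambda>e. e - {v}) ` ?B"
    using uv by (auto simp: contract_def)
  have "weight x (contract E v) u = (\<Prod>e\<in>?B. x (card (e - {v})))"
    unfolding weight_def img by (simp add: prod.reindex[OF inj])
  also have "?B = {e\<in>{e\<in>E. u \<in> e}. e \<inter> nbrs E v = {}}" by auto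
  also have "(\<Prod>e\<in>\<dots>. x (card (e - {v})))
     = (\<Prod>e\<in>{e\<in>E. u \<in> e}. if e \<inter> nbrs E v = {} then x (card (e - {v})) else 1)"
    by (rule prod.inter_filter) (use fin in auto)
  also have "\<dots> = (\<Prod>e\<in>{e\<in>E. u \<in> e}. if e \<inter> nbrs E v \<noteq> {} then 1 else x (card (e - {v})))"
    by (rule prod.cong) auto
  finally show ?thesis .
qed

lemma weight_pos: "(\<And>k. x k > 0) \<Longrightarrow> weight x E u > 0"
  by (simp add: weight_def prod_pos)

lemma weight_ratio:
  assumes "\<And>k. x k > 0"
  shows "(\<Prod>e\<in>{e\<in>E. u \<in> e}. \<psi> e) - weight x E u
       = weight x E u * ((\<Prod>e\<in>{e\<in>E. u \<in> e}. \<psi> e / x (card e)) - 1)"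
proof -
  have "weight x E u \<noteq> 0" using weight_pos[of x E u, OF assms] by simp
  then show ?thesis by (simp add: prod_dividef weight_def[symmetric] field_simps)
qed

text \<open>
  Selecting \<open>v\<close> changes at most one edge at \<open>u\<close>: two changed edges would close a cycle of length
  at most 4. This is what makes the change of the product \<open>weight x E u\<close> additive over edges.
\<close>

lemma touch_unique:
  assumes H: "uncrowded_hypergraph U E" and uv: "u \<noteq> v" "u \<notin> nbrs E v"
    and e: "e \<in> E" "u \<in> e" "v \<in> e \<or> e \<inter> nbrs E v \<noteq> {}"
    and f: "f \<in> E" "u \<in> f" "v \<in> f \<or> f \<inter> nbrs E v \<noteq> {}"
  shows "e = f"
proof (rule ccontr)
  assume ef: "e \<noteq> f"
  have lin: "linear_hg E" and tri: "triangle_free E" and quad: "quad_free E"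
    using H by (auto simp: uncrowded_hypergraph_def uncrowded_def)
  have mixed: False
    if "e \<in> E" "u \<in> e" "v \<in> e" "f \<in> E" "u \<in> f" "w \<in> f" "w \<in> nbrs E v" "e \<noteq> f" for e f w
  proof -
    have w: "w \<noteq> v" "w \<noteq> u" "{v, w} \<in> E" using that uv by (auto simp: nbrs_def)
    show False
      by (rule triangle_freeD[OF tri, of e "{v, w}" f u v w]) (use that w uv in auto)
  qed
  \<comment> \<open>The cases close cycles through \<open>u\<close> of length 2, 3, 3 and 4, the
    2-edges from \<open>v\<close> to its neighbours being the additional edges. In the last case
    \<open>w = z\<close> would be a second common vertex of \<open>e\<close> and \<open>f\<close>,
    which linearity excludes.\<close>
  consider "v \<in> e" "v \<in> f" | w where "v \<in> e" "w \<in> f" "w \<in> nbrs E v"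
    | w where "v \<in> f" "w \<in> e" "w \<in> nbrs E v"
    | w z where "w \<in> e" "w \<in> nbrs E v" "z \<in> f" "z \<in> nbrs E v"
    using e(3) f(3) by blast
  then show False
  proof cases
    case 1
    then show False using linear_hgD[OF lin e(1) f(1) e(2) f(2) 1 uv(1)] ef by simp
  next
    case 2
    show False by (rule mixed[OF e(1,2) 2(1) f(1,2) 2(2,3) ef])
  next
    case 3
    show False by (rule mixed[OF f(1,2) 3(1) e(1,2) 3(2,3)]) (use ef in simp)
  next
    case 4
    have w: "w \<noteq> v" "w \<noteq> u" "{w, v} \<in> E" and z: "z \<noteq> v" "z \<noteq> u" "{v, z} \<in> E"
      using 4 uv by (auto simp: nbrs_def insert_commute)
    have wz: "w \<noteq> z"
      using linear_hgD[OF lin e(1) f(1) e(2) f(2), of w] ef 4 w by auto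
    have "e \<noteq> {w, v}" "e \<noteq> {v, z}" "f \<noteq> {w, v}" "f \<noteq> {v, z}" "{w, v} \<noteq> {v, z}"
      using e(2) f(2) uv w z wz by auto
    then show False
      by (intro quad_freeD[OF quad e(1) w(3) z(3) f(1) f(2) e(2) 4(1), of v z])
        (use 4 w z wz uv ef in auto)
  qed
qed

text \<open>As \<open>e\<close> also contains \<open>u\<close>, linearity keeps \<open>v\<close> and
  a neighbour of \<open>v\<close> from both lying in \<open>e\<close>, and two neighbours would form
  a triangle with \<open>e\<close>; so the cardinality is 0 or 1. It is written as a number in order
  to be summed over \<open>v\<close> by double counting.\<close>

lemma touch_cases:
  assumes H: "uncrowded_hypergraph U E" and uv: "u \<noteq> v" "u \<notin> nbrs E v" and e: "e \<in> E" "u \<in> e"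
    and x: "x (card e) \<noteq> (0::real)"
  shows "(if e \<inter> nbrs E v \<noteq> {} then 1 else x (card (e - {v}))) / x (card e) - 1
    = (if v \<in> e then x (card e - 1) / x (card e) - 1 else 0)
      + real (card (e \<inter> nbrs E v)) * (1 / x (card e) - 1)"
proof -
  have lin: "linear_hg E" and tri: "triangle_free E"
    using H by (auto simp: uncrowded_hypergraph_def uncrowded_def)
  have fe: "finite e" using hypergraph_finite_edge[OF H e(1)] .
  show ?thesis
  proof (cases "e \<inter> nbrs E v = {}")
    case True
    then show ?thesis using x fe by auto
  next
    case False
    then obtain w where w: "w \<in> e" "w \<in> nbrs E v" by blast
    then have w': "w \<noteq> v" "w \<noteq> u" "{v, w} \<in> E" using uv by (auto simp: nbrs_def)
    have "v \<notin> e"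
    proof
      assume "v \<in> e"
      then have "e = {v, w}" using linear_hgD[OF lin e(1) w'(3), of v w] w w' by auto
      then show False using e uv w' by auto
    qed
    moreover have "z = w" if "z \<in> e \<inter> nbrs E v" for z
    proof (rule ccontr)
      assume zw: "z \<noteq> w"
      have z: "z \<noteq> v" "z \<noteq> u" "{v, z} \<in> E" using uv that by (auto simp: nbrs_def)
      show False
        by (rule triangle_freeD[OF tri e(1) w'(3) z(3), of z w v]) (use that zw z w w' e uv in auto)
    qed
    then have "e \<inter> nbrs E v = {w}" using w by blast
    ultimately show ?thesis using x by simp
  qed
qed

text \<open>Double counting by edges at \<open>u\<close>. Selecting another vertex of
  \<open>e\<close> shrinks \<open>e\<close>, except in a 2-edge, where that vertex is a neighbour of
  \<open>u\<close> and outside the range of summation. Selecting a 2-neighbour of a vertex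
  \<open>w\<close> of \<open>e\<close> destroys \<open>e\<close>; in a 2-edge \<open>u\<close>
  itself is one of these neighbours and is subtracted.\<close>

lemma sum_weight_contract:
  assumes H: "uncrowded_hypergraph U E" and u: "u \<in> U" and x: "\<And>k. x k > 0"
  shows "(\<Sum>v\<in>U - insert u (nbrs E u). weight x (contract E v) u - weight x E u)
    = weight x E u * (\<Sum>e\<in>{e\<in>E. u \<in> e}.
        (if card e = 2 then 0 else real (card e - 1) * (x (card e - 1) / x (card e) - 1))
        + ((\<Sum>w\<in>e - {u}. real (card (nbrs E w))) - (if card e = 2 then 1 else 0)) * (1 / x (card e) - 1))"
proof -
  have lin: "linear_hg E" and tri: "triangle_free E"
    using H by (auto simp: uncrowded_hypergraph_def uncrowded_def)
  have finU: "finite U" and finE: "finite E" using H hypergraph_finite by (auto simp: uncrowded_hypergraph_def)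
  have finN: "finite (nbrs E w)" for w using nbrs_subset[OF H] finU finite_subset by blast
  have xn: "x k \<noteq> 0" for k using x[of k] by simp
  define V where "V = U - insert u (nbrs E u)"
  have V: "v \<in> U" "u \<noteq> v" "u \<notin> nbrs E v" if "v \<in> V" for v
    using that nbrs_sym[of u E v] by (auto simp: V_def)
  define A where "A = {e\<in>E. u \<in> e}"
  have finA: "finite A" using finE by (simp add: A_def)
  define \<phi> where "\<phi> v e = (if e \<inter> nbrs E v \<noteq> {} then 1 else x (card (e - {v}))) / x (card e)" for v e
  have "weight x (contract E v) u - weight x E u = weight x E u * (\<Sum>e\<in>A. \<phi> v e - 1)" if "v \<in> V" for v
  proof -
    have "weight x (contract E v) u - weight x E u = weight x E u * ((\<Prod>e\<in>A. \<phi> v e) - 1)"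
      unfolding weight_contract[OF H V(2,3)[OF that]] weight_ratio[OF x] A_def \<phi>_def ..
    also have "(\<Prod>e\<in>A. \<phi> v e) - 1 = (\<Sum>e\<in>A. \<phi> v e - 1)"
    proof (rule prod_minus_one[OF finA])
      fix e f assume ef: "e \<in> A" "f \<in> A" "e \<noteq> f"
      have *: "\<phi> v e = 1" if "\<not> (v \<in> e \<or> e \<inter> nbrs E v \<noteq> {})" for e
        using that xn by (simp add: \<phi>_def)
      show "\<phi> v e = 1 \<or> \<phi> v f = 1"
        using touch_unique[OF H V(2,3)[OF that], of e f] *[of e] *[of f] ef by (auto simp: A_def)
    qed
    finally show ?thesis .
  qed
  then have "(\<Sum>v\<in>V. weight x (contract E v) u - weight x E u)
      = weight x E u * (\<Sum>e\<in>A. \<Sum>v\<in>V. \<phi> v e - 1)"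
    by (simp add: sum_distrib_left[symmetric] sum.swap[of _ A V])
  also have "(\<Sum>e\<in>A. \<Sum>v\<in>V. \<phi> v e - 1) = (\<Sum>e\<in>A.
      (if card e = 2 then 0 else real (card e - 1) * (x (card e - 1) / x (card e) - 1))
        + ((\<Sum>w\<in>e - {u}. real (card (nbrs E w))) - (if card e = 2 then 1 else 0)) * (1 / x (card e) - 1))"
  proof (rule sum.cong[OF refl])
    fix e assume "e \<in> A"
    then have e: "e \<in> E" "u \<in> e" by (auto simp: A_def)
    have fe: "finite e" using hypergraph_finite_edge[OF H e(1)] .
    have eU: "e \<subseteq> U" and ce: "card e \<in> {2, 3, 4}" using H e by (auto simp: uncrowded_hypergraph_def)
    have two: "u \<in> nbrs E w \<longleftrightarrow> card e = 2" if w: "w \<in> e" "w \<noteq> u" for w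
    proof
      assume "u \<in> nbrs E w"
      then have "{w, u} \<in> E" by (simp add: nbrs_def)
      then have "e = {w, u}" using linear_hgD[OF lin e(1), of "{w, u}" w u] e w by auto
      then show "card e = 2" using w by simp
    next
      assume "card e = 2"
      then have "e = {w, u}" using card_subset_eq[OF fe, of "{w, u}"] e w by simp
      then show "u \<in> nbrs E w" using e w by (auto simp: nbrs_def)
    qed
    have Ve: "real (card (V \<inter> e)) = (if card e = 2 then 0 else real (card e - 1))"
    proof (cases "card e = 2")
      case True
      then have "V \<inter> e = {}" using two nbrs_sym[of u E] by (auto simp: V_def)
      then show ?thesis using True by simp
    next
      case False
      then have "V \<inter> e = e - {u}" using two nbrs_sym[of u E] eU by (auto simp: V_def)
      then show ?thesis using False e fe by simp
    qed
    have Nw: "{v\<in>V. v \<in> nbrs E w} = nbrs E w - {u}" if w: "w \<in> e - {u}" for w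
    proof -
      \<comment> \<open>Otherwise \<open>e\<close>, \<open>{w, v}\<close> and \<open>{v, u}\<close>
        form a triangle. So every 2-neighbour of \<open>w\<close> other than \<open>u\<close> is in
        the range of summation.\<close>
      have "v \<notin> nbrs E u" if v: "v \<in> nbrs E w" "v \<noteq> u" for v
      proof
        assume "v \<in> nbrs E u"
        then have uv: "{v, u} \<in> E" by (auto simp: nbrs_def insert_commute)
        have wv: "{w, v} \<in> E" "w \<noteq> v" using v by (auto simp: nbrs_def)
        show False
          by (rule triangle_freeD[OF tri e(1) wv(1) uv, of u w v]) (use e w v wv in auto)
      qed
      then show ?thesis using nbrs_subset[OF H, of w] by (auto simp: V_def)
    qed
    have Nu: "{v\<in>V. v \<in> nbrs E u} = {}" by (auto simp: V_def)
    have "(\<Sum>v\<in>V. real (card (e \<inter> nbrs E v))) = (\<Sum>v\<in>V. \<Sum>w\<in>{w\<in>e. v \<in> nbrs E w}. 1)"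
      by (rule sum.cong[OF refl]) (auto simp: nbrs_sym Int_def intro!: arg_cong[of _ _ card])
    also have "\<dots> = (\<Sum>w\<in>e. \<Sum>v\<in>{v\<in>V. v \<in> nbrs E w}. 1)"
      by (rule sum.swap_restrict) (use finU fe in \<open>auto simp: V_def\<close>)
    also have "\<dots> = (\<Sum>w\<in>e - {u}. \<Sum>v\<in>{v\<in>V. v \<in> nbrs E w}. 1)"
      unfolding sum.remove[OF fe e(2)] Nu by simp
    also have "\<dots> = (\<Sum>w\<in>e - {u}. real (card (nbrs E w)) - (if card e = 2 then 1 else 0))"
    proof (rule sum.cong[OF refl])
      fix w assume w: "w \<in> e - {u}"
      have "card (nbrs E w) > 0" if "u \<in> nbrs E w"
        using that finN by (auto simp: card_gt_0_iff)
      then show "(\<Sum>v\<in>{v\<in>V. v \<in> nbrs E w}. 1) = real (card (nbrs E w)) - (if card e = 2 then 1 else 0)"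
        unfolding Nw[OF w] using two[of w] w finN[of w] by (auto simp: of_nat_diff)
    qed
    also have "\<dots> = (\<Sum>w\<in>e - {u}. real (card (nbrs E w))) - (if card e = 2 then 1 else 0)"
      using fe e by (simp add: sum_subtractf)
    finally have deg: "(\<Sum>v\<in>V. real (card (e \<inter> nbrs E v)))
      = (\<Sum>w\<in>e - {u}. real (card (nbrs E w))) - (if card e = 2 then 1 else 0)" .
    have "(\<Sum>v\<in>V. \<phi> v e - 1) = (\<Sum>v\<in>V. (if v \<in> e then x (card e - 1) / x (card e) - 1 else 0)
      + real (card (e \<inter> nbrs E v)) * (1 / x (card e) - 1))"
    proof (rule sum.cong[OF refl])
      fix v assume v: "v \<in> V"
      show "\<phi> v e - 1 = (if v \<in> e then x (card e - 1) / x (card e) - 1 else 0)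
      + real (card (e \<inter> nbrs E v)) * (1 / x (card e) - 1)"
        unfolding \<phi>_def by (rule touch_cases[OF H V(2)[OF v] V(3)[OF v] e xn])
    qed
    also have "\<dots> = real (card (V \<inter> e)) * (x (card e - 1) / x (card e) - 1)
        + (\<Sum>v\<in>V. real (card (e \<inter> nbrs E v))) * (1 / x (card e) - 1)"
      using finU by (simp add: sum.distrib sum_distrib_right sum.If_cases V_def Int_def)
    finally show "(\<Sum>v\<in>V. \<phi> v e - 1) = (if card e = 2 then 0 else real (card e - 1) * (x (card e - 1) / x (card e) - 1))
        + ((\<Sum>w\<in>e - {u}. real (card (nbrs E w))) - (if card e = 2 then 1 else 0)) * (1 / x (card e) - 1)"
      unfolding Ve deg by simp
  qed
  finally show ?thesis unfolding V_def A_def .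
qed

text \<open>Linearity puts at most one edge through \<open>u\<close> and \<open>w\<close>, so
  deleting \<open>w\<close> removes at most one factor.\<close>

lemma sum_weight_del:
  assumes H: "uncrowded_hypergraph U E" and x: "\<And>k. x k > 0"
  shows "(\<Sum>w\<in>U - {u}. \<pi> w * (weight x (del_vertex E w) u - weight x E u))
    = weight x E u * (\<Sum>e\<in>{e\<in>E. u \<in> e}. (\<Sum>w\<in>e - {u}. \<pi> w) * (1 / x (card e) - 1))"
proof -
  have lin: "linear_hg E" using H by (auto simp: uncrowded_hypergraph_def uncrowded_def)
  have finU: "finite U" and finE: "finite E" using H hypergraph_finite by (auto simp: uncrowded_hypergraph_def)
  have xn: "x k \<noteq> 0" for k using x[of k] by simp
  define A where "A = {e\<in>E. u \<in> e}"
  have finA: "finite A" using finE by (simp add: A_def)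
  have "weight x (del_vertex E w) u - weight x E u
      = weight x E u * (\<Sum>e\<in>A. if w \<in> e then 1 / x (card e) - 1 else 0)" if "w \<in> U - {u}" for w
  proof -
    have uw: "u \<noteq> w" using that by auto
    have "weight x (del_vertex E w) u - weight x E u
        = weight x E u * ((\<Prod>e\<in>A. (if w \<in> e then 1 else x (card e)) / x (card e)) - 1)"
      unfolding weight_del[OF finE uw] weight_ratio[OF x] A_def ..
    also have "(\<Prod>e\<in>A. (if w \<in> e then 1 else x (card e)) / x (card e)) - 1
      = (\<Sum>e\<in>A. (if w \<in> e then 1 else x (card e)) / x (card e) - 1)"
    proof (rule prod_minus_one[OF finA])
      fix e f assume ef: "e \<in> A" "f \<in> A" "e \<noteq> f"
      then have "w \<notin> e \<or> w \<notin> f" using linear_hgD[OF lin, of e f u w] uw by (auto simp: A_def)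
      then show "(if w \<in> e then 1 else x (card e)) / x (card e) = 1
        \<or> (if w \<in> f then 1 else x (card f)) / x (card f) = 1" using xn by auto
    qed
    also have "\<dots> = (\<Sum>e\<in>A. if w \<in> e then 1 / x (card e) - 1 else 0)"
      by (rule sum.cong[OF refl]) (use xn in auto)
    finally show ?thesis .
  qed
  then have "(\<Sum>w\<in>U - {u}. \<pi> w * (weight x (del_vertex E w) u - weight x E u))
    = (\<Sum>w\<in>U - {u}. \<Sum>e\<in>A. weight x E u * (if w \<in> e then \<pi> w * (1 / x (card e) - 1) else 0))"
    by (intro sum.cong[OF refl]) (simp add: sum_distrib_left ac_simps if_distrib cong: if_cong)
  also have "\<dots> = weight x E u * (\<Sum>e\<in>A. \<Sum>w\<in>U - {u}. if w \<in> e then \<pi> w * (1 / x (card e) - 1) else 0)"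
    by (subst sum.swap) (simp add: sum_distrib_left)
  also have "(\<Sum>e\<in>A. \<Sum>w\<in>U - {u}. if w \<in> e then \<pi> w * (1 / x (card e) - 1) else 0)
      = (\<Sum>e\<in>A. (\<Sum>w\<in>e - {u}. \<pi> w) * (1 / x (card e) - 1))"
  proof (rule sum.cong[OF refl])
    fix e assume "e \<in> A"
    then have "{w \<in> U - {u}. w \<in> e} = e - {u}" using H by (auto simp: A_def uncrowded_hypergraph_def)
    then show "(\<Sum>w\<in>U - {u}. if w \<in> e then \<pi> w * (1 / x (card e) - 1) else 0)
      = (\<Sum>w\<in>e - {u}. \<pi> w) * (1 / x (card e) - 1)"
      using finU by (simp add: sum.inter_filter[symmetric] sum_distrib_right)
  qed
  finally show ?thesis unfolding A_def .
qed

section \<open>The potential and its drift\<close>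

text \<open>Heuristically \<open>a\<close> is the number of selections still to be expected per
  living vertex, and \<open>b * weight\<close> a discount for vertices with too many edges.\<close>

definition potential :: "real \<Rightarrow> real \<Rightarrow> (nat \<Rightarrow> real) \<Rightarrow> 'a set \<Rightarrow> 'a set set \<Rightarrow> real" where
  "potential a b x U E = (\<Sum>u\<in>U. a - b * weight x E u)"

lemma potential_diff:
  assumes "finite U" "B \<subseteq> U"
  shows "potential a b x (U - B) E' - potential a b x U E
    = - (\<Sum>u\<in>B. a - b * weight x E u) - b * (\<Sum>u\<in>U - B. weight x E' u - weight x E u)"
proof -
  have "potential a b x U E = (\<Sum>u\<in>U - B. a - b * weight x E u) + (\<Sum>u\<in>B. a - b * weight x E u)"
    unfolding potential_def by (rule sum.subset_diff) (use assms in auto)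
  moreover have "potential a b x (U - B) E' - (\<Sum>u\<in>U - B. a - b * weight x E u)
    = - b * (\<Sum>u\<in>U - B. weight x E' u - weight x E u)"
    unfolding potential_def sum_subtractf[symmetric] sum_distrib_left
    by (rule sum.cong) (auto simp: algebra_simps)
  ultimately show ?thesis by simp
qed

lemma two_edges_at:
  assumes H: "uncrowded_hypergraph U E" and u: "u \<in> U"
  shows "card {e\<in>E. u \<in> e \<and> card e = 2} = card (nbrs E u)"
proof -
  have "inj_on (\<lambda>w. {u, w}) (nbrs E u)" by (auto simp: inj_on_def doubleton_eq_iff)
  moreover have "{e\<in>E. u \<in> e \<and> card e = 2} = (\<lambda>w. {u, w}) ` nbrs E u"
    by (auto simp: nbrs_def card_2_iff doubleton_eq_iff image_iff insert_commute)
  ultimately show ?thesis by (simp add: card_image)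
qed

text \<open>
  Every vertex is selected at rate \<open>r\<close>, which destroys its 2-neighbours, and is in addition deleted at
  the rate \<open>\<pi>\<close> that raises its total destruction rate to at least \<open>\<rho>\<close>. This equalisation is the point
  of the deletions: edges then die at rate at least \<open>\<rho>\<close> per vertex, whatever correlation there is
  between the degrees of neighbouring vertices. The hypotheses on \<open>x\<close> say that the weight of a vertex
  does not grow on average, and \<open>pw\<close> says that the weight pays for vertices whose
  2-degree exceeds \<open>\<rho> / r\<close>.
\<close>

lemma potential_drift:
  fixes r \<rho> a a' b :: real and x x' :: "nat \<Rightarrow> real" and E :: "'a set set"
  assumes H: "uncrowded_hypergraph U E" and r: "r \<ge> 0" and b: "b \<ge> 0"
    and x1: "\<And>k. x k \<ge> 1" and x2: "x 2 \<le> 2"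
    and x4': "x' 4 + 3 * (r * (x 3 - x 4) + \<rho> * (1 - x 4)) \<le> 0"
    and x3': "x' 3 + 2 * (r * (x 2 - x 3) + \<rho> * (1 - x 3)) \<le> 0"
    and x2': "x' 2 + \<rho> * (1 - x 2) \<le> 0"
    and pw: "\<And>k::nat. r + a' - (r + max \<rho> (r * real k)) * a + b * (\<rho> / 2) * x 2 ^ k \<ge> 0"
    and \<rho>: "\<rho> \<ge> 0"
    and \<pi>: "\<And>w. \<pi> w = max \<rho> (r * real (card (nbrs E w))) - r * real (card (nbrs E w))"
  shows "0 \<le> (\<Sum>v\<in>U. r * (1 + (potential a b x (U - insert v (nbrs E v)) (contract E v) - potential a b x U E)))
     + (\<Sum>w\<in>U. \<pi> w * (potential a b x (U - {w}) (del_vertex E w) - potential a b x U E))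
     + (\<Sum>u\<in>U. a' - b * (weight x E u * (\<Sum>e\<in>{e\<in>E. u \<in> e}. x' (card e) / x (card e))))"
proof -
  have finU: "finite U" and finE: "finite E" using H hypergraph_finite by (auto simp: uncrowded_hypergraph_def)
  have xp: "x k > 0" for k using x1[of k] by simp
  define d where "d u = real (card (nbrs E u))" for u
  define F where "F u = a - b * weight x E u" for u
  define W where "W = weight x E"
  define C where "C u = (\<Sum>v\<in>U - insert u (nbrs E u). weight x (contract E v) u - W u)" for u
  define D where "D u = (\<Sum>w\<in>U - {u}. \<pi> w * (weight x (del_vertex E w) u - W u))" for u
  define S where "S u = (\<Sum>e\<in>{e\<in>E. u \<in> e}. x' (card e) / x (card e))" for u
  have sw: "(\<Sum>v\<in>U. \<Sum>u\<in>insert v (nbrs E v). F u) = (\<Sum>u\<in>U. (1 + d u) * F u)"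
  proof -
    have "(\<Sum>v\<in>U. \<Sum>u\<in>insert v (nbrs E v). F u) = (\<Sum>v\<in>U. \<Sum>u\<in>{u\<in>U. u \<in> insert v (nbrs E v)}. F u)"
      by (rule sum.cong[OF refl], rule sum.cong) (use nbrs_subset[OF H] in auto)
    also have "\<dots> = (\<Sum>u\<in>U. \<Sum>v\<in>{v\<in>U. u \<in> insert v (nbrs E v)}. F u)"
      by (rule sum.swap_restrict[OF finU finU])
    also have "\<dots> = (\<Sum>u\<in>U. (1 + d u) * F u)"
    proof (rule sum.cong[OF refl])
      fix u assume u: "u \<in> U"
      have "{v\<in>U. u \<in> insert v (nbrs E v)} = insert u (nbrs E u)"
        using u nbrs_subset[OF H, of u] nbrs_sym[of u E] by auto
      moreover have "finite (nbrs E u)" "u \<notin> nbrs E u"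
        using nbrs_subset[OF H, of u] finU by (auto simp: nbrs_def intro: finite_subset)
      ultimately show "(\<Sum>v\<in>{v\<in>U. u \<in> insert v (nbrs E v)}. F u) = (1 + d u) * F u"
        by (simp add: d_def)
    qed
    finally show ?thesis .
  qed
  have sc: "(\<Sum>v\<in>U. \<Sum>u\<in>U - insert v (nbrs E v). weight x (contract E v) u - W u) = (\<Sum>u\<in>U. C u)"
  proof -
    have "(\<Sum>v\<in>U. \<Sum>u\<in>U - insert v (nbrs E v). weight x (contract E v) u - W u)
      = (\<Sum>v\<in>U. \<Sum>u\<in>{u\<in>U. u \<notin> insert v (nbrs E v)}. weight x (contract E v) u - W u)"
      by (rule sum.cong[OF refl], rule sum.cong) auto
    also have "\<dots> = (\<Sum>u\<in>U. \<Sum>v\<in>{v\<in>U. u \<notin> insert v (nbrs E v)}. weight x (contract E v) u - W u)"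
      by (rule sum.swap_restrict[OF finU finU])
    also have "\<dots> = (\<Sum>u\<in>U. C u)"
      unfolding C_def by (rule sum.cong[OF refl], rule sum.cong) (use nbrs_sym[of _ E] in auto)
    finally show ?thesis .
  qed
  have sd: "(\<Sum>w\<in>U. \<pi> w * (\<Sum>u\<in>U - {w}. weight x (del_vertex E w) u - W u)) = (\<Sum>u\<in>U. D u)"
  proof -
    have "(\<Sum>w\<in>U. \<pi> w * (\<Sum>u\<in>U - {w}. weight x (del_vertex E w) u - W u))
      = (\<Sum>w\<in>U. \<Sum>u\<in>{u\<in>U. u \<noteq> w}. \<pi> w * (weight x (del_vertex E w) u - W u))"
      unfolding sum_distrib_left by (rule sum.cong[OF refl], rule sum.cong) auto
    also have "\<dots> = (\<Sum>u\<in>U. \<Sum>w\<in>{w\<in>U. u \<noteq> w}. \<pi> w * (weight x (del_vertex E w) u - W u))"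
      by (rule sum.swap_restrict[OF finU finU])
    also have "\<dots> = (\<Sum>u\<in>U. D u)"
      unfolding D_def by (rule sum.cong[OF refl], rule sum.cong) auto
    finally show ?thesis .
  qed
  have t1: "(\<Sum>v\<in>U. r * (1 + (potential a b x (U - insert v (nbrs E v)) (contract E v) - potential a b x U E)))
      = r * (real (card U) - (\<Sum>u\<in>U. (1 + d u) * F u) - b * (\<Sum>u\<in>U. C u))"
  proof -
    have "(\<Sum>v\<in>U. r * (1 + (potential a b x (U - insert v (nbrs E v)) (contract E v) - potential a b x U E)))
      = (\<Sum>v\<in>U. r * (1 - (\<Sum>u\<in>insert v (nbrs E v). F u)
           - b * (\<Sum>u\<in>U - insert v (nbrs E v). weight x (contract E v) u - W u)))"
    proof (rule sum.cong[OF refl])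
      fix v assume "v \<in> U"
      then have "insert v (nbrs E v) \<subseteq> U" using nbrs_subset[OF H] by auto
      from potential_diff[OF finU this, of a b x "contract E v" E]
      show "r * (1 + (potential a b x (U - insert v (nbrs E v)) (contract E v) - potential a b x U E))
         = r * (1 - (\<Sum>u\<in>insert v (nbrs E v). F u)
           - b * (\<Sum>u\<in>U - insert v (nbrs E v). weight x (contract E v) u - W u))"
        by (simp add: F_def W_def)
    qed
    also have "\<dots> = r * (real (card U) - (\<Sum>v\<in>U. \<Sum>u\<in>insert v (nbrs E v). F u)
        - b * (\<Sum>v\<in>U. \<Sum>u\<in>U - insert v (nbrs E v). weight x (contract E v) u - W u))"
    proof -
      have "(\<Sum>v\<in>U. r * (1 - A v - b * B v)) = r * (real (card U) - (\<Sum>v\<in>U. A v) - b * (\<Sum>v\<in>U. B v))"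
        for A B :: "'a \<Rightarrow> real"
        by (simp add: sum_subtractf sum_distrib_left[symmetric])
      then show ?thesis .
    qed
    finally show ?thesis unfolding sw sc .
  qed
  have t2: "(\<Sum>w\<in>U. \<pi> w * (potential a b x (U - {w}) (del_vertex E w) - potential a b x U E))
      = - (\<Sum>u\<in>U. \<pi> u * F u) - b * (\<Sum>u\<in>U. D u)"
  proof -
    have "(\<Sum>w\<in>U. \<pi> w * (potential a b x (U - {w}) (del_vertex E w) - potential a b x U E))
      = (\<Sum>w\<in>U. - (\<pi> w * F w) - b * (\<pi> w * (\<Sum>u\<in>U - {w}. weight x (del_vertex E w) u - W u)))"
    proof (rule sum.cong[OF refl])
      fix w assume "w \<in> U"
      then have "{w} \<subseteq> U" by simp
      from potential_diff[OF finU this, of a b x "del_vertex E w" E]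
      have "potential a b x (U - {w}) (del_vertex E w) - potential a b x U E
        = - F w - b * (\<Sum>u\<in>U - {w}. weight x (del_vertex E w) u - W u)"
        by (simp add: F_def W_def)
      then show "\<pi> w * (potential a b x (U - {w}) (del_vertex E w) - potential a b x U E)
        = - (\<pi> w * F w) - b * (\<pi> w * (\<Sum>u\<in>U - {w}. weight x (del_vertex E w) u - W u))"
        by (simp only: right_diff_distrib mult_minus_right mult.left_commute[of b])
    qed
    also have "\<dots> = - (\<Sum>u\<in>U. \<pi> u * F u)
        - b * (\<Sum>w\<in>U. \<pi> w * (\<Sum>u\<in>U - {w}. weight x (del_vertex E w) u - W u))"
    proof -
      have "(\<Sum>v\<in>U. - A v - b * B v) = - (\<Sum>v\<in>U. A v) - b * (\<Sum>v\<in>U. B v)" for A B :: "'a \<Rightarrow> real"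
        by (simp add: sum_subtractf sum_negf sum_distrib_left[symmetric])
      then show ?thesis .
    qed
    finally show ?thesis unfolding sd .
  qed
  have main: "0 \<le> r + a' - b * (W u * S u) - r * ((1 + d u) * F u) - r * (b * C u) - \<pi> u * F u - b * D u"
    if u: "u \<in> U" for u
  proof -
    define R where "R = max \<rho> (r * d u)"
    have \<pi>u: "\<pi> u = R - r * d u" by (simp add: \<pi> R_def d_def)
    have Wp: "W u > 0" unfolding W_def by (rule weight_pos[OF xp])
    define c where "c e = (if card e = 2 then 0 else real (card e - 1) * (x (card e - 1) / x (card e) - 1))
        + ((\<Sum>w\<in>e - {u}. d w) - (if card e = 2 then 1 else 0)) * (1 / x (card e) - 1)" for e
    define l where "l e = (\<Sum>w\<in>e - {u}. \<pi> w) * (1 / x (card e) - 1)" for e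
    have Cu: "C u = W u * (\<Sum>e\<in>{e\<in>E. u \<in> e}. c e)"
      unfolding C_def W_def c_def d_def by (rule sum_weight_contract[OF H u xp])
    have Du: "D u = W u * (\<Sum>e\<in>{e\<in>E. u \<in> e}. l e)"
      unfolding D_def W_def l_def by (rule sum_weight_del[OF H xp])
    \<comment> \<open>Relative rate of change of the factor of one edge through time, selections and
      deletions. A 2-edge keeps a remainder: one of the events that destroy its other end is the
      selection of \<open>u\<close>, which does not lower the weight of a living \<open>u\<close>.
      By \<open>x2\<close> this costs at most \<open>r / 2\<close>.\<close>
    have edge: "x' (card e) / x (card e) + r * c e + l e \<le> (if card e = 2 then r / 2 else 0)"
      if e: "e \<in> E" "u \<in> e" for e
    proof -
      have fe: "finite e" using hypergraph_finite_edge[OF H e(1)] .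
      have ce: "card e \<in> {2, 3, 4}" using H e by (auto simp: uncrowded_hypergraph_def)
      have xi: "1 / x (card e) - 1 \<le> 0" using x1[of "card e"] by simp
      have "real (card e - 1) * \<rho> = (\<Sum>w\<in>e - {u}. \<rho>)" using e fe by simp
      also have "\<dots> \<le> (\<Sum>w\<in>e - {u}. r * d w + \<pi> w)"
        by (rule sum_mono) (simp add: \<pi> d_def)
      also have "\<dots> = r * (\<Sum>w\<in>e - {u}. d w) + (\<Sum>w\<in>e - {u}. \<pi> w)"
        by (simp add: sum.distrib sum_distrib_left)
      finally have "(r * (\<Sum>w\<in>e - {u}. d w) + (\<Sum>w\<in>e - {u}. \<pi> w)) * (1 / x (card e) - 1)
          \<le> real (card e - 1) * \<rho> * (1 / x (card e) - 1)"
        using xi by (rule mult_right_mono_neg)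
      then have le: "r * c e + l e \<le> (if card e = 2 then r * (1 - 1 / x 2)
          else r * (real (card e - 1) * (x (card e - 1) / x (card e) - 1)))
          + real (card e - 1) * \<rho> * (1 / x (card e) - 1)"
        unfolding c_def l_def by (auto simp: algebra_simps)
      from ce consider "card e = 2" | "card e = 3" | "card e = 4" by auto
      then show ?thesis
      proof cases
        case 1
        have "r * (1 - 1 / x 2) \<le> r * (1 / 2)" using x2 xp[of 2] by (intro mult_left_mono r) (simp add: field_simps)
        moreover have "x' 2 / x 2 + \<rho> * (1 / x 2 - 1) \<le> 0"
          using divide_right_mono[OF x2' less_imp_le[OF xp[of 2]]] xp[of 2] by (simp add: field_simps)
        moreover have "r * c e + l e \<le> r * (1 - 1 / x 2) + \<rho> * (1 / x 2 - 1)" using le 1 by simp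
        ultimately have "x' 2 / x 2 + r * c e + l e \<le> r * (1 / 2)" by argo
        then show ?thesis using 1 by simp
      next
        case 2
        have "x' 3 / x 3 + r * (2 * (x 2 / x 3 - 1)) + 2 * \<rho> * (1 / x 3 - 1) \<le> 0"
        proof -
          have "x' 3 / x 3 + r * (2 * (x 2 / x 3 - 1)) + 2 * \<rho> * (1 / x 3 - 1)
            = (x' 3 + 2 * (r * (x 2 - x 3) + \<rho> * (1 - x 3))) / x 3"
            using xp[of 3] by (simp add: field_simps)
          then show ?thesis using x3' xp[of 3] by (simp add: divide_nonpos_pos)
        qed
        moreover have "r * c e + l e \<le> r * (2 * (x 2 / x 3 - 1)) + 2 * \<rho> * (1 / x 3 - 1)" using le 2 by simp
        ultimately have "x' 3 / x 3 + r * c e + l e \<le> 0" by argo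
        then show ?thesis using 2 by simp
      next
        case 3
        have "x' 4 / x 4 + r * (3 * (x 3 / x 4 - 1)) + 3 * \<rho> * (1 / x 4 - 1) \<le> 0"
        proof -
          have "x' 4 / x 4 + r * (3 * (x 3 / x 4 - 1)) + 3 * \<rho> * (1 / x 4 - 1)
            = (x' 4 + 3 * (r * (x 3 - x 4) + \<rho> * (1 - x 4))) / x 4"
            using xp[of 4] by (simp add: field_simps)
          then show ?thesis using x4' xp[of 4] by (simp add: divide_nonpos_pos)
        qed
        moreover have "r * c e + l e \<le> r * (3 * (x 3 / x 4 - 1)) + 3 * \<rho> * (1 / x 4 - 1)" using le 3 by simp
        ultimately have "x' 4 / x 4 + r * c e + l e \<le> 0" by argo
        then show ?thesis using 3 by simp
      qed
    qed
    have finA: "finite {e\<in>E. u \<in> e}" using finE by simp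
    have "S u + r * (\<Sum>e\<in>{e\<in>E. u \<in> e}. c e) + (\<Sum>e\<in>{e\<in>E. u \<in> e}. l e)
        = (\<Sum>e\<in>{e\<in>E. u \<in> e}. x' (card e) / x (card e) + r * c e + l e)"
      by (simp add: S_def sum.distrib sum_distrib_left)
    also have "\<dots> \<le> (\<Sum>e\<in>{e\<in>E. u \<in> e}. if card e = 2 then r / 2 else 0)"
      by (rule sum_mono) (use edge in auto)
    also have "\<dots> = r * d u / 2"
      using finA two_edges_at[OF H u] by (simp add: sum.inter_filter[symmetric] d_def conj_assoc)
    finally have tot: "S u + r * (\<Sum>e\<in>{e\<in>E. u \<in> e}. c e) + (\<Sum>e\<in>{e\<in>E. u \<in> e}. l e) \<le> r * d u / 2" .
    \<comment> \<open>The removal rate \<open>r + R\<close> of \<open>u\<close> itself pays for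
      these remainders: \<open>R\<close> is at least \<open>r * d u\<close> and at least
      \<open>\<rho>\<close>, so subtracting half of \<open>r * d u\<close> still leaves
      \<open>\<rho> / 2\<close>.\<close>
    have "\<rho> / 2 \<le> (r + R) - r * d u / 2" using r by (auto simp: R_def max_def)
    also have "\<dots> \<le> (r + R) - (S u + r * (\<Sum>e\<in>{e\<in>E. u \<in> e}. c e) + (\<Sum>e\<in>{e\<in>E. u \<in> e}. l e))"
      using tot by simp
    finally have "W u * (\<rho> / 2) \<le> W u * ((r + R) - (S u + r * (\<Sum>e\<in>{e\<in>E. u \<in> e}. c e) + (\<Sum>e\<in>{e\<in>E. u \<in> e}. l e)))"
      using Wp by (intro mult_left_mono) auto
    also have "\<dots> = (r + R) * W u - W u * S u - r * C u - D u"
      unfolding Cu Du by (simp add: algebra_simps)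
    finally have 1: "b * (W u * (\<rho> / 2)) \<le> b * ((r + R) * W u - W u * S u - r * C u - D u)"
      using b by (rule mult_left_mono)
    have "x 2 ^ card (nbrs E u) = (\<Prod>e\<in>{e\<in>E. u \<in> e \<and> card e = 2}. x (card e))"
      using two_edges_at[OF H u] by simp
    also have "\<dots> \<le> W u"
      unfolding W_def weight_def
      by (rule prod_mono2) (use finE x1 xp in \<open>auto intro: less_imp_le\<close>)
    finally have "b * (\<rho> / 2) * x 2 ^ card (nbrs E u) \<le> b * (\<rho> / 2) * W u"
      using b \<rho> by (intro mult_left_mono) auto
    moreover have "r + a' - (r + R) * a + b * (\<rho> / 2) * x 2 ^ card (nbrs E u) \<ge> 0"
      using pw[of "card (nbrs E u)"] by (simp add: R_def d_def)
    ultimately have 2: "r + a' - (r + R) * a + b * (W u * (\<rho> / 2)) \<ge> 0" by (simp add: algebra_simps)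
    have "r + a' - b * (W u * S u) - r * ((1 + d u) * F u) - r * (b * C u) - \<pi> u * F u - b * D u
      = r + a' - (r + R) * a + b * ((r + R) * W u - W u * S u - r * C u - D u)"
      unfolding \<pi>u F_def W_def[symmetric] by (simp add: algebra_simps)
    then show ?thesis using 1 2 by linarith
  qed
  have "0 \<le> (\<Sum>u\<in>U. r + a' - b * (W u * S u) - r * ((1 + d u) * F u) - r * (b * C u) - \<pi> u * F u - b * D u)"
    by (rule sum_nonneg) (rule main)
  also have "\<dots> = r * (real (card U) - (\<Sum>u\<in>U. (1 + d u) * F u) - b * (\<Sum>u\<in>U. C u))
     + (- (\<Sum>u\<in>U. \<pi> u * F u) - b * (\<Sum>u\<in>U. D u)) + (\<Sum>u\<in>U. a' - b * (W u * S u))"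
    by (simp add: sum.distrib sum_subtractf sum_distrib_left algebra_simps)
  finally show ?thesis unfolding t1 t2 W_def S_def .
qed

section \<open>Comparison of the potential with the independence number\<close>

text \<open>From a negative value, go to the first later time at which \<open>f\<close> is
  nonnegative. Before it \<open>f\<close> is negative and hence does not increase, contrary to the
  mean value theorem.\<close>

lemma nonneg_of_nonneg_at_end:
  fixes f f' :: "real \<Rightarrow> real"
  assumes der: "\<And>t. \<lbrakk>0 \<le> t; t \<le> L\<rbrakk> \<Longrightarrow> (f has_real_derivative f' t) (at t)"
    and last: "f L \<ge> 0"
    and neg: "\<And>t. \<lbrakk>0 \<le> t; t \<le> L; f t < 0\<rbrakk> \<Longrightarrow> f' t \<le> 0"
    and t: "0 \<le> t" "t \<le> L"
  shows "f t \<ge> 0"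
proof (rule ccontr)
  assume "\<not> f t \<ge> 0"
  then have ft: "f t < 0" by simp
  define S where "S = {t..L} \<inter> f -` {0..}"
  have "continuous_on {t..L} f"
    by (rule DERIV_continuous_on[where D = f'])
      (use der t in \<open>auto intro: has_field_derivative_at_within\<close>)
  then have "closed S" unfolding S_def by (intro continuous_closed_preimage) auto
  moreover have "L \<in> S" using last t by (simp add: S_def)
  moreover have bdd: "bdd_below S" unfolding S_def by (rule bdd_belowI[of _ t]) auto
  ultimately have s: "Inf S \<in> S" by (intro closed_contains_Inf) auto
  then have ts: "t < Inf S" "Inf S \<le> L" and fs: "f (Inf S) \<ge> 0"
    using ft by (auto simp: S_def order.strict_iff_order)
  obtain z where z: "z > t" "z < Inf S" "f (Inf S) - f t = (Inf S - t) * f' z"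
    using MVT2[of t "Inf S" f f'] ts t der by (meson order_trans)
  have "z \<notin> S" using z(2) cInf_lower[OF _ bdd, of z] by auto
  then have "f z < 0" using z ts by (auto simp: S_def)
  then have "f' z \<le> 0" using neg[of z] z ts t by auto
  then show False using z ts fs ft by (smt (verit) mult_nonneg_nonpos)
qed

lemma weight_derivative:
  assumes pos: "\<And>k. x t k > 0"
    and der: "\<And>e. e \<in> E \<Longrightarrow> u \<in> e \<Longrightarrow> ((\<lambda>s. x s (card e)) has_real_derivative x' (card e)) (at t)"
  shows "((\<lambda>s. weight (x s) E u) has_real_derivative
      weight (x t) E u * (\<Sum>e\<in>{e\<in>E. u \<in> e}. x' (card e) / x t (card e))) (at t)"
  unfolding weight_def
  by (rule has_field_derivative_prod') (use der pos in \<open>auto simp: less_imp_neq[THEN not_sym]\<close>)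

text \<open>
  No random process is needed. For a fixed hypergraph let \<open>\<delta>(t)\<close> be the independence number minus the
  potential at time \<open>t\<close>. By induction on the number of vertices each move increases the potential by
  at most \<open>\<delta>(t)\<close>, so the drift inequality becomes \<open>\<delta>' \<le> R \<delta>\<close> with \<open>R \<ge> 0\<close>; hence \<open>\<delta>\<close>
  cannot be negative anywhere, since it would stay negative until the final time \<open>L\<close>.
\<close>

lemma alpha_ge_potential:
  fixes a a' r :: "real \<Rightarrow> real" and x x' :: "real \<Rightarrow> nat \<Rightarrow> real" and b \<rho> L :: real
  assumes a: "\<And>t. \<lbrakk>0 \<le> t; t \<le> L\<rbrakk> \<Longrightarrow> (a has_real_derivative a' t) (at t)"
    and x: "\<And>t k. \<lbrakk>0 \<le> t; t \<le> L; k \<in> {2, 3, 4}\<rbrakk> \<Longrightarrow> ((\<lambda>s. x s k) has_real_derivative x' t k) (at t)"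
    and r: "\<And>t. r t \<ge> 0" and b: "b \<ge> 0" and \<rho>: "\<rho> \<ge> 0" and aL: "a L = 0"
    and x1: "\<And>t k. \<lbrakk>0 \<le> t; t \<le> L\<rbrakk> \<Longrightarrow> x t k \<ge> 1"
    and x2: "\<And>t. \<lbrakk>0 \<le> t; t \<le> L\<rbrakk> \<Longrightarrow> x t 2 \<le> 2"
    and x4': "\<And>t. \<lbrakk>0 \<le> t; t \<le> L\<rbrakk> \<Longrightarrow> x' t 4 + 3 * (r t * (x t 3 - x t 4) + \<rho> * (1 - x t 4)) \<le> 0"
    and x3': "\<And>t. \<lbrakk>0 \<le> t; t \<le> L\<rbrakk> \<Longrightarrow> x' t 3 + 2 * (r t * (x t 2 - x t 3) + \<rho> * (1 - x t 3)) \<le> 0"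
    and x2': "\<And>t. \<lbrakk>0 \<le> t; t \<le> L\<rbrakk> \<Longrightarrow> x' t 2 + \<rho> * (1 - x t 2) \<le> 0"
    and pw: "\<And>t k. \<lbrakk>0 \<le> t; t \<le> L\<rbrakk> \<Longrightarrow>
      r t + a' t - (r t + max \<rho> (r t * real k)) * a t + b * (\<rho> / 2) * x t 2 ^ k \<ge> 0"
    and H: "uncrowded_hypergraph U E" and t: "0 \<le> t" "t \<le> L"
  shows "real (alpha U E) \<ge> potential (a t) b (x t) U E"
  using H t
proof (induction "card U" arbitrary: U E t rule: less_induct)
  case (less U E t)
  have H: "uncrowded_hypergraph U E" by fact
  have finU: "finite U" and finE: "finite E" and ce: "\<And>e. e \<in> E \<Longrightarrow> card e \<in> {2, 3, 4}"
    using H hypergraph_finite by (auto simp: uncrowded_hypergraph_def)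
  have xp: "x s k > 0" if "0 \<le> s" "s \<le> L" for s k using x1[OF that, of k] by simp
  define \<Phi> where "\<Phi> s = potential (a s) b (x s) U E" for s
  define \<Phi>' where "\<Phi>' s = (\<Sum>u\<in>U. a' s - b * (weight (x s) E u * (\<Sum>e\<in>{e\<in>E. u \<in> e}. x' s (card e) / x s (card e))))" for s
  have "real (alpha U E) - \<Phi> t \<ge> 0"
  proof (rule nonneg_of_nonneg_at_end[where L = L and f = "\<lambda>s. real (alpha U E) - \<Phi> s" and f' = "\<lambda>s. - \<Phi>' s"])
    fix s assume s: "0 \<le> s" "s \<le> L"
    have "((\<lambda>s. weight (x s) E u) has_real_derivative
        weight (x s) E u * (\<Sum>e\<in>{e\<in>E. u \<in> e}. x' s (card e) / x s (card e))) (at s)" for u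
      by (rule weight_derivative) (use xp[OF s] x[OF s ce] in auto)
    then have "(\<Phi> has_real_derivative \<Phi>' s) (at s)"
      unfolding \<Phi>_def[abs_def] \<Phi>'_def potential_def
      by (intro DERIV_sum DERIV_diff a[OF s] DERIV_cmult)
    then show "((\<lambda>s. real (alpha U E) - \<Phi> s) has_real_derivative - \<Phi>' s) (at s)"
      by (auto intro!: derivative_eq_intros)
  next
    have "\<Phi> L \<le> 0"
      unfolding \<Phi>_def potential_def aL using less.prems(2,3) b
      by (intro sum_nonpos) (simp add: weight_pos[OF xp] less_imp_le)
    then show "real (alpha U E) - \<Phi> L \<ge> 0" by simp
  next
    fix s assume s: "0 \<le> s" "s \<le> L" and neg: "real (alpha U E) - \<Phi> s < 0"
    define \<pi> where "\<pi> w = max \<rho> (r s * real (card (nbrs E w))) - r s * real (card (nbrs E w))" for w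
    have \<pi>0: "\<pi> w \<ge> 0" for w by (simp add: \<pi>_def)
    have sel: "1 + (potential (a s) b (x s) (U - insert v (nbrs E v)) (contract E v) - \<Phi> s) \<le> real (alpha U E) - \<Phi> s"
      if v: "v \<in> U" for v
    proof -
      have "card (U - insert v (nbrs E v)) < card U"
        by (rule psubset_card_mono[OF finU]) (use v in blast)
      from less.hyps[OF this hypergraph_contract[OF H] s] alpha_contract[OF H v] show ?thesis by simp
    qed
    have del: "potential (a s) b (x s) (U - {v}) (del_vertex E v) - \<Phi> s \<le> real (alpha U E) - \<Phi> s"
      if v: "v \<in> U" for v
    proof -
      have "card (U - {v}) < card U" by (rule psubset_card_mono[OF finU]) (use v in blast)
      from less.hyps[OF this hypergraph_del[OF H] s] alpha_del[OF H, of v] show ?thesis by simp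
    qed
    have "0 \<le> (\<Sum>v\<in>U. r s * (1 + (potential (a s) b (x s) (U - insert v (nbrs E v)) (contract E v) - \<Phi> s)))
     + (\<Sum>w\<in>U. \<pi> w * (potential (a s) b (x s) (U - {w}) (del_vertex E w) - \<Phi> s)) + \<Phi>' s"
      unfolding \<Phi>_def \<Phi>'_def
      by (rule potential_drift[OF H r b x1[OF s] x2[OF s] x4'[OF s] x3'[OF s] x2'[OF s] pw[OF s] \<rho> \<pi>_def])
    also have "\<dots> \<le> (\<Sum>v\<in>U. r s * (real (alpha U E) - \<Phi> s)) + (\<Sum>w\<in>U. \<pi> w * (real (alpha U E) - \<Phi> s)) + \<Phi>' s"
      using sel del r \<pi>0 by (intro add_mono sum_mono mult_left_mono order_refl) auto
    also have "\<dots> \<le> 0 + 0 + \<Phi>' s"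
      using neg r[of s] \<pi>0 by (intro add_mono sum_nonpos order_refl) (auto intro: mult_nonneg_nonpos)
    finally show "- \<Phi>' s \<le> 0" by simp
  qed (use less.prems in auto)
  then show ?case by (simp add: \<Phi>_def)
qed

section \<open>Choice of the parameters\<close>

text \<open>Turns the power \<open>x t 2 ^ k\<close> into an exponential, with a loss of a factor 2
  in the exponent.\<close>

lemma exp_half_le: "exp (y / 2) \<le> 1 + (y::real)" if "0 \<le> y" "y \<le> 1"
proof -
  have "exp (y / 2) \<le> 1 + y / 2 + (y / 2)\<^sup>2" by (rule exp_bound) (use that in auto)
  also have "\<dots> \<le> 1 + y"
    using that mult_left_mono[of y 1 y] by (simp add: power2_eq_square field_simps)
  finally show ?thesis .
qed

text \<open>
  Time is the density of selected vertices. The heuristic fraction of vertices still alive at time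
  \<open>t\<close> is \<open>exp (- \<rho> t)\<close>, so a selection rate of \<open>exp (\<rho> t)\<close> per living vertex is constant
  in total; a 4-edge with two (one) selected vertices then turns up at a living vertex with multiplicity
  of order \<open>D t\<^sup>2\<close> (\<open>D t\<close>) times a power of the living fraction, whence the choice \<open>\<rho> = 12 D L\<^sup>2\<close> and
  the shape of \<open>x\<close>. The factor \<open>h\<close> keeps \<open>x t 2\<close> below 2 up to time \<open>L\<close>.
\<close>

lemma uncrowded_independent:
  fixes L D :: real and E :: "'a set set"
  assumes H: "uncrowded_hypergraph U E" and c4: "\<And>e. e \<in> E \<Longrightarrow> card e = 4"
    and deg: "\<And>u. u \<in> U \<Longrightarrow> real (card {e\<in>E. u \<in> e}) \<le> D"
    and L: "L > 0" and big: "12 * D * L\<^sup>2 \<ge> 8" and small: "8 * L * exp (12 * D * L\<^sup>2 * L) \<le> 1"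
  shows "\<exists>S\<subseteq>U. indep E S \<and> real (card S) \<ge> real (card U) * L / 4"
proof -
  define \<rho> where "\<rho> = 12 * D * L\<^sup>2"
  have \<rho>: "\<rho> \<ge> 8" using big by (simp add: \<rho>_def)
  define h where "h = exp (- (\<rho> * L))"
  have h: "h > 0" by (simp add: h_def)
  have hL: "8 * L \<le> h"
    using small exp_gt_zero[of "\<rho> * L"] unfolding h_def \<rho>_def[symmetric] exp_minus
    by (simp add: field_simps)
  define r where "r t = exp (\<rho> * t)" for t
  have hr: "h * r t \<le> 1" if "t \<le> L" for t
  proof -
    have "h * r t = exp (\<rho> * (t - L))" by (simp add: h_def r_def exp_add[symmetric] algebra_simps)
    also have "\<dots> \<le> 1" using \<rho> that by (simp add: mult_nonneg_nonpos)
    finally show ?thesis .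
  qed
  have r0: "r t > 0" for t by (simp add: r_def)
  \<comment> \<open>Remaining time times rate, halved: the half given up leaves
    \<open>r t / 2\<close> to pay for \<open>r t * a t\<close>, the loss of the selected vertex
    itself, since \<open>a t \<le> 1 / 2\<close>.\<close>
  define a where "a t = (L - t) * r t / 2" for t
  define a' where "a' t = \<rho> * a t - r t / 2" for t
  \<comment> \<open>Chosen so that a vertex with \<open>r t * real k = \<rho> + z\<close> has a
    compensation of at least \<open>z * L / (2 * h)\<close> in \<open>pw\<close>; by
    \<open>aA\<close> its excess costs no more than that.\<close>
  define b where "b = 2 * L / (\<rho> * h\<^sup>2) * exp (- (h * \<rho> / 2))"
  \<comment> \<open>The drift conditions hold with equality, apart from the terms
    \<open>- 3 * r t * (x t 4 - 1)\<close> and \<open>- 2 * r t * (x t 3 - 1)\<close>, which have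
    the right sign and are given away. The default 1 serves the bound \<open>x t k \<ge> 1\<close>,
    which is asked for all \<open>k\<close>.\<close>
  define x where "x t k = (if k = 2 then 1 + h * r t else if k = 3 then 1 + 2 * h * (L - t) * r t ^ 2
      else if k = 4 then 1 + 3 * h * (L - t)\<^sup>2 * r t ^ 3 else 1)" for t and k :: nat
  define x' where "x' t k = (if k = 2 then \<rho> * (h * r t)
      else if k = 3 then 2 * \<rho> * (2 * h * (L - t) * r t ^ 2) - 2 * h * r t ^ 2
      else 3 * \<rho> * (3 * h * (L - t)\<^sup>2 * r t ^ 3) - 6 * h * (L - t) * r t ^ 3)" for t and k :: nat
  have dr: "(r has_real_derivative \<rho> * r t) (at t)" for t
    unfolding r_def[abs_def] by (auto intro!: derivative_eq_intros)
  have b0: "b > 0" using L \<rho> h by (simp add: b_def)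
  have aA: "a t \<le> L / (2 * h)" if "0 \<le> t" "t \<le> L" for t
  proof -
    have "(L - t) * (h * r t) \<le> L * 1"
      using hr[OF that(2)] that L h r0[of t] by (intro mult_mono) auto
    then show ?thesis using h by (simp add: a_def field_simps)
  qed
  have "potential (a 0) b (x 0) U E \<le> real (alpha U E)"
  proof (rule alpha_ge_potential[where r = r and a' = a' and x' = x' and \<rho> = \<rho> and L = L])
    fix t :: real assume t: "0 \<le> t" "t \<le> L"
    show "(a has_real_derivative a' t) (at t)"
      unfolding a_def[abs_def] a'_def
      by (auto intro!: derivative_eq_intros dr simp: a_def field_simps)
    show "((\<lambda>s. x s k) has_real_derivative x' t k) (at t)" if "k \<in> {2, 3, 4}" for k
    proof -
      from that consider "k = 2" | "k = 3" | "k = 4" by auto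
      then show ?thesis
      proof cases
        case 1
        show ?thesis unfolding 1 x_def x'_def by (auto intro!: derivative_eq_intros dr)
      next
        case 2
        show ?thesis unfolding 2 x_def x'_def
          by (auto intro!: derivative_eq_intros dr simp: power2_eq_square algebra_simps)
      next
        case 3
        show ?thesis unfolding 3 x_def x'_def
          by (auto intro!: derivative_eq_intros dr simp: power2_eq_square power3_eq_cube algebra_simps)
      qed
    qed
    show "x t k \<ge> 1" for k using t h r0[of t] by (auto simp: x_def)
    show "x t 2 \<le> 2" using hr[OF t(2)] by (simp add: x_def)
    have "0 \<le> h * (L - t)\<^sup>2 * r t ^ 4"
      using h r0[of t] t by auto
    then show "x' t 4 + 3 * (r t * (x t 3 - x t 4) + \<rho> * (1 - x t 4)) \<le> 0"
      by (simp add: x_def x'_def power2_eq_square power3_eq_cube power4_eq_xxxx algebra_simps)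
    have "0 \<le> h * (L - t) * r t ^ 3" using h r0[of t] t by auto
    then show "x' t 3 + 2 * (r t * (x t 2 - x t 3) + \<rho> * (1 - x t 3)) \<le> 0"
      by (simp add: x_def x'_def power2_eq_square power3_eq_cube algebra_simps)
    show "x' t 2 + \<rho> * (1 - x t 2) \<le> 0" by (simp add: x_def x'_def)
    show "r t + a' t - (r t + max \<rho> (r t * real k)) * a t + b * (\<rho> / 2) * x t 2 ^ k \<ge> 0" for k
    proof -
      have a0: "0 \<le> a t" using t r0[of t] by (simp add: a_def)
      have "L / (2 * h) \<le> 1 / 2" using hL L h by (simp add: field_simps)
      then have "a t \<le> 1 / 2" using aA[OF t] by simp
      then have ra: "r t * a t \<le> r t * (1 / 2)" using r0[of t] by (intro mult_left_mono) auto
      have "(max \<rho> (r t * real k) - \<rho>) * a t \<le> b * (\<rho> / 2) * x t 2 ^ k"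
      proof (cases "r t * real k \<le> \<rho>")
        case True
        then show ?thesis using b0 \<rho> h r0[of t] by (simp add: max_absorb1 x_def)
      next
        case False
        \<comment> \<open>The cost is linear in the excess \<open>z\<close> while the weight grows
          exponentially, so the linear lower bound of \<open>exp (h * z / 2)\<close> is
          enough.\<close>
        define z where "z = r t * real k - \<rho>"
        have z: "z > 0" using False by (simp add: z_def)
        have "h * z / 2 * exp (h * \<rho> / 2) \<le> exp (h * z / 2) * exp (h * \<rho> / 2)"
          by (rule mult_right_mono) (use exp_ge_add_one_self[of "h * z / 2"] in linarith, simp)
        also have "\<dots> = exp (h * r t / 2) ^ k"
          by (simp add: exp_add[symmetric] exp_of_nat_mult[symmetric] z_def algebra_simps add_divide_distrib diff_divide_distrib)
        also have "\<dots> \<le> x t 2 ^ k"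
          using exp_half_le[of "h * r t"] hr[OF t(2)] h r0[of t] by (intro power_mono) (auto simp: x_def)
        finally have "b * (\<rho> / 2) * (h * z / 2 * exp (h * \<rho> / 2)) \<le> b * (\<rho> / 2) * x t 2 ^ k"
          using b0 \<rho> by (intro mult_left_mono) auto
        moreover have "b * (\<rho> / 2) * (h * z / 2 * exp (h * \<rho> / 2)) = z * (L / (2 * h))"
          using \<rho> h by (simp add: b_def exp_minus power2_eq_square field_simps)
        moreover have "z * a t \<le> z * (L / (2 * h))" using aA[OF t] z by (intro mult_left_mono) auto
        moreover have "max \<rho> (r t * real k) - \<rho> = z" using z by (simp add: z_def max_def)
        ultimately show ?thesis by (metis order_trans)
      qed
      then show ?thesis using ra by (simp add: a'_def algebra_simps)
    qed
  qed (use \<rho> b0 L H r0 in \<open>auto simp: a_def less_imp_le\<close>)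
  moreover have "real (card U) * (L / 4) \<le> potential (a 0) b (x 0) U E"
  proof -
    \<comment> \<open>The constants meet here. The 12 in \<open>\<rho>\<close> makes the initial
      weight at most \<open>exp (h * \<rho> / 4)\<close>, half of the exponent in \<open>b\<close>;
      \<open>8 * L \<le> h\<close> bounds the remaining \<open>exp (- (h * \<rho> / 4))\<close> by
      \<open>h\<^sup>2\<close>; and \<open>\<rho> \<ge> 8\<close> bounds the discount by
      \<open>L / 4\<close>, half of \<open>a 0\<close>.\<close>
    have "L / 4 \<le> a 0 - b * weight (x 0) E u" if u: "u \<in> U" for u
    proof -
      have x4: "x 0 4 = 1 + 3 * h * L\<^sup>2" by (simp add: x_def r_def)
      have "weight (x 0) E u = (1 + 3 * h * L\<^sup>2) ^ card {e\<in>E. u \<in> e}"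
        unfolding weight_def by (simp add: c4 x4)
      also have "\<dots> \<le> exp (3 * h * L\<^sup>2) ^ card {e\<in>E. u \<in> e}"
        using h by (intro power_mono) auto
      also have "\<dots> = exp (3 * h * L\<^sup>2 * real (card {e\<in>E. u \<in> e}))"
        by (simp add: exp_of_nat_mult[symmetric] mult.commute)
      also have "\<dots> \<le> exp (3 * h * L\<^sup>2 * D)"
        using deg[OF u] h by (simp add: mult_left_mono)
      also have "3 * h * L\<^sup>2 * D = h * \<rho> / 4" by (simp add: \<rho>_def)
      finally have "b * weight (x 0) E u \<le> b * exp (h * \<rho> / 4)" using b0 by (intro mult_left_mono) auto
      also have "\<dots> = 2 * L / (\<rho> * h\<^sup>2) * exp (- (h * \<rho> / 4))"
        by (simp add: b_def exp_add[symmetric])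
      also have "\<dots> \<le> 2 * L / (\<rho> * h\<^sup>2) * h\<^sup>2"
      proof -
        have "8 * L * \<rho> \<le> h * \<rho>" using hL \<rho> by (intro mult_right_mono) auto
        then have "exp (- (h * \<rho> / 4)) \<le> exp (- (\<rho> * L) + - (\<rho> * L))" by simp
        also have "\<dots> = h\<^sup>2" unfolding exp_add by (simp add: h_def power2_eq_square)
        finally show ?thesis using L \<rho> h by (intro mult_left_mono) auto
      qed
      also have "\<dots> = 2 * L / \<rho>" using h by simp
      also have "\<dots> \<le> L / 4" using \<rho> L by (simp add: field_simps)
      finally show ?thesis by (simp add: a_def r_def)
    qed
    then show ?thesis unfolding potential_def by (rule sum_bounded_below)
  qed
  moreover obtain S where "S \<subseteq> U" "indep E S" "card S = alpha U E"
    using alpha_attained[of U E] hypergraph_no_empty[OF H] H by (auto simp: uncrowded_hypergraph_def)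
  ultimately show ?thesis by (intro exI[of _ S]) simp
qed

lemma uncrowded_independent_log:
  "\<exists>c>0. \<exists>D0. \<forall>D\<ge>D0. \<forall>U (E::'a set set).
     uncrowded_hypergraph U E \<longrightarrow> (\<forall>e\<in>E. card e = 4) \<longrightarrow> (\<forall>u\<in>U. real (card {e\<in>E. u \<in> e}) \<le> D) \<longrightarrow>
     (\<exists>S\<subseteq>U. indep E S \<and> real (card S) \<ge> c * real (card U) * (ln D / D) powr (1/3))"
proof -
  \<comment> \<open>With 72 the exponent \<open>12 * D * (L D)\<^sup>2 * L D\<close> equals
    \<open>ln D / 6\<close>, so its exponential is \<open>D powr (1/6)\<close>, which the factor
    \<open>L D\<close> of order \<open>(ln D / D) powr (1/3)\<close> outweighs.\<close>
  define L :: "real \<Rightarrow> real" where "L D = (ln D / (72 * D)) powr (1/3)" for D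
  have "eventually (\<lambda>D::real. 12 * D * (L D)\<^sup>2 \<ge> 8) at_top"
    unfolding L_def by real_asymp
  moreover have "eventually (\<lambda>D::real. 8 * (ln D / (72 * D)) powr (1/3) * D powr (1/6) \<le> 1) at_top"
    by real_asymp
  moreover have "eventually (\<lambda>D::real. D > 1) at_top" by real_asymp
  ultimately have "eventually (\<lambda>D. 12 * D * (L D)\<^sup>2 \<ge> 8 \<and> 8 * L D * D powr (1/6) \<le> 1 \<and> D > 1) at_top"
    unfolding L_def by eventually_elim auto
  then obtain D0 where D0: "\<And>D. D \<ge> D0 \<Longrightarrow> 12 * D * (L D)\<^sup>2 \<ge> 8 \<and> 8 * L D * D powr (1/6) \<le> 1 \<and> D > 1"
    unfolding eventually_at_top_linorder by blast
  define c :: real where "c = (1 / 72) powr (1/3) / 4"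
  show ?thesis
  proof (rule exI[of _ c], rule conjI, goal_cases)
    case 2
    show ?case
    proof (rule exI[of _ "max 2 D0"], intro allI impI)
    fix D U and E :: "'a set set"
    assume D: "D \<ge> max 2 D0" and H: "uncrowded_hypergraph U E" and c4: "\<forall>e\<in>E. card e = 4"
      and deg: "\<forall>u\<in>U. real (card {e\<in>E. u \<in> e}) \<le> D"
    have D1: "D > 1" using D by simp
    have L0: "L D > 0" using D1 by (simp add: L_def)
    have "(L D)\<^sup>2 * L D = L D powr 3" using L0 by (simp add: powr_numeral power2_eq_square power3_eq_cube)
    also have "\<dots> = ln D / (72 * D)" using D1 by (simp add: L_def powr_powr)
    finally have "12 * D * (L D)\<^sup>2 * L D = ln D * (1/6)" using D1 by (simp add: field_simps)
    then have "exp (12 * D * (L D)\<^sup>2 * L D) = D powr (1/6)" using D1 by (simp add: powr_def)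
    then have "\<exists>S\<subseteq>U. indep E S \<and> real (card S) \<ge> real (card U) * L D / 4"
      using D0[of D] D by (intro uncrowded_independent[OF H c4[rule_format] deg[rule_format] L0]) auto
    moreover have "L D = 4 * c * (ln D / D) powr (1/3)"
    proof -
      have "L D = (1 / 72 * (ln D / D)) powr (1/3)" by (simp add: L_def)
      also have "\<dots> = (1 / 72) powr (1/3) * (ln D / D) powr (1/3)" using D1 by (intro powr_mult)
      finally show ?thesis by (simp add: c_def)
    qed
    ultimately show "\<exists>S\<subseteq>U. indep E S \<and> real (card S) \<ge> c * real (card U) * (ln D / D) powr (1/3)"
      by (simp add: mult.assoc mult.left_commute)
    qed
  qed (simp add: c_def)
qed

section \<open>Sparse subsets without short cycles\<close>

text \<open>
  The left-hand side is the expectation of the right-hand side for a random subset of density \<open>p\<close>; as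
  a polynomial in the inclusion probabilities it is affine in each of them, so they can be rounded to
  0 or 1 one after the other.
\<close>

lemma rounding:
  fixes X :: "'j \<Rightarrow> 'a set" and c :: "'j \<Rightarrow> real"
  assumes p: "0 \<le> p" "p \<le> 1" and "finite V" "finite J" "\<And>j. j \<in> J \<Longrightarrow> X j \<subseteq> V"
  shows "\<exists>S\<subseteq>V. p * real (card V) - (\<Sum>j\<in>J. c j * p ^ card (X j))
           \<le> real (card S) - (\<Sum>j\<in>{j\<in>J. X j \<subseteq> S}. c j)"
  using assms(3-5)
proof (induction V arbitrary: X J)
  case empty
  then have "{j\<in>J. X j \<subseteq> {}} = J" "\<And>j. j \<in> J \<Longrightarrow> X j = {}" by auto
  then show ?case by (intro exI[of _ "{}"]) simp
next
  case (insert v V X J)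
  define J1 where "J1 = {j\<in>J. v \<in> X j}"
  define J0 where "J0 = {j\<in>J. v \<notin> X j}"
  have J: "J = J0 \<union> J1" "J0 \<inter> J1 = {}" "finite J0" "finite J1"
    using insert.prems by (auto simp: J0_def J1_def)
  have finX: "finite (X j)" if "j \<in> J" for j
    using insert.prems(2)[OF that] insert.hyps by (auto intro: finite_subset)
  \<comment> \<open>\<open>S1\<close> and \<open>S0\<close> come from setting the probability of
    \<open>v\<close> to 1 and to 0. In the first case \<open>v\<close> is removed from the sets,
    which may thereby coincide; this is why they form an indexed family.\<close>
  obtain S1 where S1: "S1 \<subseteq> V" "p * real (card V) - (\<Sum>j\<in>J. c j * p ^ card (X j - {v}))
      \<le> real (card S1) - (\<Sum>j\<in>{j\<in>J. X j - {v} \<subseteq> S1}. c j)"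
  proof -
    have "X j - {v} \<subseteq> V" if "j \<in> J" for j using insert.prems(2)[OF that] by auto
    from insert.IH[of J "\<lambda>j. X j - {v}", OF insert.prems(1) this] that show ?thesis by blast
  qed
  obtain S0 where S0: "S0 \<subseteq> V" "p * real (card V) - (\<Sum>j\<in>J0. c j * p ^ card (X j))
      \<le> real (card S0) - (\<Sum>j\<in>{j\<in>J0. X j \<subseteq> S0}. c j)"
  proof -
    have "X j \<subseteq> V" if "j \<in> J0" for j using insert.prems(2)[of j] that by (auto simp: J0_def)
    from insert.IH[of J0 X, OF J(3) this] that show ?thesis by blast
  qed
  have v: "v \<notin> S1" "v \<notin> S0" using S1 S0 insert.hyps by auto
  define g1 where "g1 = real (card (insert v S1)) - (\<Sum>j\<in>{j\<in>J. X j \<subseteq> insert v S1}. c j)"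
  define g0 where "g0 = real (card S0) - (\<Sum>j\<in>{j\<in>J. X j \<subseteq> S0}. c j)"
  have e1: "{j\<in>J. X j \<subseteq> insert v S1} = {j\<in>J. X j - {v} \<subseteq> S1}" by auto
  have e0: "{j\<in>J. X j \<subseteq> S0} = {j\<in>J0. X j \<subseteq> S0}" using v by (auto simp: J0_def)
  have "finite S1" using S1 insert.hyps finite_subset by auto
  then have 1: "1 + (p * real (card V) - (\<Sum>j\<in>J. c j * p ^ card (X j - {v}))) \<le> g1"
    unfolding g1_def e1 using S1(2) v by simp
  have 0: "p * real (card V) - (\<Sum>j\<in>J0. c j * p ^ card (X j)) \<le> g0"
    unfolding g0_def e0 using S0(2) .
  have "(\<Sum>j\<in>J. c j * p ^ card (X j - {v})) = (\<Sum>j\<in>J0. c j * p ^ card (X j)) + (\<Sum>j\<in>J1. c j * p ^ card (X j - {v}))"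
    unfolding J(1) by (subst sum.union_disjoint[OF J(3,4,2)]) (auto simp: J0_def intro!: sum.cong)
  moreover have "p * (\<Sum>j\<in>J1. c j * p ^ card (X j - {v})) = (\<Sum>j\<in>J1. c j * p ^ card (X j))"
    unfolding sum_distrib_left
  proof (rule sum.cong[OF refl])
    fix j assume "j \<in> J1"
    then have "card (X j) = Suc (card (X j - {v}))"
      using finX by (intro card.remove) (auto simp: J1_def)
    then show "p * (c j * p ^ card (X j - {v})) = c j * p ^ card (X j)" by simp
  qed
  moreover have "(\<Sum>j\<in>J. c j * p ^ card (X j)) = (\<Sum>j\<in>J0. c j * p ^ card (X j)) + (\<Sum>j\<in>J1. c j * p ^ card (X j))"
    unfolding J(1) by (rule sum.union_disjoint[OF J(3,4,2)])
  moreover have "real (card (insert v V)) = 1 + real (card V)" using insert.hyps by simp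
  ultimately have "p * real (card (insert v V)) - (\<Sum>j\<in>J. c j * p ^ card (X j))
    = p * (1 + (p * real (card V) - (\<Sum>j\<in>J. c j * p ^ card (X j - {v}))))
      + (1 - p) * (p * real (card V) - (\<Sum>j\<in>J0. c j * p ^ card (X j)))"
    by (simp add: algebra_simps)
  also have "\<dots> \<le> p * g1 + (1 - p) * g0"
    using 0 1 p by (intro add_mono mult_left_mono) auto
  also have "\<dots> \<le> p * max g0 g1 + (1 - p) * max g0 g1"
    using p by (intro add_mono mult_left_mono) auto
  also have "\<dots> = max g0 g1" by (simp add: algebra_simps)
  finally have le: "p * real (card (insert v V)) - (\<Sum>j\<in>J. c j * p ^ card (X j)) \<le> max g0 g1" .
  show ?case
  proof (cases "g0 \<le> g1")
    case True
    with le S1(1) show ?thesis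
      by (intro exI[of _ "insert v S1"]) (auto simp: g1_def max_def)
  next
    case False
    with le S0(1) show ?thesis
      by (intro exI[of _ S0]) (auto simp: g0_def max_def)
  qed
qed

text \<open>Alteration with a single weighted count for two tasks. Each edge is penalised by
  \<open>l\<close>, fixed so that the expected penalty of all edges is at most
  \<open>p * card V / 4\<close>. The realised penalty is carried along until it bounds the number of
  vertices of large degree; bad sets lose a point each before that.\<close>

lemma sparse_subset:
  fixes V :: "'a set" and H Bad :: "'a set set" and p d :: real
  assumes p: "0 < p" "p \<le> 1" and V: "finite V" and H: "\<And>e. e \<in> H \<Longrightarrow> e \<subseteq> V \<and> card e = 4"
    and Bad: "\<And>X. X \<in> Bad \<Longrightarrow> X \<subseteq> V \<and> X \<noteq> {}"
    and bad: "(\<Sum>X\<in>Bad. p ^ card X) \<le> p * real (card V) / 4"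
    and d: "d > 0" and cH: "real (card H) \<le> real (card V) * d"
  shows "\<exists>W\<subseteq>V. real (card W) \<ge> p * real (card V) / 4 \<and> (\<forall>X\<in>Bad. \<not> X \<subseteq> W)
    \<and> (\<forall>u\<in>W. real (card {e\<in>{e\<in>H. e \<subseteq> W}. u \<in> e}) \<le> 32 * d * p ^ 3)"
proof -
  define N where "N = real (card V)"
  define l where "l = 1 / (4 * d * p ^ 3)"
  have l: "l > 0" using d p by (simp add: l_def)
  have pN: "p * N \<ge> 0" using p by (simp add: N_def)
  have finB: "finite Bad" using Bad V by (intro finite_subset[of Bad "Pow V"]) auto
  have finH: "finite H" using H V by (intro finite_subset[of H "Pow V"]) auto
  \<comment> \<open>The two penalties are added because a bad set may be an edge as well.\<close>
  define c where "c X = (if X \<in> Bad then 1 else 0) + (if X \<in> H then l else 0)" for X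
  obtain S where S: "S \<subseteq> V" "p * N - (\<Sum>X\<in>Bad \<union> H. c X * p ^ card X)
      \<le> real (card S) - (\<Sum>X\<in>{X\<in>Bad \<union> H. X \<subseteq> S}. c X)"
    using rounding[of p V "Bad \<union> H" "\<lambda>X. X" c] p V finB finH H Bad unfolding N_def by auto
  have split: "(\<Sum>X\<in>{X\<in>Bad \<union> H. P X}. c X * q X) = (\<Sum>X\<in>{X\<in>Bad. P X}. q X) + l * (\<Sum>X\<in>{X\<in>H. P X}. q X)"
    for P and q :: "'a set \<Rightarrow> real"
  proof -
    have "(\<Sum>X\<in>{X\<in>Bad \<union> H. P X}. c X * q X) = (\<Sum>X\<in>{X\<in>Bad \<union> H. P X}. if X \<in> Bad then q X else 0)
       + (\<Sum>X\<in>{X\<in>Bad \<union> H. P X}. if X \<in> H then l * q X else 0)"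
      unfolding sum.distrib[symmetric] by (rule sum.cong) (auto simp: c_def algebra_simps)
    also have "(\<Sum>X\<in>{X\<in>Bad \<union> H. P X}. if X \<in> Bad then q X else 0) = (\<Sum>X\<in>{X\<in>Bad. P X}. q X)"
      using finB finH by (intro sum.mono_neutral_cong_right) auto
    also have "(\<Sum>X\<in>{X\<in>Bad \<union> H. P X}. if X \<in> H then l * q X else 0) = l * (\<Sum>X\<in>{X\<in>H. P X}. q X)"
      unfolding sum_distrib_left using finB finH by (intro sum.mono_neutral_cong_right) auto
    finally show ?thesis .
  qed
  define nb where "nb = real (card {X\<in>Bad. X \<subseteq> S})"
  define nh where "nh = real (card {X\<in>H. X \<subseteq> S})"
  have "(\<Sum>X\<in>Bad \<union> H. c X * p ^ card X) = (\<Sum>X\<in>Bad. p ^ card X) + l * (\<Sum>X\<in>H. p ^ card X)"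
    using split[where P = "\<lambda>_. True" and q = "\<lambda>X. p ^ card X"]
    by (simp only: simp_thms Collect_mem_eq)
  also have "(\<Sum>X\<in>H. p ^ card X) = real (card H) * p ^ 4" using H by simp
  also have "l * (real (card H) * p ^ 4) \<le> l * (N * d * p ^ 4)"
    using cH p l by (intro mult_left_mono mult_right_mono) (auto simp: N_def)
  also have "l * (N * d * p ^ 4) = p * N / 4"
    using d p by (simp add: l_def field_simps power3_eq_cube power4_eq_xxxx)
  finally have "(\<Sum>X\<in>Bad \<union> H. c X * p ^ card X) \<le> p * N / 2" using bad by (simp add: N_def)
  moreover have "(\<Sum>X\<in>{X\<in>Bad \<union> H. X \<subseteq> S}. c X) = nb + l * nh"
    using split[where P = "\<lambda>X. X \<subseteq> S" and q = "\<lambda>_. 1"] by (simp add: nb_def nh_def)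
  ultimately have big: "p * N / 2 + nb + l * nh \<le> real (card S)" using S(2) by linarith
  have finS: "finite S" using S(1) V finite_subset by auto
  define V1 where "V1 = S - (\<lambda>X. SOME x. x \<in> X) ` {X\<in>Bad. X \<subseteq> S}"
  have "real (card S) - nb \<le> real (card V1)"
  proof -
    have "card S \<le> card (V1 \<union> (\<lambda>X. SOME x. x \<in> X) ` {X\<in>Bad. X \<subseteq> S})"
      by (rule card_mono) (use finS finB in \<open>auto simp: V1_def\<close>)
    also have "\<dots> \<le> card V1 + card ((\<lambda>X. SOME x. x \<in> X) ` {X\<in>Bad. X \<subseteq> S})"
      by (rule card_Un_le)
    also have "\<dots> \<le> card V1 + card {X\<in>Bad. X \<subseteq> S}" using finB by (simp add: card_image_le)
    finally show ?thesis by (simp add: nb_def)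
  qed
  with big have V1: "p * N / 2 + l * nh \<le> real (card V1)" by simp
  have finV1: "finite V1" using finS by (simp add: V1_def)
  define deg where "deg u = card {e\<in>{e\<in>H. e \<subseteq> V1}. u \<in> e}" for u
  define D where "D = 32 * d * p ^ 3"
  have D: "D = 8 / l" "D > 0" using d p by (auto simp: D_def l_def field_simps)
  \<comment> \<open>Markov's inequality: the degrees sum to at most \<open>4 * nh\<close>, and
    \<open>l * nh\<close> is at most \<open>card V1\<close>, so with threshold \<open>8 / l\<close>
    at most half of \<open>V1\<close> is discarded.\<close>
  define Q where "Q = {u\<in>V1. real (deg u) > D}"
  have "(\<Sum>u\<in>V1. real (deg u)) = (\<Sum>u\<in>V1. \<Sum>e\<in>{e\<in>{e\<in>H. e \<subseteq> V1}. u \<in> e}. 1)"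
    by (simp add: deg_def)
  also have "\<dots> = (\<Sum>e\<in>{e\<in>H. e \<subseteq> V1}. \<Sum>u\<in>{u\<in>V1. u \<in> e}. 1)"
    by (rule sum.swap_restrict) (use finV1 finH in auto)
  also have "\<dots> \<le> (\<Sum>e\<in>{e\<in>H. e \<subseteq> V1}. 4)"
  proof (rule sum_mono)
    fix e assume "e \<in> {e\<in>H. e \<subseteq> V1}"
    then have "{u\<in>V1. u \<in> e} = e" "card e = 4" using H by auto
    then show "(\<Sum>u\<in>{u\<in>V1. u \<in> e}. 1) \<le> (4::real)" by simp
  qed
  also have "\<dots> \<le> 4 * nh"
    unfolding nh_def using finH by (auto simp: V1_def intro!: card_mono)
  finally have degsum: "(\<Sum>u\<in>V1. real (deg u)) \<le> 4 * nh" .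
  have "D * real (card Q) = (\<Sum>u\<in>Q. D)" by simp
  also have "\<dots> \<le> (\<Sum>u\<in>Q. real (deg u))" by (rule sum_mono) (simp add: Q_def)
  also have "\<dots> \<le> (\<Sum>u\<in>V1. real (deg u))" using finV1 by (intro sum_mono2) (auto simp: Q_def)
  finally have "8 / l * real (card Q) \<le> 4 * nh" using degsum D by simp
  then have "2 * real (card Q) \<le> l * nh" using l by (simp add: field_simps)
  also have "\<dots> \<le> real (card V1)" using V1 pN by linarith
  finally have Q: "2 * real (card Q) \<le> real (card V1)" .
  have QV: "Q \<subseteq> V1" by (auto simp: Q_def)
  define W where "W = V1 - Q"
  have "card W = card V1 - card Q" "card Q \<le> card V1"
    unfolding W_def using QV finV1 by (auto intro: card_Diff_subset finite_subset card_mono)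
  then have "real (card W) \<ge> real (card V1) / 2" using Q by (simp add: of_nat_diff)
  moreover have "l * nh \<ge> 0" using l by (simp add: nh_def)
  ultimately have "real (card W) \<ge> p * N / 4" using V1 by simp
  moreover have "W \<subseteq> V" using S(1) by (auto simp: W_def V1_def)
  moreover have "\<not> X \<subseteq> W" if "X \<in> Bad" for X
  proof
    assume XW: "X \<subseteq> W"
    then have "X \<subseteq> S" by (auto simp: W_def V1_def)
    moreover have "(SOME x. x \<in> X) \<in> X" using Bad[OF that] by (simp add: some_in_eq)
    ultimately show False using XW that by (auto simp: W_def V1_def)
  qed
  moreover have "real (card {e\<in>{e\<in>H. e \<subseteq> W}. u \<in> e}) \<le> D" if "u \<in> W" for u
  proof -
    have "card {e\<in>{e\<in>H. e \<subseteq> W}. u \<in> e} \<le> deg u"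
      unfolding deg_def using finH by (intro card_mono) (auto simp: W_def)
    moreover have "real (deg u) \<le> D" using that by (auto simp: W_def Q_def)
    ultimately show ?thesis by linarith
  qed
  ultimately show ?thesis unfolding N_def D_def by blast
qed

section \<open>Counting short cycles\<close>

definition meet1 :: "'a set set \<Rightarrow> 'a set \<Rightarrow> 'a set set" where
  "meet1 H e = {f \<in> H. \<exists>x\<in>e. x \<in> f}"

text \<open>The edges that close a cycle between \<open>e\<close> and \<open>f\<close>. With
  \<open>f = e\<close> these are the edges with two vertices in \<open>e\<close>; a 4-set
  \<open>e\<close> is among them itself and is ruled out by the size 6 required in
  \<open>short_cycles\<close>.\<close>

definition meet2 :: "'a set set \<Rightarrow> 'a set \<Rightarrow> 'a set \<Rightarrow> 'a set set" where
  "meet2 H e f = {k \<in> H. \<exists>x\<in>e. \<exists>y\<in>f. x \<noteq> y \<and> {x, y} \<subseteq> k}"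

definition meet3 :: "'a set set \<Rightarrow> 'a set \<Rightarrow> 'a set set" where
  "meet3 H e = {f \<in> H. \<exists>x\<in>e. \<exists>y\<in>e. \<exists>z\<in>e. distinct [x, y, z] \<and> {x, y, z} \<subseteq> f}"

text \<open>
  The cardinalities are those of the unions of two 4-sets meeting in 2 or 3 points and of cycles
  of length 3 and 4 without further intersections, so that the four kinds (and the later forbidden sets
  of sizes 2 and 3) have pairwise different sizes.
\<close>

definition short_cycles :: "'a set set \<Rightarrow> 'a set set" where
  "short_cycles H = {X.
     (\<exists>e\<in>H. \<exists>f\<in>meet2 H e e. X = e \<union> f \<and> card X = 6) \<or>
     (\<exists>e\<in>H. \<exists>f\<in>meet3 H e. X = e \<union> f \<and> card X = 5) \<or>
     (\<exists>e\<in>H. \<exists>f\<in>meet1 H e. \<exists>h\<in>meet2 H e f. X = e \<union> f \<union> h \<and> card X = 9) \<or>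
     (\<exists>e\<in>H. \<exists>f\<in>meet1 H e. \<exists>h\<in>meet1 H f. \<exists>k\<in>meet2 H e h. X = e \<union> f \<union> h \<union> k \<and> card X = 12)}"

text \<open>The order matters. Linearity makes consecutive edges of a longer cycle meet in exactly
  one point, so a triangle has \<open>12 - 3 = 9\<close> points; the absence of triangles then makes
  opposite edges of a 4-cycle disjoint, so that it has \<open>16 - 4 = 12\<close>.\<close>

lemma uncrowded_if_no_short_cycles:
  assumes c4: "\<And>e. e \<in> H \<Longrightarrow> card e = 4" and no: "\<And>X. X \<in> short_cycles H \<Longrightarrow> \<not> X \<subseteq> W"
  shows "uncrowded {e\<in>H. e \<subseteq> W}"
proof -
  let ?E = "{e\<in>H. e \<subseteq> W}"
  have fin: "finite e" if "e \<in> ?E" for e using c4[of e] that by (auto intro: card_ge_0_finite)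
  have lin: "linear_hg ?E"
    unfolding linear_hg_def
  proof (intro ballI impI, rule ccontr)
    fix e f x y assume ef: "e \<in> ?E" "f \<in> ?E" "x \<in> e \<inter> f" "y \<in> e \<inter> f" "x \<noteq> y" "e \<noteq> f"
    have c: "card e = 4" "card f = 4" "finite e" "finite f" using ef c4 fin by auto
    have "card (e \<inter> f) < card e"
    proof (rule psubset_card_mono[OF c(3)])
      show "e \<inter> f \<subset> e" using ef(6) card_subset_eq[OF c(4), of e] c by auto
    qed
    moreover have "card {x, y} \<le> card (e \<inter> f)" using ef c by (intro card_mono) auto
    ultimately have "card (e \<inter> f) = 2 \<or> card (e \<inter> f) = 3" using c ef(5) by auto
    then have "e \<union> f \<in> short_cycles H"
    proof
      assume 2: "card (e \<inter> f) = 2"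
      have "card (e \<union> f) = 6" using card_Un_Int[OF c(3,4)] 2 c by simp
      moreover have "f \<in> meet2 H e e" using ef by (auto simp: meet2_def)
      ultimately show ?thesis using ef(1) by (auto simp: short_cycles_def)
    next
      assume 3: "card (e \<inter> f) = 3"
      have "card (e \<union> f) = 5" using card_Un_Int[OF c(3,4)] 3 c by simp
      moreover have "f \<in> meet3 H e"
      proof -
        obtain a b d where "e \<inter> f = {a, b, d}" "distinct [a, b, d]"
          using 3 by (auto simp: card_3_iff)
        then have "a \<in> e" "b \<in> e" "d \<in> e" "{a, b, d} \<subseteq> f" by auto
        then show ?thesis using ef(2) \<open>distinct [a, b, d]\<close> unfolding meet3_def by blast
      qed
      ultimately show ?thesis using ef(1) by (auto simp: short_cycles_def)
    qed
    then show False using no[of "e \<union> f"] ef by auto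
  qed
  have int: "e \<inter> f = {y}" if "e \<in> ?E" "f \<in> ?E" "e \<noteq> f" "y \<in> e" "y \<in> f" for e f y
    using linear_hgD[OF lin that(1,2) that(4,5)] that by blast
  have tri: "triangle_free ?E"
    unfolding triangle_free_def
  proof (intro ballI impI notI)
    fix e f h x y z
    assume efh: "e \<in> ?E" "f \<in> ?E" "h \<in> ?E" and xyz: "x \<in> h \<inter> e" "y \<in> e \<inter> f" "z \<in> f \<inter> h"
      and d: "distinct [x, y, z]" "distinct [e, f, h]"
    have i: "e \<inter> f = {y}" "f \<inter> h = {z}" "h \<inter> e = {x}" using int efh xyz d by auto
    have c: "card e = 4" "card f = 4" "card h = 4" "finite e" "finite f" "finite h" using efh c4 fin by auto
    have "card (e \<union> f) = 7" using card_Un_Int[OF c(4,5)] i c by simp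
    moreover have "(e \<union> f) \<inter> h = {x, z}" using i by blast
    then have "card ((e \<union> f) \<inter> h) = 2" using d by simp
    ultimately have "card (e \<union> f \<union> h) = 9" using card_Un_Int[of "e \<union> f" h] c by simp
    moreover have "f \<in> meet1 H e" "h \<in> meet2 H e f" using efh xyz d by (auto simp: meet1_def meet2_def)
    ultimately have "e \<union> f \<union> h \<in> short_cycles H" using efh unfolding short_cycles_def by blast
    then show False using no[of "e \<union> f \<union> h"] efh by auto
  qed
  have "quad_free ?E"
    unfolding quad_free_def
  proof (intro ballI impI notI)
    fix e f h k x y z w
    assume E: "e \<in> ?E" "f \<in> ?E" "h \<in> ?E" "k \<in> ?E"
      and m: "x \<in> k \<inter> e" "y \<in> e \<inter> f" "z \<in> f \<inter> h" "w \<in> h \<inter> k"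
      and d: "distinct [x, y, z, w]" "distinct [e, f, h, k]"
    have i: "e \<inter> f = {y}" "f \<inter> h = {z}" "h \<inter> k = {w}" "k \<inter> e = {x}" using int E m d by auto
    have opp: "e' \<inter> h' = {}" if E': "e' \<in> ?E" "f' \<in> ?E" "h' \<in> ?E" and i': "e' \<inter> f' = {y'}" "f' \<inter> h' = {z'}"
      and d': "y' \<noteq> z'" "distinct [e', f', h']" for e' f' h' y' z'
    proof (rule ccontr)
      assume "e' \<inter> h' \<noteq> {}"
      then obtain v where v: "v \<in> e'" "v \<in> h'" by blast
      have m': "y' \<in> e'" "y' \<in> f'" "z' \<in> f'" "z' \<in> h'" using i' by blast+
      have "v \<notin> f'"
      proof
        assume "v \<in> f'"
        then have "v \<in> {y'}" "v \<in> {z'}" using v unfolding i'[symmetric] by simp_all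
        then show False using d'(1) by simp
      qed
      then have "distinct [v, y', z']" using m' d'(1) by auto
      then show False by (rule triangle_freeD[OF tri E' v(2,1) m' _ d'(2)])
    qed
    have eh: "e \<inter> h = {}" by (rule opp[OF E(1,2,3) i(1,2)]) (use d in auto)
    have fk: "f \<inter> k = {}" by (rule opp[OF E(2,3,4) i(2,3)]) (use d in auto)
    have c: "card e = 4" "card f = 4" "card h = 4" "card k = 4" "finite e" "finite f" "finite h" "finite k"
      using E c4 fin by auto
    have "card (e \<union> f) = 7" using card_Un_Int[OF c(5,6)] i c by simp
    moreover have "(e \<union> f) \<inter> h = {z}" using i eh by blast
    ultimately have "card (e \<union> f \<union> h) = 10" using card_Un_Int[of "e \<union> f" h] c by simp
    moreover have "(e \<union> f \<union> h) \<inter> k = {x, w}" using i fk by blast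
    then have "card ((e \<union> f \<union> h) \<inter> k) = 2" using d by simp
    ultimately have "card (e \<union> f \<union> h \<union> k) = 12" using card_Un_Int[of "e \<union> f \<union> h" k] c by simp
    moreover have "f \<in> meet1 H e" "h \<in> meet1 H f"
      using E m unfolding meet1_def by blast+
    moreover have "k \<in> meet2 H e h"
    proof -
      have "x \<in> e" "w \<in> h" "x \<noteq> w" "{x, w} \<subseteq> k" "k \<in> H" using E m d(1) by simp_all
      then show ?thesis unfolding meet2_def by blast
    qed
    moreover have "e \<in> H" using E by simp
    ultimately have "e \<union> f \<union> h \<union> k \<in> short_cycles H"
      unfolding short_cycles_def
      by (intro CollectI disjI2, intro bexI[of _ e] bexI[of _ f] bexI[of _ h] bexI[of _ k] conjI refl)
    moreover have "e \<union> f \<union> h \<union> k \<subseteq> W" using E by simp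
    ultimately show False using no by blast
  qed
  with lin tri show ?thesis by (simp add: uncrowded_def)
qed

lemma card_UN_le_real:
  assumes "finite I" "\<And>i. i \<in> I \<Longrightarrow> real (card (A i)) \<le> k"
  shows "real (card (\<Union>i\<in>I. A i)) \<le> real (card I) * k"
proof -
  have "real (card (\<Union>i\<in>I. A i)) \<le> (\<Sum>i\<in>I. real (card (A i)))"
    using card_UN_le[OF assms(1), of A] by (simp flip: of_nat_sum)
  also have "\<dots> \<le> real (card I) * k" by (rule sum_bounded_above) (rule assms(2))
  finally show ?thesis .
qed

lemma card_subset_UN_le:
  assumes "finite I" "X \<subseteq> (\<Union>i\<in>I. A i)" "\<And>i. i \<in> I \<Longrightarrow> finite (A i) \<and> real (card (A i)) \<le> k"
  shows "real (card X) \<le> real (card I) * k"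
proof -
  have "card X \<le> card (\<Union>i\<in>I. A i)" using assms by (intro card_mono) auto
  then show ?thesis using card_UN_le_real[of I A k] assms by force
qed

text \<open>\<open>num\<close> bounds the expected number of forbidden sets divided by
  \<open>p * card V\<close>. A cycle starts with one of at most \<open>card V * d1\<close> edges, is
  continued by at most \<open>4 * d1\<close> edges each time, and is closed by at most
  \<open>16 * d2\<close> edges or, for three common points, \<open>64 * d3\<close>; a union of
  \<open>k\<close> points survives with probability \<open>p ^ k\<close>.\<close>

lemma sparse_uncrowded:
  fixes V :: "'a set" and H B2 B3 :: "'a set set" and p d1 d2 d3 b2 b3 :: real
  assumes p: "0 < p" "p \<le> 1" and V: "finite V" and H: "\<And>e. e \<in> H \<Longrightarrow> e \<subseteq> V \<and> card e = 4"
    and B2: "\<And>X. X \<in> B2 \<Longrightarrow> X \<subseteq> V \<and> card X = 2" and B3: "\<And>X. X \<in> B3 \<Longrightarrow> X \<subseteq> V \<and> card X = 3"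
    and b2: "real (card B2) \<le> real (card V) * b2" and b3: "real (card B3) \<le> real (card V) * b3"
    and d: "d1 > 0" "d2 \<ge> 0" "d3 \<ge> 0"
    and d1: "\<And>x. x \<in> V \<Longrightarrow> real (card {e\<in>H. x \<in> e}) \<le> d1"
    and d2: "\<And>x y. x \<in> V \<Longrightarrow> y \<in> V \<Longrightarrow> x \<noteq> y \<Longrightarrow> real (card {e\<in>H. {x, y} \<subseteq> e}) \<le> d2"
    and d3: "\<And>x y z. x \<in> V \<Longrightarrow> y \<in> V \<Longrightarrow> z \<in> V \<Longrightarrow> distinct [x, y, z] \<Longrightarrow> real (card {e\<in>H. {x, y, z} \<subseteq> e}) \<le> d3"
    and num: "b2 * p + b3 * p ^ 2 + 16 * d1 * d2 * p ^ 5 + 64 * d1 * d3 * p ^ 4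
       + 64 * d1 ^ 2 * d2 * p ^ 8 + 256 * d1 ^ 3 * d2 * p ^ 11 \<le> 1 / 4"
  shows "\<exists>W\<subseteq>V. real (card W) \<ge> p * real (card V) / 4 \<and> (\<forall>X\<in>B2 \<union> B3. \<not> X \<subseteq> W)
    \<and> uncrowded_hypergraph W {e\<in>H. e \<subseteq> W}
    \<and> (\<forall>u\<in>W. real (card {e\<in>{e\<in>H. e \<subseteq> W}. u \<in> e}) \<le> 32 * d1 * p ^ 3)"
proof -
  define N where "N = real (card V)"
  have finH: "finite H" using H V by (intro finite_subset[of H "Pow V"]) auto
  have fe: "finite e" and eV: "e \<subseteq> V" and c4: "card e = 4" if "e \<in> H" for e
    using H[OF that] V finite_subset by auto
  have "real (card H) \<le> real (card V) * d1"
  proof (rule card_subset_UN_le[OF V, where A = "\<lambda>x. {e\<in>H. x \<in> e}"])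
    show "H \<subseteq> (\<Union>x\<in>V. {e\<in>H. x \<in> e})"
    proof
      fix e assume e: "e \<in> H"
      then obtain x where "x \<in> e" using c4[OF e] by fastforce
      then show "e \<in> (\<Union>x\<in>V. {e\<in>H. x \<in> e})" using e eV by auto
    qed
  qed (use finH d1 in auto)
  then have cH: "real (card H) \<le> N * d1" by (simp add: N_def)
  have m1: "real (card (meet1 H e)) \<le> 4 * d1" if e: "e \<in> H" for e
  proof -
    have "real (card (meet1 H e)) \<le> real (card e) * d1"
      by (rule card_subset_UN_le[OF fe[OF e], where A = "\<lambda>x. {f\<in>H. x \<in> f}"])
        (use finH d1 eV[OF e] in \<open>auto simp: meet1_def\<close>)
    then show ?thesis using c4[OF e] by simp
  qed
  have m2: "real (card (meet2 H e f)) \<le> 16 * d2" if e: "e \<in> H" and f: "f \<in> H" for e f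
  proof -
    have "real (card (meet2 H e f)) \<le> real (card (e \<times> f)) * d2"
      by (rule card_subset_UN_le[where A = "\<lambda>(x, y). if x = y then {} else {k\<in>H. {x, y} \<subseteq> k}"])
        (use finH d2 d eV e f fe in \<open>auto simp: meet2_def subset_iff\<close>)
    then show ?thesis using c4[OF e] c4[OF f] by (simp add: card_cartesian_product)
  qed
  have m3: "real (card (meet3 H e)) \<le> 64 * d3" if e: "e \<in> H" for e
  proof -
    have "real (card (meet3 H e)) \<le> real (card (e \<times> e \<times> e)) * d3"
      by (rule card_subset_UN_le[where A = "\<lambda>(x, y, z). if distinct [x, y, z] then {k\<in>H. {x, y, z} \<subseteq> k} else {}"])
        (use finH d3 d eV e fe in \<open>auto simp: meet3_def subset_iff\<close>)
    then show ?thesis using c4[OF e] by (simp add: card_cartesian_product)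
  qed
  have finm: "finite (meet1 H e)" "finite (meet2 H e f)" "finite (meet3 H e)" for e f
    using finH by (auto simp: meet1_def meet2_def meet3_def)
  have mH: "meet1 H e \<subseteq> H" "meet2 H e f \<subseteq> H" "meet3 H e \<subseteq> H" for e f
    by (auto simp: meet1_def meet2_def meet3_def)
  define C6 where "C6 = (\<Union>e\<in>H. \<Union>f\<in>meet2 H e e. {e \<union> f})"
  define C5 where "C5 = (\<Union>e\<in>H. \<Union>f\<in>meet3 H e. {e \<union> f})"
  define C9 where "C9 = (\<Union>e\<in>H. \<Union>f\<in>meet1 H e. \<Union>h\<in>meet2 H e f. {e \<union> f \<union> h})"
  define C12 where "C12 = (\<Union>e\<in>H. \<Union>f\<in>meet1 H e. \<Union>h\<in>meet1 H f. \<Union>k\<in>meet2 H e h. {e \<union> f \<union> h \<union> k})"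
  note C_defs = C6_def C5_def C9_def C12_def
  have finC: "finite C6" "finite C5" "finite C9" "finite C12"
    unfolding C_defs using finH finm by auto
  have UN: "real (card (\<Union>i\<in>I. A i)) \<le> M * k"
    if "finite I" "real (card I) \<le> M" "0 \<le> k" "\<And>i. i \<in> I \<Longrightarrow> real (card (A i)) \<le> k"
    for I and A :: "'a set \<Rightarrow> 'a set set" and M k
    using card_UN_le_real[of I A k] mult_right_mono[OF that(2,3)] that by fastforce
  have "real (card C6) \<le> N * d1 * (16 * d2 * 1)"
    unfolding C6_def by (intro UN finH cH finm m2) (use d in auto)
  moreover have "real (card C5) \<le> N * d1 * (64 * d3 * 1)"
    unfolding C5_def by (intro UN finH cH finm m3) (use d in auto)
  moreover have "real (card C9) \<le> N * d1 * (4 * d1 * (16 * d2 * 1))"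
    unfolding C9_def by (intro UN finH cH finm m1 m2) (use d mH in auto)
  moreover have "real (card C12) \<le> N * d1 * (4 * d1 * (4 * d1 * (16 * d2 * 1)))"
    unfolding C12_def by (intro UN finH cH finm m1 m2) (use d mH in auto)
  ultimately have cC: "real (card C6) \<le> N * (16 * d1 * d2)" "real (card C5) \<le> N * (64 * d1 * d3)"
    "real (card C9) \<le> N * (64 * d1 ^ 2 * d2)" "real (card C12) \<le> N * (256 * d1 ^ 3 * d2)"
    by (simp_all add: power2_eq_square power3_eq_cube mult_ac)
  define Bad where "Bad = B2 \<union> B3 \<union> short_cycles H"
  have finB: "finite B2" "finite B3"
    using B2 B3 V by (auto intro!: finite_subset[of _ "Pow V"])
  have Bad: "X \<subseteq> V \<and> X \<noteq> {}" if "X \<in> Bad" for X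
  proof -
    have mV: "f \<in> meet1 H e \<Longrightarrow> f \<subseteq> V" "f \<in> meet2 H e h \<Longrightarrow> f \<subseteq> V" "f \<in> meet3 H e \<Longrightarrow> f \<subseteq> V" for e f h
      using mH eV by blast+
    have "X \<subseteq> V \<and> card X \<noteq> 0" if "X \<in> short_cycles H"
      using that unfolding short_cycles_def
      by (elim CollectE disjE bexE conjE) (simp_all add: mV eV)
    moreover have "X \<subseteq> V \<and> card X \<noteq> 0" if "X \<in> B2 \<union> B3"
      using that B2[of X] B3[of X] by auto
    ultimately have "X \<subseteq> V \<and> card X \<noteq> 0" using that by (auto simp: Bad_def)
    then show ?thesis by auto
  qed
  have "(\<Sum>X\<in>Bad. p ^ card X) \<le> real (card B2) * p ^ 2 + real (card B3) * p ^ 3 + real (card C6) * p ^ 6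
      + real (card C5) * p ^ 5 + real (card C9) * p ^ 9 + real (card C12) * p ^ 12"
  proof -
    have nn: "(\<Sum>X\<in>A \<inter> B. p ^ card X) \<ge> 0" for A B :: "'a set set" using p by (intro sum_nonneg) auto
    have un: "(\<Sum>X\<in>A \<union> B. p ^ card X) \<le> s + (\<Sum>X\<in>B. p ^ card X)"
      if "finite A" "finite B" "(\<Sum>X\<in>A. p ^ card X) \<le> s" for A B :: "'a set set" and s
      using sum.union_inter[OF that(1,2), of "\<lambda>X. p ^ card X"] nn[of A B] that(3) by linarith
    \<comment> \<open>Unions with fewer points than the index says would be too likely to survive;
      only those of full size occur in \<open>short_cycles\<close>.\<close>
    define R where "R C k = {X\<in>C. card X = k}" for C :: "'a set set" and k
    have Rs: "(\<Sum>X\<in>R C k. p ^ card X) \<le> real (card C) * p ^ k" if "finite C" for C k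
    proof -
      have "(\<Sum>X\<in>R C k. p ^ card X) = real (card (R C k)) * p ^ k" by (simp add: R_def)
      also have "\<dots> \<le> real (card C) * p ^ k"
        using p that by (intro mult_right_mono) (auto simp: R_def intro: card_mono)
      finally show ?thesis .
    qed
    have CI: "e \<in> H \<Longrightarrow> f \<in> meet2 H e e \<Longrightarrow> e \<union> f \<in> C6"
      "e \<in> H \<Longrightarrow> f \<in> meet3 H e \<Longrightarrow> e \<union> f \<in> C5"
      "e \<in> H \<Longrightarrow> f \<in> meet1 H e \<Longrightarrow> h \<in> meet2 H e f \<Longrightarrow> e \<union> f \<union> h \<in> C9"
      "e \<in> H \<Longrightarrow> f \<in> meet1 H e \<Longrightarrow> h \<in> meet1 H f \<Longrightarrow> k \<in> meet2 H e h \<Longrightarrow> e \<union> f \<union> h \<union> k \<in> C12"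
      for e f h k unfolding C_defs by blast+
    have "short_cycles H \<subseteq> R C6 6 \<union> R C5 5 \<union> R C9 9 \<union> R C12 12"
    proof
      fix X assume "X \<in> short_cycles H"
      then show "X \<in> R C6 6 \<union> R C5 5 \<union> R C9 9 \<union> R C12 12"
        unfolding short_cycles_def R_def
        by (elim CollectE disjE bexE conjE) (simp_all add: CI)
    qed
    moreover have "B2 \<subseteq> R B2 2" "B3 \<subseteq> R B3 3" using B2 B3 by (auto simp: R_def)
    ultimately have sub: "Bad \<subseteq> R B2 2 \<union> R B3 3 \<union> R C6 6 \<union> R C5 5 \<union> R C9 9 \<union> R C12 12"
      unfolding Bad_def by blast
    have finR: "finite (R C k)" if "finite C" for C k using that by (simp add: R_def)
    note fR = finR[OF finB(1)] finR[OF finB(2)] finR[OF finC(1)] finR[OF finC(2)] finR[OF finC(3)] finR[OF finC(4)]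
    have "(\<Sum>X\<in>Bad. p ^ card X) \<le> (\<Sum>X\<in>R B2 2 \<union> R B3 3 \<union> R C6 6 \<union> R C5 5 \<union> R C9 9 \<union> R C12 12. p ^ card X)"
      by (rule sum_mono2[OF _ sub]) (use fR p in auto)
    also have "\<dots> \<le> (\<Sum>X\<in>R B2 2. p ^ card X) + (\<Sum>X\<in>R B3 3. p ^ card X) + (\<Sum>X\<in>R C6 6. p ^ card X)
        + (\<Sum>X\<in>R C5 5. p ^ card X) + (\<Sum>X\<in>R C9 9. p ^ card X) + (\<Sum>X\<in>R C12 12. p ^ card X)"
      by (intro un order_refl finite_UnI fR)
    also have "\<dots> \<le> real (card B2) * p ^ 2 + real (card B3) * p ^ 3 + real (card C6) * p ^ 6
      + real (card C5) * p ^ 5 + real (card C9) * p ^ 9 + real (card C12) * p ^ 12"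
      by (intro add_mono Rs finB finC)
    finally show ?thesis .
  qed
  also have "\<dots> \<le> N * b2 * p ^ 2 + N * b3 * p ^ 3 + N * (16 * d1 * d2) * p ^ 6
      + N * (64 * d1 * d3) * p ^ 5 + N * (64 * d1 ^ 2 * d2) * p ^ 9 + N * (256 * d1 ^ 3 * d2) * p ^ 12"
    using p by (intro add_mono mult_right_mono cC) (use b2 b3 in \<open>auto simp: N_def\<close>)
  also have "\<dots> = p * N * (b2 * p + b3 * p ^ 2 + 16 * d1 * d2 * p ^ 5 + 64 * d1 * d3 * p ^ 4
       + 64 * d1 ^ 2 * d2 * p ^ 8 + 256 * d1 ^ 3 * d2 * p ^ 11)"
    by (simp add: algebra_simps eval_nat_numeral)
  also have "\<dots> \<le> p * N * (1 / 4)" using num p by (intro mult_left_mono) (auto simp: N_def)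
  finally have bad: "(\<Sum>X\<in>Bad. p ^ card X) \<le> p * real (card V) / 4" by (simp add: N_def)
  obtain W where W: "W \<subseteq> V" "real (card W) \<ge> p * real (card V) / 4" "\<forall>X\<in>Bad. \<not> X \<subseteq> W"
      "\<forall>u\<in>W. real (card {e\<in>{e\<in>H. e \<subseteq> W}. u \<in> e}) \<le> 32 * d1 * p ^ 3"
    using sparse_subset[OF p V H Bad bad d(1)] cH unfolding N_def by blast
  have "uncrowded {e\<in>H. e \<subseteq> W}"
    by (rule uncrowded_if_no_short_cycles) (use W(3) c4 in \<open>auto simp: Bad_def\<close>)
  then have "uncrowded_hypergraph W {e\<in>H. e \<subseteq> W}"
    using W(1) V c4 by (auto simp: uncrowded_hypergraph_def intro: finite_subset)
  then show ?thesis using W by (intro exI[of _ W]) (auto simp: Bad_def)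
qed

section \<open>Trapezoids in the grid\<close>

definition cross :: "int \<times> int \<Rightarrow> int \<times> int \<Rightarrow> int" where
  "cross u v = fst u * snd v - snd u * fst v"

definition sup_norm :: "int \<times> int \<Rightarrow> nat" where
  "sup_norm u = nat (max \<bar>fst u\<bar> \<bar>snd u\<bar>)"

definition scale :: "int \<Rightarrow> int \<times> int \<Rightarrow> int \<times> int" where
  "scale k w = (k * fst w, k * snd w)"

definition prim :: "int \<times> int \<Rightarrow> int \<times> int" where
  "prim u = (fst u div gcd (fst u) (snd u), snd u div gcd (fst u) (snd u))"

definition vecs :: "nat \<Rightarrow> (int \<times> int) set" where
  "vecs n = {u. u \<noteq> 0 \<and> sup_norm u \<le> n}"

definition multiples :: "nat \<Rightarrow> int \<times> int \<Rightarrow> (int \<times> int) set" where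
  "multiples n w = {v. \<exists>l. l \<noteq> 0 \<and> v = scale l w \<and> sup_norm v \<le> n}"

definition parallels :: "nat \<Rightarrow> int \<times> int \<Rightarrow> (int \<times> int) set" where
  "parallels n u = {v \<in> vecs n. cross u v = 0}"

definition parallel_pairs :: "nat \<Rightarrow> ((int \<times> int) \<times> (int \<times> int)) set" where
  "parallel_pairs n = {(u, v). u \<in> vecs n \<and> v \<in> vecs n \<and> cross u v = 0}"

lemma cross_commute: "cross v u = - cross u v"
  by (simp add: cross_def)

lemma cross_minus [simp]: "cross (- u) v = - cross u v" "cross u (- v) = - cross u v"
  by (simp_all add: cross_def)

lemma sup_norm_pos: "u \<noteq> 0 \<Longrightarrow> sup_norm u \<ge> 1"
  by (cases u) (auto simp: sup_norm_def zero_prod_def)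

lemma sup_norm_scale: "sup_norm (scale k w) = nat \<bar>k\<bar> * sup_norm w"
proof -
  have "max (\<bar>k\<bar> * \<bar>fst w\<bar>) (\<bar>k\<bar> * \<bar>snd w\<bar>) = \<bar>k\<bar> * max \<bar>fst w\<bar> \<bar>snd w\<bar>"
    by (simp add: max_mult_distrib_left)
  then show ?thesis by (simp add: sup_norm_def scale_def abs_mult nat_mult_distrib)
qed

lemma scale_prim: "scale (gcd (fst u) (snd u)) (prim u) = u"
  by (cases u) (simp add: scale_def prim_def)

lemma prim_nonzero: "u \<noteq> 0 \<Longrightarrow> prim u \<noteq> 0"
  using scale_prim[of u] by (auto simp: scale_def zero_prod_def)

lemma parallel_multiple:
  assumes "u \<noteq> 0" "cross u v = 0" shows "\<exists>l. v = scale l (prim u)"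
proof -
  define g where "g = gcd (fst u) (snd u)"
  obtain a b where ab: "prim u = (a, b)" by fastforce
  have g0: "g \<noteq> 0" using assms(1) by (cases u) (auto simp: g_def zero_prod_def)
  have u: "fst u = g * a" "snd u = g * b" using arg_cong[OF scale_prim[of u], of fst] arg_cong[OF scale_prim[of u], of snd] ab
    by (simp_all add: scale_def g_def)
  have cop: "coprime a b"
  proof -
    have "coprime (fst u div g) (snd u div g)"
      unfolding g_def by (rule div_gcd_coprime) (use assms(1) in \<open>auto simp: prod_eq_iff\<close>)
    then show ?thesis using ab by (simp add: prim_def g_def)
  qed
  have eq: "a * snd v = b * fst v"
  proof -
    have "g * (a * snd v - b * fst v) = 0" using assms(2) by (simp add: cross_def u algebra_simps)
    then show ?thesis using g0 by simp
  qed
  have "a dvd fst v"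
    using cop eq by (metis coprime_dvd_mult_right_iff dvd_triv_left)
  then obtain k where k: "fst v = a * k" by blast
  show ?thesis
  proof (cases "a = 0")
    case False
    then have "snd v = b * k" using eq k by (simp add: mult.left_commute)
    then show ?thesis using k ab by (intro exI[of _ k]) (simp add: scale_def prod_eq_iff)
  next
    \<comment> \<open>Divisibility by \<open>a = 0\<close> yields no multiplier; instead coprimality
      forces \<open>b\<close> to be 1 or -1, and the multiplier is \<open>snd v * b\<close>.\<close>
    case True
    then have "is_unit b" using cop by simp
    then have "b = 1 \<or> b = - 1" by simp presburger
    then have "b * b = 1" by auto
    then have "snd v = snd v * b * b" by (simp add: mult.assoc)
    then show ?thesis using k ab True by (intro exI[of _ "snd v * b"]) (simp add: scale_def prod_eq_iff)
  qed
qed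

lemma prim_multiples:
  assumes "u \<in> vecs n" "v \<in> vecs n" "cross u v = 0"
  shows "v \<in> multiples n (prim u)"
proof -
  obtain l where l: "v = scale l (prim u)" using parallel_multiple[of u v] assms by (auto simp: vecs_def)
  then have "l \<noteq> 0" using assms(2) by (auto simp: vecs_def scale_def zero_prod_def)
  then show ?thesis using l assms(2) by (auto simp: multiples_def vecs_def)
qed

lemma cross_self [simp]: "cross u u = 0"
  by (simp add: cross_def mult.commute)

lemma prim_vecs: "u \<in> vecs n \<Longrightarrow> prim u \<in> vecs n"
proof -
  assume u: "u \<in> vecs n"
  define g where "g = gcd (fst u) (snd u)"
  have "g \<noteq> 0" using u by (cases u) (auto simp: g_def vecs_def zero_prod_def)
  then have "nat \<bar>g\<bar> \<ge> 1" by simp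
  then have "sup_norm (prim u) \<le> nat \<bar>g\<bar> * sup_norm (prim u)" by simp
  also have "\<dots> = sup_norm u" using sup_norm_scale[of g "prim u"] scale_prim[of u] by (simp add: g_def)
  finally show ?thesis using u prim_nonzero by (auto simp: vecs_def)
qed

lemma finite_vecs: "finite (vecs n)" and card_vecs: "real (card (vecs n)) \<le> 9 * real n ^ 2"
proof -
  have sub: "vecs n \<subseteq> {- int n..int n} \<times> {- int n..int n} - {0}"
    by (auto simp: vecs_def sup_norm_def zero_prod_def)
  show fin: "finite (vecs n)" by (rule finite_subset[OF sub]) simp
  show "real (card (vecs n)) \<le> 9 * real n ^ 2"
  proof (cases "n = 0")
    case True
    then have "vecs n = {}" using sup_norm_pos by (fastforce simp: vecs_def)
    then show ?thesis by simp
  next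
    case False
    have "card (vecs n) \<le> card ({- int n..int n} \<times> {- int n..int n})"
      by (rule card_mono) (use sub in auto)
    also have "\<dots> = (2 * n + 1) * (2 * n + 1)" by (simp add: card_cartesian_product nat_add_distrib nat_mult_distrib)
    finally have "real (card (vecs n)) \<le> (2 * real n + 1) * (2 * real n + 1)"
      by (metis (mono_tags, opaque_lifting) of_nat_1 of_nat_add of_nat_le_iff of_nat_mult of_nat_numeral)
    also have "\<dots> \<le> (3 * real n) * (3 * real n)" using False by (intro mult_mono) auto
    finally show ?thesis by (simp add: power2_eq_square)
  qed
qed

lemma card_multiples:
  assumes "w \<noteq> 0" shows "finite (multiples n w)" "real (card (multiples n w)) \<le> 2 * real n / real (sup_norm w)"
proof -
  define q where "q = n div sup_norm w"
  have s: "sup_norm w > 0" using sup_norm_pos[OF assms] by simp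
  have sub: "multiples n w \<subseteq> (\<lambda>l. scale l w) ` ({- int q..int q} - {0})"
  proof
    fix v assume "v \<in> multiples n w"
    then obtain l where l: "l \<noteq> 0" "v = scale l w" "nat \<bar>l\<bar> * sup_norm w \<le> n"
      unfolding multiples_def mem_Collect_eq by (metis sup_norm_scale)
    then have "nat \<bar>l\<bar> \<le> q" using s by (simp add: q_def less_eq_div_iff_mult_less_eq)
    then have "l \<in> {- int q..int q} - {0}" using l(1) by auto
    then show "v \<in> (\<lambda>l. scale l w) ` ({- int q..int q} - {0})" using l(2) by blast
  qed
  show "finite (multiples n w)" by (rule finite_subset[OF sub]) simp
  have "card (multiples n w) \<le> card ((\<lambda>l. scale l w) ` ({- int q..int q} - {0}))"
    by (rule card_mono[OF _ sub]) simp
  also have "\<dots> \<le> card ({- int q..int q} - {0})" by (rule card_image_le) simp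
  also have "\<dots> = 2 * q" by (simp add: nat_add_distrib nat_mult_distrib)
  finally have "real (card (multiples n w)) \<le> 2 * real q" by linarith
  also have "real q \<le> real n / real (sup_norm w)" unfolding q_def by (rule of_nat_div_le_of_nat)
  finally show "real (card (multiples n w)) \<le> 2 * real n / real (sup_norm w)" by simp
qed

lemma card_sphere:
  assumes "m \<ge> 1" shows "finite {w. sup_norm w = m}" "real (card {w. sup_norm w = m}) \<le> 12 * real m"
proof -
  let ?I = "{- int m..int m}" and ?P = "{int m, - int m}"
  have sub: "{w. sup_norm w = m} \<subseteq> ?P \<times> ?I \<union> ?I \<times> ?P"
    using assms by (auto simp: sup_norm_def max_def split: if_splits)
  show "finite {w. sup_norm w = m}" by (rule finite_subset[OF sub]) simp
  have "card {w. sup_norm w = m} \<le> card (?P \<times> ?I \<union> ?I \<times> ?P)" by (rule card_mono[OF _ sub]) simp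
  also have "\<dots> \<le> card (?P \<times> ?I) + card (?I \<times> ?P)" by (rule card_Un_le)
  also have "card ?P = 2" using assms by (simp add: card_insert_if)
  then have "card (?P \<times> ?I) + card (?I \<times> ?P) = 4 * (2 * m + 1)"
    by (simp add: card_cartesian_product nat_add_distrib nat_mult_distrib)
  finally have "real (card {w. sup_norm w = m}) \<le> real (4 * (2 * m + 1))" by linarith
  also have "\<dots> \<le> 12 * real m" using assms by simp
  finally show "real (card {w. sup_norm w = m}) \<le> 12 * real m" .
qed

text \<open>Vectors are grouped by their norm, at most \<open>12 * m\<close> of them having norm
  \<open>m\<close>; sums over directions become sums over one integer.\<close>

lemma sum_vecs_le:
  assumes "\<And>m. f m \<ge> (0::real)"
  shows "(\<Sum>w\<in>vecs n. f (sup_norm w)) \<le> (\<Sum>m=1..n. 12 * real m * f m)"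
proof -
  have "vecs n = (\<Union>m\<in>{1..n}. {w. sup_norm w = m})"
  proof (intro equalityI subsetI)
    fix w assume "w \<in> vecs n"
    then show "w \<in> (\<Union>m\<in>{1..n}. {w. sup_norm w = m})" using sup_norm_pos[of w] by (simp add: vecs_def)
  next
    fix w assume "w \<in> (\<Union>m\<in>{1..n}. {w. sup_norm w = m})"
    moreover have "sup_norm 0 = 0" by (simp add: sup_norm_def)
    ultimately show "w \<in> vecs n" by (auto simp: vecs_def)
  qed
  then have "(\<Sum>w\<in>vecs n. f (sup_norm w)) = (\<Sum>m\<in>{1..n}. \<Sum>w\<in>{w. sup_norm w = m}. f (sup_norm w))"
    by (simp, subst sum.UNION_disjoint) (use card_sphere(1) in auto)
  also have "\<dots> \<le> (\<Sum>m=1..n. 12 * real m * f m)"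
  proof (rule sum_mono)
    fix m assume "m \<in> {1..n}"
    then have "real (card {w. sup_norm w = m}) * f m \<le> 12 * real m * f m"
      using card_sphere(2)[of m] assms by (intro mult_right_mono) auto
    then show "(\<Sum>w\<in>{w. sup_norm w = m}. f (sup_norm w)) \<le> 12 * real m * f m" by simp
  qed
  finally show ?thesis .
qed

lemma card_UN_le_sum:
  assumes "finite I" "X \<subseteq> (\<Union>i\<in>I. A i)" "\<And>i. i \<in> I \<Longrightarrow> finite (A i) \<and> real (card (A i)) \<le> k i"
  shows "real (card X) \<le> sum k I"
proof -
  have "card X \<le> card (\<Union>i\<in>I. A i)" using assms by (intro card_mono) auto
  also have "\<dots> \<le> (\<Sum>i\<in>I. card (A i))" by (rule card_UN_le[OF assms(1)])
  finally have "real (card X) \<le> (\<Sum>i\<in>I. real (card (A i)))" by (simp flip: of_nat_sum)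
  also have "\<dots> \<le> sum k I" by (rule sum_mono) (use assms(3) in auto)
  finally show ?thesis .
qed

lemma vecs_nonzero: "w \<in> vecs n \<Longrightarrow> w \<noteq> 0"
  by (simp add: vecs_def)

lemma card_parallels:
  assumes "u \<in> vecs n"
  shows "finite (parallels n u)" "real (card (parallels n u)) \<le> 2 * real n / real (sup_norm (prim u))"
proof -
  have w: "prim u \<noteq> 0" using prim_nonzero vecs_nonzero[OF assms] .
  have sub: "parallels n u \<subseteq> multiples n (prim u)"
    using prim_multiples[OF assms] by (auto simp: parallels_def)
  show "finite (parallels n u)" by (rule finite_subset[OF sub card_multiples(1)[OF w]])
  show "real (card (parallels n u)) \<le> 2 * real n / real (sup_norm (prim u))"
    using card_mono[OF card_multiples(1)[OF w] sub] card_multiples(2)[OF w, of n] by linarith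
qed

lemma finite_parallel_pairs: "finite (parallel_pairs n)"
  by (rule finite_subset[of _ "vecs n \<times> vecs n"]) (auto simp: parallel_pairs_def finite_vecs)

text \<open>
  A pair of parallel vectors consists of two multiples of a primitive vector \<open>w\<close>; summing over all
  nonzero \<open>w\<close> instead only costs a constant factor.
\<close>

lemma card_parallel_pairs: "real (card (parallel_pairs n)) \<le> 48 * real n ^ 2 * harm n"
proof -
  have "real (card (parallel_pairs n)) \<le> (\<Sum>w\<in>vecs n. (2 * real n / real (sup_norm w))\<^sup>2)"
  proof (rule card_UN_le_sum[OF finite_vecs, where A = "\<lambda>w. multiples n w \<times> multiples n w"])
    show "parallel_pairs n \<subseteq> (\<Union>w\<in>vecs n. multiples n w \<times> multiples n w)"
    proof
      fix x assume "x \<in> parallel_pairs n"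
      then obtain u v where x: "x = (u, v)" "u \<in> vecs n" "v \<in> vecs n" "cross u v = 0"
        by (auto simp: parallel_pairs_def)
      then have "prim u \<in> vecs n" "u \<in> multiples n (prim u)" "v \<in> multiples n (prim u)"
        by (auto intro: prim_vecs prim_multiples)
      then show "x \<in> (\<Union>w\<in>vecs n. multiples n w \<times> multiples n w)" using x(1) by blast
    qed
    fix w assume "w \<in> vecs n"
    then have w: "w \<noteq> 0" by (rule vecs_nonzero)
    have "real (card (multiples n w)) * real (card (multiples n w))
        \<le> (2 * real n / real (sup_norm w)) * (2 * real n / real (sup_norm w))"
      using card_multiples(2)[OF w, of n] by (intro mult_mono) auto
    then show "finite (multiples n w \<times> multiples n w)
        \<and> real (card (multiples n w \<times> multiples n w)) \<le> (2 * real n / real (sup_norm w))\<^sup>2"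
      using card_multiples(1)[OF w, of n] by (simp add: card_cartesian_product power2_eq_square)
  qed
  also have "\<dots> \<le> (\<Sum>m=1..n. 12 * real m * (2 * real n / real m)\<^sup>2)"
    by (rule sum_vecs_le) simp
  also have "\<dots> = (\<Sum>m=1..n. 48 * real n ^ 2 * inverse (real m))"
    by (rule sum.cong) (auto simp: field_simps power2_eq_square)
  \<comment> \<open>This harmonic sum is the origin of the logarithm in the degrees.\<close>
  also have "\<dots> = 48 * real n ^ 2 * harm n" by (simp add: harm_def sum_distrib_left)
  finally show ?thesis .
qed

definition short_vectors :: "nat \<Rightarrow> nat \<Rightarrow> (int \<times> int) set" where
  "short_vectors n M = {u \<in> vecs n. sup_norm (prim u) \<le> M}"

text \<open>There are at most \<open>12 * m\<close> vectors of norm \<open>m\<close>, with at most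
  \<open>2 * n / m\<close> multiples each, so every norm up to \<open>M\<close> contributes the same
  \<open>24 * n\<close>.\<close>

lemma card_short_vectors: "real (card (short_vectors n M)) \<le> 24 * real n * real M"
proof -
  have "real (card (short_vectors n M)) \<le> (\<Sum>w\<in>vecs M. 2 * real n / real (sup_norm w))"
  proof (rule card_UN_le_sum[OF finite_vecs, where A = "multiples n"])
    show "short_vectors n M \<subseteq> (\<Union>w\<in>vecs M. multiples n w)"
    proof
      fix u assume u: "u \<in> short_vectors n M"
      then have ub: "u \<in> vecs n" "sup_norm (prim u) \<le> M" by (auto simp: short_vectors_def)
      have "prim u \<in> vecs M" using ub(2) prim_nonzero[OF vecs_nonzero[OF ub(1)]] by (simp add: vecs_def)
      moreover have "u \<in> multiples n (prim u)" by (rule prim_multiples[OF ub(1) ub(1) cross_self])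
      ultimately show "u \<in> (\<Union>w\<in>vecs M. multiples n w)" by blast
    qed
    fix w assume "w \<in> vecs M"
    then have w: "w \<noteq> 0" by (rule vecs_nonzero)
    show "finite (multiples n w) \<and> real (card (multiples n w)) \<le> 2 * real n / real (sup_norm w)"
      using card_multiples[OF w] by blast
  qed
  also have "\<dots> \<le> (\<Sum>m=1..M. 12 * real m * (2 * real n / real m))" by (rule sum_vecs_le) simp
  also have "\<dots> = (\<Sum>m=1..M. 24 * real n)" by (rule sum.cong) auto
  also have "\<dots> = 24 * real n * real M" by simp
  finally show ?thesis .
qed

section \<open>Short pairs, collinear triples and trapezoids\<close>

definition igrid :: "nat \<Rightarrow> (int \<times> int) set" where
  "igrid n = {1..int n} \<times> {1..int n}"

text \<open>
  The norm of the primitive vector along a pair governs both how many pairs are parallel to it and how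
  many pairs of this kind there are: pairs with small norm are so few in a sparse random subset that
  they can be deleted, and the remaining ones lie in few trapezoids.
\<close>

definition long :: "nat \<Rightarrow> (int \<times> int) set \<Rightarrow> bool" where
  "long M e \<longleftrightarrow> (\<forall>x\<in>e. \<forall>y\<in>e. x \<noteq> y \<longrightarrow> sup_norm (prim (y - x)) > M)"

text \<open>Collinear quadruples and parallelograms are included. The condition \<open>long\<close>
  is part of the edge, so that a pair with small norm lies in no edge at all and the codegree bound
  holds for every pair.\<close>

definition trapezoids :: "nat \<Rightarrow> nat \<Rightarrow> (int \<times> int) set set" where
  "trapezoids n M = {e. e \<subseteq> igrid n \<and> card e = 4 \<and> long M e \<and>
     (\<exists>a b c d. e = {a, b, c, d} \<and> cross (b - a) (d - c) = 0)}"

definition short_pairs :: "nat \<Rightarrow> nat \<Rightarrow> (int \<times> int) set set" where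
  "short_pairs n M = {e. \<exists>x\<in>igrid n. \<exists>y\<in>igrid n. e = {x, y} \<and> x \<noteq> y \<and> sup_norm (prim (y - x)) \<le> M}"

definition collinear_triples :: "nat \<Rightarrow> nat \<Rightarrow> (int \<times> int) set set" where
  "collinear_triples n M = {e. e \<subseteq> igrid n \<and> card e = 3 \<and> long M e \<and>
     (\<exists>x y z. e = {x, y, z} \<and> cross (y - x) (z - x) = 0)}"

lemma finite_igrid [simp]: "finite (igrid n)" and card_igrid: "real (card (igrid n)) = real n ^ 2"
  by (simp_all add: igrid_def card_cartesian_product power2_eq_square)

lemma diff_vecs: "x \<in> igrid n \<Longrightarrow> y \<in> igrid n \<Longrightarrow> x \<noteq> y \<Longrightarrow> y - x \<in> vecs n"
  by (cases x; cases y) (auto simp: igrid_def vecs_def sup_norm_def zero_prod_def)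

lemma cross_swap: "cross u (x - y) = 0 \<longleftrightarrow> cross u (y - x) = 0" "cross (x - y) u = 0 \<longleftrightarrow> cross (y - x) u = 0"
  using cross_minus[of u "x - y"] cross_minus[of "x - y" u] by simp_all

lemma cross_sym: "cross u v = 0 \<longleftrightarrow> cross v u = 0"
  by (simp add: cross_commute[of v u])

lemma distinct_card4: "card {a, b, c, d} = 4 \<longleftrightarrow> distinct [a, b, c, d]"
  by (auto simp: card_insert_if)

text \<open>Parallelism is unaffected by exchanging the two pairs or the points of one pair, and
  these exchanges bring any vertex to the first place.\<close>

lemma trapezoid_at:
  assumes "e \<in> trapezoids n M" "x \<in> e"
  obtains y c d where "e = {x, y, c, d}" "distinct [x, y, c, d]" "cross (y - x) (d - c) = 0"
    "{x, y, c, d} \<subseteq> igrid n"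
proof -
  obtain a b c d where e: "e = {a, b, c, d}" and cr: "cross (b - a) (d - c) = 0"
    and c4: "card {a, b, c, d} = 4" and g: "e \<subseteq> igrid n"
    using assms(1) by (auto simp: trapezoids_def)
  have d: "distinct [a, b, c, d]" by (rule distinct_card4[THEN iffD1, OF c4])
  from assms(2) e consider "x = a" | "x = b" | "x = c" | "x = d" by auto
  then show thesis
  proof cases
    case 1
    show thesis by (rule that[of b c d]) (use e cr d g 1 in simp_all)
  next
    case 2
    have "e = {b, a, c, d}" unfolding e by (rule insert_commute)
    moreover have "distinct [b, a, c, d]" using d by auto
    moreover have "cross (a - b) (d - c) = 0" using cr cross_swap(2)[of a b] by simp
    moreover have "{b, a, c, d} \<subseteq> igrid n" using g e by auto
    ultimately show thesis unfolding 2[symmetric] by (rule that)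
  next
    case 3
    have "e = {c, d, a, b}" unfolding e by blast
    moreover have "distinct [c, d, a, b]" using d by auto
    moreover have "cross (d - c) (b - a) = 0" using cr cross_sym by blast
    moreover have "{c, d, a, b} \<subseteq> igrid n" using g e by auto
    ultimately show thesis unfolding 3[symmetric] by (rule that)
  next
    case 4
    have "e = {d, c, a, b}" unfolding e by blast
    moreover have "distinct [d, c, a, b]" using d by auto
    moreover have "cross (c - d) (b - a) = 0" using cr cross_sym cross_swap(2)[of c d] by blast
    moreover have "{d, c, a, b} \<subseteq> igrid n" using g e by auto
    ultimately show thesis unfolding 4[symmetric] by (rule that)
  qed
qed

text \<open>Given \<open>x\<close>, an edge is determined by the starting point of its other pair
  and by the two parallel differences.\<close>

lemma trapezoid_degree:
  "real (card {e \<in> trapezoids n M. x \<in> e}) \<le> 48 * real n ^ 4 * harm n"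
proof -
  let ?A = "igrid n \<times> parallel_pairs n"
  have sub: "{e \<in> trapezoids n M. x \<in> e} \<subseteq> (\<lambda>(c, u, v). {x, x + u, c, c + v}) ` ?A"
  proof
    fix e assume "e \<in> {e \<in> trapezoids n M. x \<in> e}"
    then obtain y c d where e: "e = {x, y, c, d}" "distinct [x, y, c, d]" "cross (y - x) (d - c) = 0"
      "{x, y, c, d} \<subseteq> igrid n" by (auto elim: trapezoid_at)
    then have "(c, y - x, d - c) \<in> ?A" using diff_vecs by (auto simp: parallel_pairs_def)
    moreover have "e = (\<lambda>(c, u, v). {x, x + u, c, c + v}) (c, y - x, d - c)" using e(1) by simp
    ultimately show "e \<in> (\<lambda>(c, u, v). {x, x + u, c, c + v}) ` ?A" by blast
  qed
  have fin: "finite ?A" using finite_parallel_pairs by simp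
  have "card {e \<in> trapezoids n M. x \<in> e} \<le> card ?A" by (rule surj_card_le[OF fin sub])
  then have "real (card {e \<in> trapezoids n M. x \<in> e}) \<le> real (card (igrid n)) * real (card (parallel_pairs n))"
    by (simp add: card_cartesian_product flip: of_nat_mult)
  also have "\<dots> \<le> real n ^ 2 * (48 * real n ^ 2 * harm n)"
    unfolding card_igrid by (rule mult_left_mono[OF card_parallel_pairs]) simp
  finally show ?thesis by (simp add: power2_eq_square power4_eq_xxxx mult_ac)
qed

text \<open>If \<open>x\<close> and \<open>y\<close> form one of the parallel pairs, the other pair
  has a free starting point and at most \<open>2 * n / M\<close> differences. If they lie in
  different pairs, the edge is determined by two parallel vectors attached to them.\<close>

lemma trapezoid_codegree2:
  assumes x: "x \<in> igrid n" and y: "y \<in> igrid n" and xy: "x \<noteq> y" and M: "M \<ge> 1"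
  shows "real (card {e \<in> trapezoids n M. {x, y} \<subseteq> e}) \<le> 2 * real n ^ 3 / real M + 48 * real n ^ 2 * harm n"
proof (cases "sup_norm (prim (y - x)) > M")
  case False
  have "\<not> long M e" if "{x, y} \<subseteq> e" for e
  proof
    assume "long M e"
    moreover have "x \<in> e" "y \<in> e" using that by auto
    ultimately show False using False xy unfolding long_def by blast
  qed
  then have "{e \<in> trapezoids n M. {x, y} \<subseteq> e} = {}" unfolding trapezoids_def by blast
  moreover have "0 \<le> 2 * real n ^ 3 / real M + 48 * real n ^ 2 * harm n" by (simp add: harm_nonneg)
  ultimately show ?thesis by (simp only: card.empty of_nat_0)
next
  case True
  have b: "y - x \<in> vecs n" using diff_vecs x y xy by auto
  let ?A = "igrid n \<times> parallels n (y - x)" and ?B = "parallel_pairs n"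
  let ?f = "\<lambda>(c, v). {x, y, c, c + v}" and ?h = "\<lambda>(u, v). {x, x + u, y, y + v}"
  have fin: "finite ?A" "finite ?B" using card_parallels[OF b] finite_parallel_pairs by auto
  have sub: "{e \<in> trapezoids n M. {x, y} \<subseteq> e} \<subseteq> ?f ` ?A \<union> ?h ` ?B"
  proof
    fix e assume "e \<in> {e \<in> trapezoids n M. {x, y} \<subseteq> e}"
    then have e': "e \<in> trapezoids n M" "x \<in> e" "y \<in> e" by auto
    obtain p c d where e: "e = {x, p, c, d}" "distinct [x, p, c, d]" "cross (p - x) (d - c) = 0"
      "{x, p, c, d} \<subseteq> igrid n" using trapezoid_at[OF e'(1,2)] by blast
    have in_vecs: "p - x \<in> vecs n" "d - c \<in> vecs n" "c - d \<in> vecs n"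
      using e(2,4) diff_vecs[of x n p] diff_vecs[of c n d] diff_vecs[of d n c] by auto
    have cr: "cross (p - x) (c - d) = 0" using e(3) cross_swap(1) by blast
    from e'(3) e(1) xy consider "y = p" | "y = c" | "y = d" by auto
    then show "e \<in> ?f ` ?A \<union> ?h ` ?B"
    proof cases
      case 1
      then have "(c, d - c) \<in> ?A" using e(3,4) in_vecs by (simp add: parallels_def)
      moreover have "e = ?f (c, d - c)" using e(1) 1 by simp
      ultimately show ?thesis by blast
    next
      case 2
      then have "(p - x, d - y) \<in> ?B" using e(3) in_vecs by (simp add: parallel_pairs_def)
      moreover have "e = ?h (p - x, d - y)" using e(1) 2 by simp
      ultimately show ?thesis by blast
    next
      case 3
      then have "(p - x, c - y) \<in> ?B" using cr in_vecs by (simp add: parallel_pairs_def)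
      moreover have "e = ?h (p - x, c - y)" using e(1) 3 by auto
      ultimately show ?thesis by blast
    qed
  qed
  have "card {e \<in> trapezoids n M. {x, y} \<subseteq> e} \<le> card (?f ` ?A \<union> ?h ` ?B)"
    using fin by (intro card_mono[OF _ sub]) auto
  also have "\<dots> \<le> card (?f ` ?A) + card (?h ` ?B)" by (rule card_Un_le)
  also have "\<dots> \<le> card ?A + card ?B" by (intro add_mono card_image_le fin)
  finally have "real (card {e \<in> trapezoids n M. {x, y} \<subseteq> e})
      \<le> real (card (igrid n)) * real (card (parallels n (y - x))) + real (card ?B)"
    by (simp add: card_cartesian_product flip: of_nat_mult of_nat_add)
  also have "\<dots> \<le> real n ^ 2 * (2 * real n / real M) + 48 * real n ^ 2 * harm n"
  proof (intro add_mono card_parallel_pairs)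
    have "real (card (parallels n (y - x))) \<le> 2 * real n / real (sup_norm (prim (y - x)))"
      by (rule card_parallels(2)[OF b])
    also have "\<dots> \<le> 2 * real n / real M" using True M by (intro divide_left_mono) auto
    finally show "real (card (igrid n)) * real (card (parallels n (y - x))) \<le> real n ^ 2 * (2 * real n / real M)"
      unfolding card_igrid by (intro mult_left_mono) auto
  qed
  finally show ?thesis by (simp add: power2_eq_square power3_eq_cube mult_ac)
qed

text \<open>There are three choices for the point that is paired with the unknown fourth; the
  difference of the other two fixes the direction, which contains at most \<open>2 * n\<close>
  vectors.\<close>

lemma trapezoid_codegree3:
  assumes x: "x \<in> igrid n" "y \<in> igrid n" "z \<in> igrid n" and d: "distinct [x, y, z]"
  shows "real (card {e \<in> trapezoids n M. {x, y, z} \<subseteq> e}) \<le> 6 * real n"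
proof -
  have b: "y - x \<in> vecs n" "z - x \<in> vecs n" "z - y \<in> vecs n" using diff_vecs x d by auto
  let ?A = "parallels n (y - x)" and ?B = "parallels n (z - x)" and ?C = "parallels n (z - y)"
  let ?f = "\<lambda>p v. {x, y, z, p + v}"
  have par: "finite (parallels n u) \<and> real (card (parallels n u)) \<le> 2 * real n" if "u \<in> vecs n" for u
  proof -
    have s: "sup_norm (prim u) \<ge> 1" using sup_norm_pos[OF prim_nonzero[OF vecs_nonzero[OF that]]] .
    have "2 * real n / real (sup_norm (prim u)) \<le> 2 * real n / 1" using s by (intro divide_left_mono) auto
    then show ?thesis using card_parallels[OF that] by simp
  qed
  have fin: "finite ?A" "finite ?B" "finite ?C" using par b by auto
  have sub: "{e \<in> trapezoids n M. {x, y, z} \<subseteq> e} \<subseteq> ?f z ` ?A \<union> ?f y ` ?B \<union> ?f x ` ?C"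
  proof
    fix e assume "e \<in> {e \<in> trapezoids n M. {x, y, z} \<subseteq> e}"
    then have e': "e \<in> trapezoids n M" "x \<in> e" "y \<in> e" "z \<in> e" by auto
    obtain p c w where e: "e = {x, p, c, w}" "distinct [x, p, c, w]" "cross (p - x) (w - c) = 0"
      "{x, p, c, w} \<subseteq> igrid n" using trapezoid_at[OF e'(1,2)] by blast
    have in_vecs: "p - x \<in> vecs n" "w - c \<in> vecs n" "c - w \<in> vecs n"
      using e(2,4) diff_vecs[of x n p] diff_vecs[of c n w] diff_vecs[of w n c] by auto
    from e(3) have cr: "cross (p - x) (c - w) = 0" "cross (w - c) (p - x) = 0" "cross (c - w) (p - x) = 0"
      using cross_swap cross_sym by blast+
    from e'(3,4) e(1) d consider "y = p" "z = c" | "y = p" "z = w" | "y = c" "z = p" | "y = c" "z = w"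
      | "y = w" "z = p" | "y = w" "z = c" by auto
    then show "e \<in> ?f z ` ?A \<union> ?f y ` ?B \<union> ?f x ` ?C"
    proof cases
      case 1
      have "e = ?f z (w - c)" "w - c \<in> ?A" using e(1,3) in_vecs 1 by (auto simp: parallels_def)
      then show ?thesis by blast
    next
      case 2
      have "e = ?f z (c - w)" "c - w \<in> ?A" using e(1) cr in_vecs 2 by (auto simp: parallels_def)
      then show ?thesis by blast
    next
      case 3
      have "e = ?f y (w - c)" "w - c \<in> ?B" using e(1,3) in_vecs 3 by (auto simp: parallels_def)
      then show ?thesis by blast
    next
      case 4
      have "e = ?f x (p - x)" "p - x \<in> ?C" using e(1) cr in_vecs 4 by (auto simp: parallels_def)
      then show ?thesis by blast
    next
      case 5
      have "e = ?f y (c - w)" "c - w \<in> ?B" using e(1) cr in_vecs 5 by (auto simp: parallels_def)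
      then show ?thesis by blast
    next
      case 6
      have "e = ?f x (p - x)" "p - x \<in> ?C" using e(1) cr in_vecs 6 by (auto simp: parallels_def)
      then show ?thesis by blast
    qed
  qed
  have "card {e \<in> trapezoids n M. {x, y, z} \<subseteq> e} \<le> card (?f z ` ?A \<union> ?f y ` ?B \<union> ?f x ` ?C)"
    using fin by (intro card_mono[OF _ sub]) auto
  also have "\<dots> \<le> card (?f z ` ?A) + card (?f y ` ?B) + card (?f x ` ?C)"
    by (rule order_trans[OF card_Un_le add_right_mono[OF card_Un_le]])
  also have "\<dots> \<le> card ?A + card ?B + card ?C" by (intro add_mono card_image_le fin)
  finally show ?thesis using par[OF b(1)] par[OF b(2)] par[OF b(3)] by linarith
qed

lemma card_short_pairs: "real (card (short_pairs n M)) \<le> real n ^ 2 * (24 * real n * real M)"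
proof -
  let ?A = "igrid n \<times> short_vectors n M"
  have fin: "finite ?A" using finite_vecs by (simp add: short_vectors_def)
  have sub: "short_pairs n M \<subseteq> (\<lambda>(x, u). {x, x + u}) ` ?A"
  proof
    fix e assume "e \<in> short_pairs n M"
    then obtain x y where e: "x \<in> igrid n" "y \<in> igrid n" "e = {x, y}" "x \<noteq> y" "sup_norm (prim (y - x)) \<le> M"
      by (auto simp: short_pairs_def)
    then have "(x, y - x) \<in> ?A" using diff_vecs by (auto simp: short_vectors_def)
    moreover have "e = (\<lambda>(x, u). {x, x + u}) (x, y - x)" using e(3) by simp
    ultimately show "e \<in> (\<lambda>(x, u). {x, x + u}) ` ?A" by blast
  qed
  have "card (short_pairs n M) \<le> card ?A" by (rule surj_card_le[OF fin sub])
  then have "real (card (short_pairs n M)) \<le> real (card (igrid n)) * real (card (short_vectors n M))"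
    by (simp add: card_cartesian_product flip: of_nat_mult)
  also have "\<dots> \<le> real n ^ 2 * (24 * real n * real M)"
    unfolding card_igrid by (rule mult_left_mono[OF card_short_vectors]) simp
  finally show ?thesis .
qed

text \<open>The first two points have at most \<open>9 * n ^ 2\<close> differences, and since they
  form a long pair, at most \<open>2 * n / M\<close> vectors lead to the third.\<close>

lemma card_collinear_triples:
  assumes M: "M \<ge> 1"
  shows "real (card (collinear_triples n M)) \<le> real n ^ 2 * (18 * real n ^ 3 / real M)"
proof -
  define L where "L = {u \<in> vecs n. sup_norm (prim u) > M}"
  let ?A = "igrid n \<times> (SIGMA u:L. parallels n u)"
  have finL: "finite L" using finite_vecs by (simp add: L_def)
  have finP: "finite (parallels n u)" if "u \<in> L" for u
    using card_parallels(1)[of u n] that by (simp add: L_def)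
  then have fin: "finite ?A" using finL by (intro finite_cartesian_product finite_SigmaI) simp_all
  have sub: "collinear_triples n M \<subseteq> (\<lambda>(x, u, v). {x, x + u, x + v}) ` ?A"
  proof
    fix e assume "e \<in> collinear_triples n M"
    then obtain x y z where e: "e = {x, y, z}" "cross (y - x) (z - x) = 0" "{x, y, z} \<subseteq> igrid n"
        "card {x, y, z} = 3" "long M e"
      by (auto simp: collinear_triples_def)
    have d: "x \<noteq> y" "x \<noteq> z" using e(4) by (auto simp: card_insert_if split: if_splits)
    then have "y - x \<in> vecs n" "z - x \<in> vecs n" "sup_norm (prim (y - x)) > M"
      using e diff_vecs by (auto simp: long_def)
    then have "(x, y - x, z - x) \<in> ?A" using e by (auto simp: L_def parallels_def)
    moreover have "e = (\<lambda>(x, u, v). {x, x + u, x + v}) (x, y - x, z - x)" using e(1) by simp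
    ultimately show "e \<in> (\<lambda>(x, u, v). {x, x + u, x + v}) ` ?A" by blast
  qed
  have "real (card (SIGMA u:L. parallels n u)) = (\<Sum>u\<in>L. real (card (parallels n u)))"
    using finL finP by (subst card_SigmaI) simp_all
  also have "\<dots> \<le> real (card L) * (2 * real n / real M)"
  proof (rule sum_bounded_above)
    fix u assume u: "u \<in> L"
    then have "real (card (parallels n u)) \<le> 2 * real n / real (sup_norm (prim u))"
      by (intro card_parallels(2)) (simp add: L_def)
    also have "\<dots> \<le> 2 * real n / real M" using u M by (intro divide_left_mono) (auto simp: L_def)
    finally show "real (card (parallels n u)) \<le> 2 * real n / real M" .
  qed
  also have "\<dots> \<le> (9 * real n ^ 2) * (2 * real n / real M)"
  proof (rule mult_right_mono)
    have "card L \<le> card (vecs n)" by (rule card_mono) (auto simp: L_def finite_vecs)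
    then show "real (card L) \<le> 9 * real n ^ 2" using card_vecs[of n] by linarith
  qed simp
  finally have S: "real (card (SIGMA u:L. parallels n u)) \<le> (9 * real n ^ 2) * (2 * real n / real M)" .
  have "card (collinear_triples n M) \<le> card ?A" by (rule surj_card_le[OF fin sub])
  then have "real (card (collinear_triples n M)) \<le> real (card (igrid n)) * real (card (SIGMA u:L. parallels n u))"
    by (simp add: card_cartesian_product flip: of_nat_mult)
  also have "\<dots> \<le> real n ^ 2 * ((9 * real n ^ 2) * (2 * real n / real M))"
    unfolding card_igrid by (rule mult_left_mono[OF S]) simp
  finally show ?thesis by (simp add: power2_eq_square power3_eq_cube mult_ac)
qed

section \<open>Sets with distinct slopes\<close>

definition embed :: "int \<times> int \<Rightarrow> real \<times> real" where
  "embed u = (real_of_int (fst u), real_of_int (snd u))"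

lemma inj_embed: "inj_on embed W"
  by (auto simp: inj_on_def embed_def prod_eq_iff)

lemma embed_igrid: "embed ` igrid n \<subseteq> grid n"
proof
  fix x assume "x \<in> embed ` igrid n"
  then obtain a b where ab: "1 \<le> a" "a \<le> int n" "1 \<le> b" "b \<le> int n" "x = (real_of_int a, real_of_int b)"
    by (auto simp: embed_def igrid_def)
  then have "x = (\<lambda>(i, j). (real i, real j)) (nat a, nat b)" "(nat a, nat b) \<in> {1..n} \<times> {1..n}" by auto
  then show "x \<in> grid n" unfolding grid_def by blast
qed

lemma slope_embed_cross:
  assumes "slope (embed p) (embed q) = slope (embed p') (embed q')"
  shows "cross (q - p) (q' - p') = 0"
proof (cases "fst p = fst q")
  case True
  then have "fst p' = fst q'" using assms by (auto simp: slope_def embed_def split: if_splits)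
  then show ?thesis using True by (simp add: cross_def)
next
  case False
  then have ne: "fst p' \<noteq> fst q'" using assms by (auto simp: slope_def embed_def split: if_splits)
  have "real_of_int (snd q - snd p) / real_of_int (fst q - fst p)
      = real_of_int (snd q' - snd p') / real_of_int (fst q' - fst p')"
    using assms False ne by (simp add: slope_def embed_def)
  then have "real_of_int ((fst q - fst p) * (snd q' - snd p') - (snd q - snd p) * (fst q' - fst p')) = 0"
    using False ne by (simp add: frac_eq_eq algebra_simps)
  then show ?thesis unfolding of_int_eq_0_iff by (simp add: cross_def)
qed

text \<open>Without short pairs every subset of \<open>W\<close> is long, so the restriction to
  \<open>long\<close> in the other two families loses nothing. Two parallel pairs with a common
  point give a collinear triple, disjoint ones a trapezoid.\<close>

lemma distinct_slopes_embed:
  assumes W: "W \<subseteq> igrid n"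
    and short: "\<And>e. e \<in> short_pairs n M \<Longrightarrow> \<not> e \<subseteq> W"
    and col: "\<And>e. e \<in> collinear_triples n M \<Longrightarrow> \<not> e \<subseteq> W"
    and trap: "\<And>e. e \<in> trapezoids n M \<Longrightarrow> \<not> e \<subseteq> W"
  shows "distinct_slopes (embed ` W)"
proof -
  have long: "long M e" if "e \<subseteq> W" for e
    unfolding long_def
  proof (intro ballI impI, rule ccontr)
    fix x y assume xy: "x \<in> e" "y \<in> e" "x \<noteq> y" "\<not> sup_norm (prim (y - x)) > M"
    then have m: "x \<in> igrid n" "y \<in> igrid n" "sup_norm (prim (y - x)) \<le> M" using that W by auto
    have "{x, y} \<in> short_pairs n M" unfolding short_pairs_def using m xy(3) by blast
    moreover have "{x, y} \<subseteq> W" using xy that by auto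
    ultimately show False using short by blast
  qed
  have triple: False if "x \<in> W" "y \<in> W" "z \<in> W" "distinct [x, y, z]" "cross (y - x) (z - x) = 0" for x y z
  proof -
    have s: "{x, y, z} \<subseteq> W" using that by auto
    have "card {x, y, z} = 3" using that(4) by simp
    then have "{x, y, z} \<in> collinear_triples n M"
      unfolding collinear_triples_def using s W long[OF s] that(5) by blast
    then show False using col s by blast
  qed
  have "cross (q - p) (q' - p') \<noteq> 0"
    if m: "p \<in> W" "q \<in> W" "p' \<in> W" "q' \<in> W" and ne: "p \<noteq> q" "p' \<noteq> q'" "{p, q} \<noteq> {p', q'}" for p q p' q'
  proof
    assume cr: "cross (q - p) (q' - p') = 0"
    consider "p = p'" | "p = q'" | "q = p'" | "q = q'" | "distinct [p, q, p', q']" using ne by auto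
    then show False
    proof cases
      case 1
      have "distinct [p, q, q']" using ne 1 by auto
      then show False using triple[OF m(1,2,4)] cr 1 by simp
    next
      case 2
      have "distinct [p, q, p']" using ne 2 by auto
      moreover have "cross (q - p) (p' - p) = 0" using cr 2 cross_swap(1)[of "q - p" p p'] by simp
      ultimately show False using triple[OF m(1,2,3)] by simp
    next
      case 3
      have "distinct [q, p, q']" using ne 3 by auto
      moreover have "cross (p - q) (q' - q) = 0" using cr 3 cross_swap(2)[of p q "q' - q"] by simp
      ultimately show False using triple[OF m(2,1,4)] by simp
    next
      case 4
      have "distinct [q, p, p']" using ne 4 by auto
      moreover have "cross (p - q) (p' - q) = 0"
        using cr 4 cross_swap(2)[of p q "q - p'"] cross_swap(1)[of "p - q" p' q] by simp
      ultimately show False using triple[OF m(2,1,3)] by simp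
    next
      case 5
      have s: "{p, q, p', q'} \<subseteq> W" using m by simp
      have "card {p, q, p', q'} = 4" by (rule distinct_card4[THEN iffD2, OF 5])
      then have "{p, q, p', q'} \<in> trapezoids n M"
        unfolding trapezoids_def using s W long[OF s] cr by blast
      then show False using trap s by blast
    qed
  qed
  then have ne: "slope (embed p) (embed q) \<noteq> slope (embed p') (embed q')"
    if "p \<in> W" "q \<in> W" "p' \<in> W" "q' \<in> W" "p \<noteq> q" "p' \<noteq> q'" "{p, q} \<noteq> {p', q'}" for p q p' q'
    using that slope_embed_cross by metis
  show ?thesis
    unfolding distinct_slopes_def
  proof (intro ballI impI)
    fix P Q P' Q'
    assume "P \<in> embed ` W" "Q \<in> embed ` W" "P' \<in> embed ` W" "Q' \<in> embed ` W"
      and d: "P \<noteq> Q" "P' \<noteq> Q'" "{P, Q} \<noteq> {P', Q'}"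
    then obtain p q p' q' where m: "p \<in> W" "q \<in> W" "p' \<in> W" "q' \<in> W"
      and E: "P = embed p" "Q = embed q" "P' = embed p'" "Q' = embed q'" by (elim imageE) (rule that)
    have "{p, q} \<noteq> {p', q'}"
    proof
      assume "{p, q} = {p', q'}"
      then have "embed ` {p, q} = embed ` {p', q'}" by (rule arg_cong)
      then show False using d(3) E by simp
    qed
    then show "slope P Q \<noteq> slope P' Q'" using ne[OF m] d(1,2) E by metis
  qed
qed

text \<open>
  With density \<open>p = \<tau> / (n powr (4/3) * ln n powr (1/3))\<close> and threshold \<open>M\<close> about \<open>n powr (1/3)\<close> for
  short pairs, the expected numbers of short pairs, collinear triples and short cycles per chosen point
  are at most powers of \<open>\<tau>\<close> with exponent at most 11 times a negative power of \<open>ln n\<close> with exponent at least \<open>1/3\<close>;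
  \<open>\<tau> = ln n powr (1/40)\<close> makes all of them small, while the degrees are of order \<open>\<tau> ^ 3\<close>, whose
  logarithm is of order \<open>ln (ln n)\<close>.
\<close>

lemma distinct_slopes_lower_bound:
  "\<exists>c>0. eventually (\<lambda>n. \<exists>P. P \<subseteq> grid n \<and> distinct_slopes P \<and>
      real (card P) \<ge> c * (real n powr (2/3) * ln (ln (real n)) powr (1/3) / ln (real n) powr (1/3))) at_top"
proof -
  obtain c D0 :: real where c: "c > 0" and uncr:
    "\<forall>D\<ge>D0. \<forall>U (E::(int \<times> int) set set). uncrowded_hypergraph U E \<longrightarrow> (\<forall>e\<in>E. card e = 4) \<longrightarrow>
      (\<forall>u\<in>U. real (card {e\<in>E. u \<in> e}) \<le> D) \<longrightarrow>
     (\<exists>S\<subseteq>U. indep E S \<and> real (card S) \<ge> c * real (card U) * (ln D / D) powr (1/3))"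
    using uncrowded_independent_log[where 'a = "int \<times> int"] by (elim exE conjE) (rule that)
  define p where "p n = ln (real n) powr (1/40) / (real n powr (4/3) * ln (real n) powr (1/3))" for n :: nat
  \<comment> \<open>\<open>3072 = 32 * 96\<close>: this is \<open>32 * d1 n * p n ^ 3\<close>, in
    which the powers of \<open>n\<close> and the factor \<open>ln n\<close> cancel.\<close>
  define D where "D n = 3072 * ln (real n) powr (3/40)" for n :: nat
  define d1 where "d1 n = 96 * real n ^ 4 * ln (real n)" for n :: nat
  define d2 where "d2 n = 3 * real n powr (8/3)" for n :: nat
  define b2 where "b2 n = 48 * real n powr (4/3)" for n :: nat
  define b3 where "b3 n = 18 * real n powr (8/3)" for n :: nat
  define T where "T n = real n powr (2/3) * ln (ln (real n)) powr (1/3) / ln (real n) powr (1/3)" for n :: nat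
  \<comment> \<open>\<open>1 / 40960\<close> is \<open>(3 / 40) / 3072\<close>, from
    \<open>ln (D n) \<ge> 3 / 40 * ln (ln n)\<close>; the 4 comes from the lower bound
    \<open>p n * n ^ 2 / 4\<close> for the number of points.\<close>
  define k :: real where "k = (1 / 40960) powr (1/3) / 4"
  have "eventually (\<lambda>n. D n \<ge> D0) at_top" unfolding D_def by real_asymp
  moreover have "eventually (\<lambda>n. 0 < p n \<and> p n \<le> 1) at_top"
    by (rule eventually_conj; unfold p_def; real_asymp)
  moreover have "eventually (\<lambda>n. 32 * d1 n * p n ^ 3 \<le> D n) at_top"
    unfolding eventually_sequentially
  proof (intro exI[of _ 3] allI impI)
    fix n :: nat assume n: "3 \<le> n"
    then have l: "ln (real n) > 0" by simp
    have "(real n powr (4/3)) ^ 3 = real n ^ 4"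
      using n powr_power[of "real n" "4/3" 3] by (simp add: powr_numeral)
    moreover have "(ln (real n) powr (1/3)) ^ 3 = ln (real n)"
      using l powr_power[of "ln (real n)" "1/3" 3] by simp
    moreover have "(ln (real n) powr (1/40)) ^ 3 = ln (real n) powr (3/40)"
      using l powr_power[of "ln (real n)" "1/40" 3] by simp
    ultimately have "p n ^ 3 = ln (real n) powr (3/40) / (real n ^ 4 * ln (real n))"
      unfolding p_def power_divide power_mult_distrib by simp
    then show "32 * d1 n * p n ^ 3 \<le> D n"
      using n l by (simp add: d1_def D_def)
  qed
  moreover have "eventually (\<lambda>n. 2 * real n powr (8/3) + 48 * real n ^ 2 * (2 * ln (real n)) \<le> d2 n) at_top"
    unfolding d2_def by real_asymp
  moreover have "eventually (\<lambda>n. b2 n * p n + b3 n * p n ^ 2 + 16 * d1 n * d2 n * p n ^ 5 + 64 * d1 n * (6 * real n) * p n ^ 4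
       + 64 * d1 n ^ 2 * d2 n * p n ^ 8 + 256 * d1 n ^ 3 * d2 n * p n ^ 11 \<le> 1 / 4) at_top"
    unfolding b2_def p_def b3_def d1_def d2_def by real_asymp
  \<comment> \<open>\<open>D n powr (1/3)\<close> contains the factor
    \<open>ln n powr (1/40)\<close> by which \<open>p n\<close> was raised. The two cancel, and only
    \<open>ln (D n)\<close> remains as a gain.\<close>
  moreover have "eventually (\<lambda>n. p n * real n ^ 2 / 4 * (ln (D n) / D n) powr (1/3) \<ge> k * T n) at_top"
  proof -
    have "eventually (\<lambda>n. ln (ln (real n)) > 0) at_top" by real_asymp
    moreover have "eventually (\<lambda>n::nat. n \<ge> 3) at_top" by (rule eventually_ge_at_top)
    ultimately show ?thesis
    proof eventually_elim
      case (elim n)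
      define l where "l = ln (real n)"
      have l: "l > 0" "ln l > 0" using elim by (simp_all add: l_def)
      have n: "real n > 0" using elim by simp
      have lnD: "ln (D n) = ln 3072 + 3 / 40 * ln l"
        using l by (simp add: D_def l_def[symmetric] ln_mult ln_powr)
      have "(1 / 40960 * (ln l / l powr (3/40))) powr (1/3) \<le> (ln (D n) / D n) powr (1/3)"
      proof (rule powr_mono2)
        have "1 / 40960 * (ln l / l powr (3/40)) = (3 / 40 * ln l) / D n"
          using l by (simp add: D_def l_def[symmetric])
        also have "\<dots> \<le> ln (D n) / D n"
          unfolding lnD using l by (intro divide_right_mono) (auto simp: D_def l_def[symmetric])
        finally show "1 / 40960 * (ln l / l powr (3/40)) \<le> ln (D n) / D n" .
      qed (use l in auto)
      also have "(1 / 40960 * (ln l / l powr (3/40))) powr (1/3)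
          = (1 / 40960) powr (1/3) * (ln l powr (1/3) / l powr (1/40))"
        using l by (simp only: powr_mult powr_divide powr_powr) simp
      finally have "p n * real n ^ 2 / 4 * ((1 / 40960) powr (1/3) * (ln l powr (1/3) / l powr (1/40)))
          \<le> p n * real n ^ 2 / 4 * (ln (D n) / D n) powr (1/3)"
        using l by (intro mult_left_mono) (auto simp: p_def l_def[symmetric])
      moreover have "real n ^ 2 / real n powr (4/3) = real n powr (2/3)"
        using n powr_diff[of "real n" 2 "4/3"] by (simp add: powr_numeral)
      then have "p n * real n ^ 2 / 4 * ((1 / 40960) powr (1/3) * (ln l powr (1/3) / l powr (1/40))) = k * T n"
        using l n by (simp add: p_def T_def k_def l_def[symmetric] field_simps)
      ultimately show ?case by simp
    qed
  qed
  moreover have "eventually (\<lambda>n::nat. n \<ge> 3) at_top" by (rule eventually_ge_at_top)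
  ultimately have "eventually (\<lambda>n. \<exists>P. P \<subseteq> grid n \<and> distinct_slopes P \<and> real (card P) \<ge> c * k * T n) at_top"
  proof eventually_elim
    case (elim n)
    define M where "M = nat \<lceil>real n powr (1/3)\<rceil>"
    have n: "real n \<ge> 3" using elim(7) by simp
    have n1: "real n powr (1/3) \<ge> 1" using n by (simp add: ge_one_powr_ge_zero)
    have M: "real n powr (1/3) \<le> real M" "real M \<le> 2 * real n powr (1/3)"
      unfolding M_def using n1 by linarith+
    have M1: "M \<ge> 1" using M(1) n1 by linarith
    have ln1: "ln (real n) \<ge> 1"
      using n exp_le by (subst ln_ge_iff) auto
    \<comment> \<open>\<open>harm n - ln n\<close> decreases from its value 1 at
      \<open>n = 1\<close>, so \<open>harm n \<le> 1 + ln n\<close>.\<close>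
    have harm: "harm n \<le> 2 * ln (real n)" using euler_mascheroni_sequence_decreasing[of 1 n] ln1 elim(7) by (simp add: harm_expand)
    let ?V = "igrid n" and ?H = "trapezoids n M"
    have "\<exists>W\<subseteq>?V. real (card W) \<ge> p n * real (card ?V) / 4
      \<and> (\<forall>X\<in>short_pairs n M \<union> collinear_triples n M. \<not> X \<subseteq> W)
      \<and> uncrowded_hypergraph W {e\<in>?H. e \<subseteq> W}
      \<and> (\<forall>u\<in>W. real (card {e\<in>{e\<in>?H. e \<subseteq> W}. u \<in> e}) \<le> 32 * d1 n * p n ^ 3)"
    proof (rule sparse_uncrowded[where ?d2.0 = "d2 n" and ?d3.0 = "6 * real n" and ?b2.0 = "b2 n" and ?b3.0 = "b3 n"])
      show "0 < p n" "p n \<le> 1" using elim(2) by auto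
      show "e \<subseteq> ?V \<and> card e = 4" if "e \<in> ?H" for e using that by (auto simp: trapezoids_def)
      show "X \<subseteq> ?V \<and> card X = 2" if "X \<in> short_pairs n M" for X
        using that unfolding short_pairs_def by (elim CollectE bexE conjE) simp
      show "X \<subseteq> ?V \<and> card X = 3" if "X \<in> collinear_triples n M" for X using that by (auto simp: collinear_triples_def)
      have "24 * real n * real M \<le> 24 * real n * (2 * real n powr (1/3))" using M(2) by (intro mult_left_mono) auto
      also have "\<dots> = b2 n" using n powr_mult_base[of "real n" "1/3"] by (simp add: b2_def)
      finally show "real (card (short_pairs n M)) \<le> real (card ?V) * b2 n"
        using card_short_pairs[of n M] mult_left_mono[of "24 * real n * real M" "b2 n" "real n ^ 2"]
        by (simp add: card_igrid)
      have n83: "real n ^ 3 / real M \<le> real n powr (8/3)"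
      proof -
        have "real n ^ 3 / real M \<le> real n ^ 3 / real n powr (1/3)"
          using M n1 M1 n by (intro divide_left_mono mult_pos_pos) auto
        also have "\<dots> = real n powr (3 - 1/3)"
          unfolding powr_diff using n by simp
        finally show ?thesis by simp
      qed
      then show "real (card (collinear_triples n M)) \<le> real (card ?V) * b3 n"
        using card_collinear_triples[OF M1, of n] mult_left_mono[of "18 * real n ^ 3 / real M" "b3 n" "real n ^ 2"]
        by (simp add: card_igrid b3_def)
      show "real (card {e\<in>?H. x \<in> e}) \<le> d1 n" for x
      proof -
        have "48 * real n ^ 4 * harm n \<le> 48 * real n ^ 4 * (2 * ln (real n))" using harm by (intro mult_left_mono) auto
        also have "\<dots> = d1 n" by (simp add: d1_def)
        finally show ?thesis using trapezoid_degree[of n M x] by linarith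
      qed
      show "real (card {e\<in>?H. {x, y} \<subseteq> e}) \<le> d2 n" if "x \<in> ?V" "y \<in> ?V" "x \<noteq> y" for x y
      proof -
        have "48 * real n ^ 2 * harm n \<le> 48 * real n ^ 2 * (2 * ln (real n))" using harm by (intro mult_left_mono) auto
        moreover have "2 * real n ^ 3 / real M \<le> 2 * real n powr (8/3)" using n83 by simp
        ultimately show ?thesis using trapezoid_codegree2[OF that M1] elim(4) by linarith
      qed
      show "real (card {e\<in>?H. {x, y, z} \<subseteq> e}) \<le> 6 * real n"
        if "x \<in> ?V" "y \<in> ?V" "z \<in> ?V" "distinct [x, y, z]" for x y z
        by (rule trapezoid_codegree3[OF that])
    qed (use elim(5) n ln1 in \<open>auto simp: d1_def d2_def\<close>)
    then obtain W where W: "W \<subseteq> ?V" "real (card W) \<ge> p n * real n ^ 2 / 4"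
      "\<And>X. X \<in> short_pairs n M \<union> collinear_triples n M \<Longrightarrow> \<not> X \<subseteq> W"
      "uncrowded_hypergraph W {e\<in>?H. e \<subseteq> W}"
      "\<And>u. u \<in> W \<Longrightarrow> real (card {e\<in>{e\<in>?H. e \<subseteq> W}. u \<in> e}) \<le> 32 * d1 n * p n ^ 3"
      unfolding card_igrid by blast
    have c4: "\<forall>e\<in>{e\<in>?H. e \<subseteq> W}. card e = 4" by (simp add: trapezoids_def)
    have deg: "\<forall>u\<in>W. real (card {e\<in>{e\<in>?H. e \<subseteq> W}. u \<in> e}) \<le> D n"
      using W(5) elim(3) by (meson order_trans)
    obtain S where S: "S \<subseteq> W" "indep {e\<in>?H. e \<subseteq> W} S"
        "real (card S) \<ge> c * real (card W) * (ln (D n) / D n) powr (1/3)"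
      using uncr[THEN spec, THEN mp, OF elim(1), THEN spec, THEN spec, THEN mp, OF W(4), THEN mp, OF c4, THEN mp, OF deg]
      by (elim exE conjE) (rule that)
    have "distinct_slopes (embed ` S)"
    proof (rule distinct_slopes_embed)
      show "S \<subseteq> igrid n" using S(1) W(1) by blast
      show "\<not> e \<subseteq> S" if "e \<in> short_pairs n M" for e using W(3)[of e] that S(1) by blast
      show "\<not> e \<subseteq> S" if "e \<in> collinear_triples n M" for e using W(3)[of e] that S(1) by blast
      show "\<not> e \<subseteq> S" if "e \<in> trapezoids n M" for e using S(1,2) that unfolding indep_def by blast
    qed
    moreover have "embed ` S \<subseteq> grid n" using embed_igrid[of n] S(1) W(1) by blast
    moreover have "c * k * T n \<le> real (card (embed ` S))"
    proof -
      have "c * k * T n = c * (k * T n)" by simp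
      also have "\<dots> \<le> c * (p n * real n ^ 2 / 4 * (ln (D n) / D n) powr (1/3))"
        using elim(6) c by (intro mult_left_mono) auto
      also have "\<dots> \<le> c * (real (card W) * (ln (D n) / D n) powr (1/3))"
        using W(2) c by (intro mult_left_mono mult_right_mono) auto
      also have "\<dots> \<le> real (card S)" using S(3) by (simp add: mult.assoc)
      also have "card S = card (embed ` S)" by (rule card_image[OF inj_embed, symmetric])
      finally show ?thesis .
    qed
    ultimately show ?case by blast
  qed
  then show ?thesis using c unfolding T_def by (intro exI[of _ "c * k"]) (simp add: k_def)
qed

theorem theorem1p1:
  shows "(\<lambda>n. real (g n)) \<in>
           \<Omega>(\<lambda>n. real n powr (2/3) * ln (ln (real n)) powr (1/3) / ln (real n) powr (1/3))
       \<and> (\<exists>c>0. \<exists>n0::nat. \<forall>n\<ge>n0. \<exists>P. P \<subseteq> grid n \<and> distinct_slopes P \<and>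
           real (card P) \<ge>
             c * (real n powr (2/3) * ln (ln (real n)) powr (1/3) / ln (real n) powr (1/3)))"
proof -
  obtain c where c: "c > 0" and ev: "eventually (\<lambda>n. \<exists>P. P \<subseteq> grid n \<and> distinct_slopes P \<and>
      real (card P) \<ge> c * (real n powr (2/3) * ln (ln (real n)) powr (1/3) / ln (real n) powr (1/3))) at_top"
    using distinct_slopes_lower_bound by blast
  show ?thesis
  proof
    show "(\<lambda>n. real (g n)) \<in>
           \<Omega>(\<lambda>n. real n powr (2/3) * ln (ln (real n)) powr (1/3) / ln (real n) powr (1/3))"
    proof (rule landau_omega.bigI[OF c])
      show "eventually (\<lambda>n. c * norm (real n powr (2/3) * ln (ln (real n)) powr (1/3) / ln (real n) powr (1/3))
          \<le> norm (real (g n))) at_top"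
        using ev
      proof eventually_elim
        case (elim n)
        then obtain P where P: "P \<subseteq> grid n" "distinct_slopes P"
          "real (card P) \<ge> c * (real n powr (2/3) * ln (ln (real n)) powr (1/3) / ln (real n) powr (1/3))" by blast
        have "real (card P) \<le> real (g n)" using g_upper[OF P(1,2)] by simp
        then show ?case using P(3) by simp
      qed
    qed
    show "\<exists>c>0. \<exists>n0::nat. \<forall>n\<ge>n0. \<exists>P. P \<subseteq> grid n \<and> distinct_slopes P \<and>
           real (card P) \<ge>
             c * (real n powr (2/3) * ln (ln (real n)) powr (1/3) / ln (real n) powr (1/3))"
      using c ev unfolding eventually_sequentially by blast
  qed
qed

end
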